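(* Let $\mathcal A\subset\mathcal D'(\mathbb R,X)$ be real-linear and positive-invariant with $\mathcal A*L_c^\infty(\mathbb R,\mathbb R)\subset\mathcal A$, and let $n\in\mathbb N$. Then: (i) If $\mathcal A$ satisfies $(\Delta')$, then $\widetilde{\mathcal M}^n\mathcal A=\mathcal A+\mathcal A^{(n)}$. (ii) If $\mathcal A\subset L^1_{loc}(\mathbb R,X)$ satisfies $(\Delta)$, then $\mathcal M^n\mathcal A=\mathcal A+\mathcal A^{(n)}_{Loc}$.
   Context: $X$ is a Banach space over $\mathbb K=\mathbb R$ or $\mathbb C$. $\mathcal D(\mathbb R,\mathbb K)$: Schwartz test functions; $\mathcal D'(\mathbb R,X)$: linear continuous maps $\mathcal D(\mathbb R,\mathbb K)\to X$; locally Bochner integrable functions are identified with the distributions they define. $L_c^\infty(\mathbb R,\mathbb R)$: functions in $L^\infty(\mathbb R,\mathbb R)$ with compact support; $\mathcal A*L^\infty_c=\{T*g:T\in\mathcal A,g\in L_c^\infty(\mathbb R,\mathbb R)\}$ (distribution convolution). Translates: $f_a(t)=f(t+a)$, $T_a(\varphi)=T(\varphi_{-a})$; $\Delta_sf=f_s-f$, $\Delta_sT=T_s-T$. Real-linear: $sF+tG\in\mathcal A$ for $F,G\in\mathcal A$, $s,t\in\mathbb R$. Positive-invariant: $F_a\in\mathcal A$ for $F\in\mathcal A$, $a\ge0$. For $h\ne0$: $M_hf(t)=\frac1h\int_0^hf(t+s)\,ds$, $\widetilde M_hT(\varphi)=T(M_{-h}\varphi)$. $\mathcal M\mathcal A=\{f\in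 L^1_{loc}(\mathbb R,X):M_hf\in\mathcal A\ \forall h>0\}$, $\widetilde{\mathcal M}\mathcal A=\{T\in\mathcal D'(\mathbb R,X):\widetilde M_hT\in\mathcal A\ \forall h>0\}$, with iterates $\mathcal M^n\mathcal A=\mathcal M(\mathcal M^{n-1}\mathcal A)$, $\widetilde{\mathcal M}^n\mathcal A=\widetilde{\mathcal M}(\widetilde{\mathcal M}^{n-1}\mathcal A)$. $(\Delta)$: whenever $\phi\in L^1_{loc}(\mathbb R,X)$ and $\Delta_s\phi\in\mathcal A$ for all $s>0$, then $\phi-M_h\phi\in\mathcal A$ for all $h>0$. $(\Delta')$: whenever $T\in\mathcal D'(\mathbb R,X)$ and $\Delta_sT\in\mathcal A$ for all $s>0$, then $T-\widetilde M_hT\in\mathcal A$ for all $h>0$. $\mathcal A^{(n)}=\{T^{(n)}:T\in\mathcal A\}$ (distribution derivatives). $\mathcal A^{(n)}_{Loc}=\{\phi\in L^1_{loc}(\mathbb R,X):$ there is $\psi\in\mathcal A\cap W^{1,n}_{loc}(\mathbb R,X)$ with $\phi=\psi^{(n)}$ a.e.$\}$, where $W^{1,n}_{loc}(\mathbb R,X)$ is the set of $f\in C^{n-1}(\mathbb R,X)$ such that $f^{(n-1)}$ is locally absolutely continuous and differentiable a.e. (equivalently, $f$ is a distribution with $f^{(n)}\in L^1_{loc}$). *)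

theory Defs
  imports "HOL-Analysis.Analysis"
begin

text \<open>
  The scalar field \<open>\<K>\<close> is a type \<open>'k\<close> of sort \<open>{real_normed_field, euclidean_space}\<close>: a commutative
  finite-dimensional real division algebra with multiplicative norm. By Frobenius' theorem such a
  type is isometrically isomorphic to \<open>real\<close> or to \<open>complex\<close>, and both are instances of the sort.
  A Banach space over \<open>\<K>\<close> is a type of class \<open>banach\<close> with a \<open>\<K>\<close>-scalar multiplication
  satisfying the following locale predicate.
\<close>

locale normed_space_over = vector_space scl
  for scl :: "'k::real_normed_field \<Rightarrow> 'x::real_normed_vector \<Rightarrow> 'x" +
  assumes norm_scale: "norm (scl c x) = norm c * norm x"
    and scale_of_real: "scl (of_real r) x = r *\<^sub>R x"

section \<open>Bochner integral in arbitrary Banach spaces\<close>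

text \<open>
  The library's \<^const>\<open>has_bochner_integral\<close> is restricted to second countable spaces. This is the
  same definition without that restriction; since \<open>s i\<close> takes finitely many values, the
  integrands \<open>f - s i\<close> are still Borel measurable, and a subsequence of \<open>s\<close> converges to \<open>f\<close>
  almost everywhere, so \<open>f\<close> is strongly measurable.
\<close>

definition has_bochner :: "'a measure \<Rightarrow> ('a \<Rightarrow> 'b::real_normed_vector) \<Rightarrow> 'b \<Rightarrow> bool" where
  "has_bochner M f x \<longleftrightarrow> f \<in> borel_measurable M \<and>
     (\<exists>s. (\<forall>i::nat. Bochner_Integration.simple_bochner_integrable M (s i)) \<and>
          (\<lambda>i. \<integral>\<^sup>+t. norm (f t - s i t) \<partial>M) \<longlonglongrightarrow> 0 \<and>
          (\<lambda>i. Bochner_Integration.simple_bochner_integral M (s i)) \<longlonglongrightarrow> x)"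

definition bochner_integrable :: "'a measure \<Rightarrow> ('a \<Rightarrow> 'b::real_normed_vector) \<Rightarrow> bool" where
  "bochner_integrable M f \<longleftrightarrow> (\<exists>x. has_bochner M f x)"

definition bochner_integral :: "'a measure \<Rightarrow> ('a \<Rightarrow> 'b::real_normed_vector) \<Rightarrow> 'b" where
  "bochner_integral M f = (THE x. has_bochner M f x)"

definition oriented_integral :: "real \<Rightarrow> real \<Rightarrow> (real \<Rightarrow> 'b::real_normed_vector) \<Rightarrow> 'b" where
  "oriented_integral a b f =
     (if a \<le> b then bochner_integral lebesgue (\<lambda>s. indicator {a..b} s *\<^sub>R f s)
      else - bochner_integral lebesgue (\<lambda>s. indicator {b..a} s *\<^sub>R f s))"

text \<open>
  Members of \<open>L1loc\<close> and \<open>Linf_c\<close> are functions, not classes modulo null sets; accordingly the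
  support condition in \<open>Linf_c\<close> is about the essential support. Classes in \<open>L\<^sup>1\<^sub>l\<^sub>o\<^sub>c\<close> are represented
  by regular distributions below.
\<close>

definition L1loc :: "(real \<Rightarrow> 'b::real_normed_vector) set" where
  "L1loc = {f. \<forall>a b. bochner_integrable lebesgue (\<lambda>t. indicator {a..b} t *\<^sub>R f t)}"

definition Linf_c :: "(real \<Rightarrow> real) set" where
  "Linf_c = {g \<in> borel_measurable lebesgue.
     (\<exists>C. AE t in lebesgue. \<bar>g t\<bar> \<le> C) \<and> (\<exists>R. AE t in lebesgue. R < \<bar>t\<bar> \<longrightarrow> g t = 0)}"

section \<open>Operations on functions\<close>

definition shift :: "real \<Rightarrow> (real \<Rightarrow> 'b) \<Rightarrow> real \<Rightarrow> 'b" where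
  "shift a f = (\<lambda>t. f (t + a))"

definition diff_op :: "real \<Rightarrow> (real \<Rightarrow> 'b::real_normed_vector) \<Rightarrow> real \<Rightarrow> 'b" where
  "diff_op s f = (\<lambda>t. shift s f t - f t)"

definition mean :: "real \<Rightarrow> (real \<Rightarrow> 'b::real_normed_vector) \<Rightarrow> real \<Rightarrow> 'b" where
  "mean h f = (\<lambda>t. (1 / h) *\<^sub>R oriented_integral 0 h (\<lambda>s. f (t + s)))"

definition vderiv :: "(real \<Rightarrow> 'b::real_normed_vector) \<Rightarrow> real \<Rightarrow> 'b" where
  "vderiv f = (\<lambda>t. vector_derivative f (at t))"

definition smooth :: "(real \<Rightarrow> 'b::real_normed_vector) \<Rightarrow> bool" where
  "smooth f \<longleftrightarrow> (\<forall>k t. (vderiv ^^ k) f differentiable (at t))"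

definition locally_abs_continuous :: "(real \<Rightarrow> 'b::real_normed_vector) \<Rightarrow> bool" where
  "locally_abs_continuous f \<longleftrightarrow>
     (\<forall>a b. \<forall>\<epsilon>>0. \<exists>\<delta>>0. \<forall>I::(real \<times> real) set.
        finite I \<and> (\<forall>(u, v)\<in>I. a \<le> u \<and> u \<le> v \<and> v \<le> b) \<and>
        pairwise (\<lambda>p q. disjnt {fst p<..<snd p} {fst q<..<snd q}) I \<and>
        (\<Sum>(u, v)\<in>I. v - u) < \<delta>
        \<longrightarrow> (\<Sum>(u, v)\<in>I. norm (f v - f u)) < \<epsilon>)"

text \<open>The space \<open>W\<^sup>1\<^sup>,\<^sup>n\<^sub>l\<^sub>o\<^sub>c\<close>, used for \<open>n \<ge> 1\<close> only.\<close>

definition W1loc :: "nat \<Rightarrow> (real \<Rightarrow> 'b::real_normed_vector) set" where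
  "W1loc n = {f. (\<forall>k<n - 1. \<forall>t. (vderiv ^^ k) f differentiable (at t)) \<and>
     continuous_on UNIV ((vderiv ^^ (n - 1)) f) \<and>
     locally_abs_continuous ((vderiv ^^ (n - 1)) f) \<and>
     (AE t in lebesgue. (vderiv ^^ (n - 1)) f differentiable (at t))}"

section \<open>Test functions\<close>

definition test_functions :: "(real \<Rightarrow> 'k::real_normed_field) set" where
  "test_functions = {\<phi>. smooth \<phi> \<and> compact (closure {t. \<phi> t \<noteq> 0})}"

definition test_functions_in :: "real set \<Rightarrow> (real \<Rightarrow> 'k::real_normed_field) set" where
  "test_functions_in K = {\<phi> \<in> test_functions. closure {t. \<phi> t \<noteq> 0} \<subseteq> K}"

text \<open>Openness in the Frechet space \<open>\<D>\<^sub>K\<close>, with seminorms \<open>max\<^sub>k\<^sub>\<le>\<^sub>N sup\<^sub>t |\<phi>\<^sup>(\<^sup>k\<^sup>)(t)|\<close>.\<close>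

definition open_in_test_functions_in ::
  "real set \<Rightarrow> (real \<Rightarrow> 'k::real_normed_field) set \<Rightarrow> bool" where
  "open_in_test_functions_in K U \<longleftrightarrow> U \<subseteq> test_functions_in K \<and>
     (\<forall>\<phi>\<in>U. \<exists>N. \<exists>\<epsilon>>0. \<forall>\<psi>\<in>test_functions_in K.
        (\<forall>k\<le>N. \<forall>t. norm ((vderiv ^^ k) \<psi> t - (vderiv ^^ k) \<phi> t) < \<epsilon>) \<longrightarrow> \<psi> \<in> U)"

text \<open>
  The inductive limit topology of \<open>\<D>(\<real>,\<K>)\<close> as in Rudin, Functional Analysis, Section 6.3: it has
  as a base the translates of the convex balanced sets whose trace on every \<open>\<D>\<^sub>K\<close> is open.
\<close>

definition test_neighbourhoods :: "(real \<Rightarrow> 'k::real_normed_field) set set" where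
  "test_neighbourhoods = {W. W \<subseteq> test_functions \<and>
     (\<forall>\<phi>\<in>W. \<forall>\<psi>\<in>W. \<forall>u\<in>{0..1}. (\<lambda>t. (1 - u) *\<^sub>R \<phi> t + u *\<^sub>R \<psi> t) \<in> W) \<and>
     (\<forall>\<phi>\<in>W. \<forall>c. norm c \<le> 1 \<longrightarrow> (\<lambda>t. c * \<phi> t) \<in> W) \<and>
     (\<forall>K. compact K \<longrightarrow> open_in_test_functions_in K (W \<inter> test_functions_in K))}"

definition test_topology :: "(real \<Rightarrow> 'k::real_normed_field) topology" where
  "test_topology = topology_generated_by
     {(\<lambda>w t. \<phi> t + w t) ` W | \<phi> W. \<phi> \<in> test_functions \<and> W \<in> test_neighbourhoods}"

section \<open>Distributions\<close>

text \<open>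
  A distribution is a map on all functions \<open>real \<Rightarrow> 'k\<close> with the default value \<open>0\<close> outside the test
  functions, so that equality of distributions is equality of HOL functions, and linear
  combinations are formed pointwise.
\<close>

definition distributions ::
  "('k::real_normed_field \<Rightarrow> 'x::real_normed_vector \<Rightarrow> 'x) \<Rightarrow> ((real \<Rightarrow> 'k) \<Rightarrow> 'x) set" where
  "distributions scl = {T.
     (\<forall>\<phi>. \<phi> \<notin> test_functions \<longrightarrow> T \<phi> = 0) \<and>
     (\<forall>\<phi>\<in>test_functions. \<forall>\<psi>\<in>test_functions. T (\<lambda>t. \<phi> t + \<psi> t) = T \<phi> + T \<psi>) \<and>
     (\<forall>\<phi>\<in>test_functions. \<forall>c. T (\<lambda>t. c * \<phi> t) = scl c (T \<phi>)) \<and>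
     continuous_map test_topology euclidean T}"

text \<open>The distribution defined by a locally Bochner integrable function.\<close>

definition regular ::
  "('k::real_normed_field \<Rightarrow> 'x::real_normed_vector \<Rightarrow> 'x) \<Rightarrow> (real \<Rightarrow> 'x) \<Rightarrow> (real \<Rightarrow> 'k) \<Rightarrow> 'x" where
  "regular scl f = (\<lambda>\<phi>. if \<phi> \<in> test_functions
     then bochner_integral lebesgue (\<lambda>t. scl (\<phi> t) (f t)) else 0)"

definition dist_shift ::
  "real \<Rightarrow> ((real \<Rightarrow> 'k::real_normed_field) \<Rightarrow> 'x::real_normed_vector) \<Rightarrow> (real \<Rightarrow> 'k) \<Rightarrow> 'x" where
  "dist_shift a T = (\<lambda>\<phi>. T (shift (- a) \<phi>))"

definition dist_diff ::
  "real \<Rightarrow> ((real \<Rightarrow> 'k::real_normed_field) \<Rightarrow> 'x::real_normed_vector) \<Rightarrow> (real \<Rightarrow> 'k) \<Rightarrow> 'x" where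
  "dist_diff s T = (\<lambda>\<phi>. dist_shift s T \<phi> - T \<phi>)"

definition dist_mean ::
  "real \<Rightarrow> ((real \<Rightarrow> 'k::real_normed_field) \<Rightarrow> 'x::real_normed_vector) \<Rightarrow> (real \<Rightarrow> 'k) \<Rightarrow> 'x" where
  "dist_mean h T = (\<lambda>\<phi>. if \<phi> \<in> test_functions then T (mean (- h) \<phi>) else 0)"

definition dist_deriv ::
  "nat \<Rightarrow> ((real \<Rightarrow> 'k::real_normed_field) \<Rightarrow> 'x::real_normed_vector) \<Rightarrow> (real \<Rightarrow> 'k) \<Rightarrow> 'x" where
  "dist_deriv n T = (\<lambda>\<phi>. if \<phi> \<in> test_functions then (- 1) ^ n *\<^sub>R T ((vderiv ^^ n) \<phi>) else 0)"

text \<open>\<open>(T * g)(\<phi>) = T\<^sub>t (\<integral> g(s) \<phi>(t + s) ds)\<close>\<close>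

definition dist_conv ::
  "((real \<Rightarrow> 'k::real_normed_field) \<Rightarrow> 'x::real_normed_vector) \<Rightarrow> (real \<Rightarrow> real) \<Rightarrow> (real \<Rightarrow> 'k) \<Rightarrow> 'x" where
  "dist_conv T g = (\<lambda>\<phi>. if \<phi> \<in> test_functions
     then T (\<lambda>t. bochner_integral lebesgue (\<lambda>s. g s *\<^sub>R \<phi> (t + s))) else 0)"

section \<open>Classes of distributions\<close>

definition real_linear ::
  "((real \<Rightarrow> 'k::real_normed_field) \<Rightarrow> 'x::real_normed_vector) set \<Rightarrow> bool" where
  "real_linear A \<longleftrightarrow> (\<forall>F\<in>A. \<forall>G\<in>A. \<forall>s t::real. (\<lambda>\<phi>. s *\<^sub>R F \<phi> + t *\<^sub>R G \<phi>) \<in> A)"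

definition positive_invariant ::
  "((real \<Rightarrow> 'k::real_normed_field) \<Rightarrow> 'x::real_normed_vector) set \<Rightarrow> bool" where
  "positive_invariant A \<longleftrightarrow> (\<forall>F\<in>A. \<forall>a\<ge>0. dist_shift a F \<in> A)"

definition class_sum ::
  "((real \<Rightarrow> 'k::real_normed_field) \<Rightarrow> 'x::real_normed_vector) set \<Rightarrow>
    ((real \<Rightarrow> 'k) \<Rightarrow> 'x) set \<Rightarrow> ((real \<Rightarrow> 'k) \<Rightarrow> 'x) set" where
  "class_sum A B = {(\<lambda>\<phi>. F \<phi> + G \<phi>) | F G. F \<in> A \<and> G \<in> B}"

definition dist_mean_class ::
  "('k::real_normed_field \<Rightarrow> 'x::real_normed_vector \<Rightarrow> 'x) \<Rightarrow>
    ((real \<Rightarrow> 'k) \<Rightarrow> 'x) set \<Rightarrow> ((real \<Rightarrow> 'k) \<Rightarrow> 'x) set" where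
  "dist_mean_class scl A = {T \<in> distributions scl. \<forall>h>0. dist_mean h T \<in> A}"

definition Delta' ::
  "('k::real_normed_field \<Rightarrow> 'x::real_normed_vector \<Rightarrow> 'x) \<Rightarrow> ((real \<Rightarrow> 'k) \<Rightarrow> 'x) set \<Rightarrow> bool" where
  "Delta' scl A \<longleftrightarrow> (\<forall>T\<in>distributions scl.
     (\<forall>s>0. dist_diff s T \<in> A) \<longrightarrow> (\<forall>h>0. (\<lambda>\<phi>. T \<phi> - dist_mean h T \<phi>) \<in> A))"

text \<open>
  Subsets of \<open>L\<^sup>1\<^sub>l\<^sub>o\<^sub>c\<close> are sets of regular distributions: a function \<open>f \<in> L1loc\<close> belongs to a class
  \<open>A\<close> if \<open>regular scl f \<in> A\<close>.
\<close>

definition mean_class ::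
  "('k::real_normed_field \<Rightarrow> 'x::real_normed_vector \<Rightarrow> 'x) \<Rightarrow>
    ((real \<Rightarrow> 'k) \<Rightarrow> 'x) set \<Rightarrow> ((real \<Rightarrow> 'k) \<Rightarrow> 'x) set" where
  "mean_class scl A = {regular scl f | f. f \<in> L1loc \<and> (\<forall>h>0. regular scl (mean h f) \<in> A)}"

definition Delta ::
  "('k::real_normed_field \<Rightarrow> 'x::real_normed_vector \<Rightarrow> 'x) \<Rightarrow> ((real \<Rightarrow> 'k) \<Rightarrow> 'x) set \<Rightarrow> bool" where
  "Delta scl A \<longleftrightarrow> (\<forall>f\<in>L1loc.
     (\<forall>s>0. regular scl (diff_op s f) \<in> A) \<longrightarrow>
     (\<forall>h>0. regular scl (\<lambda>t. f t - mean h f t) \<in> A))"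

definition deriv_Loc ::
  "('k::real_normed_field \<Rightarrow> 'x::real_normed_vector \<Rightarrow> 'x) \<Rightarrow> nat \<Rightarrow>
    ((real \<Rightarrow> 'k) \<Rightarrow> 'x) set \<Rightarrow> ((real \<Rightarrow> 'k) \<Rightarrow> 'x) set" where
  "deriv_Loc scl n A = {regular scl f | f. f \<in> L1loc \<and>
     (\<exists>\<psi>\<in>W1loc n. regular scl \<psi> \<in> A \<and> (AE t in lebesgue. f t = (vderiv ^^ n) \<psi> t))}"

end

theory Submission
  imports Defs
begin

text \<open>
  Write \<open>D\<close> for the distributional derivative and \<open>M h\<close> for the mean. The whole argument rests
  on \<open>D (M h T) = M h (D T) = (1/h) \<Delta> h T\<close>. It gives \<open>M h (D A) \<subseteq> A\<close> for a linear class \<open>A\<close> that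
  is invariant under positive translations, and this is the inclusion of \<open>A + D A\<close> in the mean
  class. Conversely, let all means of \<open>T\<close> lie in \<open>A\<close>, and let \<open>P\<close> be a primitive of \<open>T\<close>. Then
  \<open>\<Delta> s P = s (M s T)\<close> lies in \<open>A\<close> for all \<open>s > 0\<close>, the difference property puts \<open>Q = P - M 1 P\<close>
  into \<open>A\<close>, and \<open>T = M 1 T + D Q\<close> (\<open>means_in_decomposition\<close>).

  The difference property passes from \<open>A\<close> to the class of all \<open>T\<close> with means in \<open>A\<close>, so the
  decomposition can be iterated. It leaves sums of terms \<open>D^j F\<close> with \<open>F \<in> A\<close> and \<open>j \<le> n\<close>. They
  collapse to \<open>A + D^n A\<close>, since \<open>F - M 1 F\<close> is the derivative of the convolution of \<open>F\<close> with a
  ramp and therefore belongs to \<open>A\<close> and to \<open>D A\<close>: in \<open>D F = D (M 1 F) + D (F - M 1 F)\<close> the first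
  term is \<open>\<Delta> 1 F \<in> A\<close>, the second is a second derivative, and repeating the step raises its
  order arbitrarily (\<open>deriv_in_sum_with_higher_deriv\<close>).

  Both parts are cases of one statement about an ambient linear space \<open>R\<close> of distributions that
  contains the means and some primitive of each of its members, namely that the \<open>n\<close>-th mean
  class of \<open>A\<close> within \<open>R\<close> is \<open>A + (D^n A \<inter> R)\<close> (\<open>means_in_pow_eq\<close>). For the first part \<open>R\<close>
  consists of all distributions, and primitives are transposes of a continuous primitive
  operator on test functions (\<open>distribution_primitive\<close>). For the second part \<open>R\<close> consists of the
  regular distributions. There the operations on functions have to be matched with those on
  distributions, for values in an arbitrary Banach space, and the fundamental theorem of
  calculus does this. The indefinite integral \<open>F\<close> of a locally integrable \<open>f\<close> is locally
  absolutely continuous with derivative \<open>f\<close> almost everywhere (\<open>primitive_has_derivative_AE\<close>), a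
  locally absolutely continuous function that is differentiable almost everywhere is the
  integral of its derivative (\<open>abs_continuous_has_integral\<close>), and so \<open>f\<close> is the distributional
  derivative of \<open>F\<close> (\<open>dist_deriv_regular\<close>). As the mean of \<open>f\<close> is a difference quotient of \<open>F\<close>,
  means of functions and of distributions agree (\<open>regular_mean\<close>), and integrating \<open>n\<close> times
  identifies \<open>D^n A \<inter> R\<close> with the locally defined derivatives (\<open>deriv_Loc_eq\<close>).
\<close>

section \<open>Strong measurability and the Bochner integral\<close>

text \<open>
  Sums of Borel functions with values in a space without a countable base need not be Borel.
  Almost everywhere limits of simple functions are closed under all continuous operations.
\<close>

definition strongly_measurable :: "(real \<Rightarrow> 'b::real_normed_vector) \<Rightarrow> bool" where
  "strongly_measurable f \<longleftrightarrow>
     (\<exists>s. (\<forall>i. simple_function lebesgue (s i)) \<and> (AE t in lebesgue. (\<lambda>i. s i t) \<longlonglongrightarrow> f t))"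

abbreviation simple_integrable :: "(real \<Rightarrow> 'b::real_normed_vector) \<Rightarrow> bool" where
  "simple_integrable \<equiv> Bochner_Integration.simple_bochner_integrable lebesgue"

abbreviation simple_integral :: "(real \<Rightarrow> 'b::real_normed_vector) \<Rightarrow> 'b" where
  "simple_integral \<equiv> Bochner_Integration.simple_bochner_integral lebesgue"

text \<open>
  The preimages of a set under the two functions differ by a subset of a null set, and such a
  subset is measurable as Lebesgue measure is complete.
\<close>

lemma borel_measurable_lebesgue_AE_cong:
  fixes f g :: "real \<Rightarrow> 'b::topological_space"
  assumes g: "g \<in> borel_measurable lebesgue" and ae: "AE t in lebesgue. f t = g t"
  shows "f \<in> borel_measurable lebesgue"
proof (rule measurableI)
  obtain N where N: "N \<in> null_sets lebesgue" "\<And>t. t \<notin> N \<Longrightarrow> f t = g t"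
    using ae unfolding completion.AE_iff_null_sets by auto
  fix S :: "'b set" assume S: "S \<in> sets borel"
  have "f -` S = (g -` S - N) \<union> (f -` S \<inter> N)" using N(2) by auto
  moreover have "f -` S \<inter> N \<in> null_sets lebesgue"
    by (rule completion.complete2[OF _ N(1)]) auto
  moreover have "g -` S \<in> sets lebesgue" using measurable_sets[OF g S] by simp
  ultimately have "f -` S \<in> sets lebesgue"
    using N(1) by (metis null_setsD2 sets.Diff sets.Un)
  then show "f -` S \<inter> space lebesgue \<in> sets lebesgue" by simp
qed simp

lemma strongly_measurable_imp_borel_measurable:
  fixes f :: "real \<Rightarrow> 'b::real_normed_vector"
  assumes "strongly_measurable f"
  shows "f \<in> borel_measurable lebesgue"
proof -
  obtain s where s: "\<And>i. simple_function lebesgue (s i)"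
      and ae: "AE t in lebesgue. (\<lambda>i. s i t) \<longlonglongrightarrow> f t"
    using assms unfolding strongly_measurable_def by auto
  obtain N where N: "N \<in> null_sets lebesgue" "\<And>t. t \<notin> N \<Longrightarrow> (\<lambda>i. s i t) \<longlonglongrightarrow> f t"
    using ae unfolding completion.AE_iff_null_sets by auto
  have Ns: "N \<in> sets lebesgue" using N(1) by auto
  define f' where "f' t = (if t \<in> N then 0 else f t)" for t
  have "f' \<in> borel_measurable lebesgue"
  proof (rule borel_measurable_LIMSEQ_metric)
    fix i
    have "simple_function lebesgue (\<lambda>t. if t \<in> N then 0 else s i t)"
      by (rule simple_function_If) (use s Ns in auto)
    then show "(\<lambda>t. if t \<in> N then 0 else s i t) \<in> borel_measurable lebesgue"
      by (rule borel_measurable_simple_function)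
  next
    fix t :: real
    show "(\<lambda>i. if t \<in> N then 0 else s i t) \<longlonglongrightarrow> f' t"
      using N(2)[of t] by (auto simp: f'_def)
  qed
  moreover have "AE t in lebesgue. f t = f' t"
    using AE_not_in[OF N(1)] by eventually_elim (simp add: f'_def)
  ultimately show ?thesis by (rule borel_measurable_lebesgue_AE_cong)
qed

lemma strongly_measurable_compose2:
  fixes p :: "'a::real_normed_vector \<Rightarrow> 'b::real_normed_vector \<Rightarrow> 'c::real_normed_vector"
  assumes p: "\<And>u v a b. u \<longlonglongrightarrow> a \<Longrightarrow> v \<longlonglongrightarrow> b \<Longrightarrow> (\<lambda>i. p (u i) (v i)) \<longlonglongrightarrow> p a b"
    and f: "strongly_measurable f" and g: "strongly_measurable g"
  shows "strongly_measurable (\<lambda>t. p (f t) (g t))"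
proof -
  obtain s where s: "\<And>i. simple_function lebesgue (s i)"
      and sl: "AE t in lebesgue. (\<lambda>i. s i t) \<longlonglongrightarrow> f t"
    using f unfolding strongly_measurable_def by auto
  obtain r where r: "\<And>i. simple_function lebesgue (r i)"
      and rl: "AE t in lebesgue. (\<lambda>i. r i t) \<longlonglongrightarrow> g t"
    using g unfolding strongly_measurable_def by auto
  have "simple_function lebesgue (\<lambda>t. p (s i t) (r i t))" for i
    by (rule simple_function_compose2[OF s r])
  moreover have "AE t in lebesgue. (\<lambda>i. p (s i t) (r i t)) \<longlonglongrightarrow> p (f t) (g t)"
    using sl rl by eventually_elim (rule p)
  ultimately show ?thesis unfolding strongly_measurable_def
    by (intro exI[of _ "\<lambda>i t. p (s i t) (r i t)"]) auto
qed

lemma strongly_measurable_simple: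
  "simple_function lebesgue f \<Longrightarrow> strongly_measurable f"
  unfolding strongly_measurable_def by (intro exI[of _ "\<lambda>i. f"]) auto

lemma strongly_measurable_norm:
  assumes "strongly_measurable f"
  shows "strongly_measurable (\<lambda>t. norm (f t))"
  by (rule strongly_measurable_compose2[where p="\<lambda>x y. norm x", OF _ assms assms])
     (auto intro: tendsto_norm)

lemma strongly_measurable_indicator:
  fixes f :: "real \<Rightarrow> 'b::real_normed_vector"
  assumes "strongly_measurable f" "S \<in> sets lebesgue"
  shows "strongly_measurable (\<lambda>t. indicator S t *\<^sub>R f t)"
proof (rule strongly_measurable_compose2[where p="\<lambda>(x::real) (y::'b). x *\<^sub>R y"])
  show "strongly_measurable (\<lambda>t. indicator S t :: real)"
    using assms(2) by (intro strongly_measurable_simple) auto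
qed (use assms in \<open>auto intro: tendsto_scaleR\<close>)

lemma strongly_measurable_shift:
  fixes f :: "real \<Rightarrow> 'b::real_normed_vector"
  assumes "strongly_measurable f"
  shows "strongly_measurable (\<lambda>t. f (t + c))"
proof -
  obtain s where s: "\<And>i. simple_function lebesgue (s i)"
      and sl: "AE t in lebesgue. (\<lambda>i. s i t) \<longlonglongrightarrow> f t"
    using assms unfolding strongly_measurable_def by auto
  have meas: "(\<lambda>t::real. t + c) \<in> lebesgue \<rightarrow>\<^sub>M lebesgue"
    using lebesgue_affine_measurable[of "\<lambda>_. 1::real" c] by (simp add: add.commute)
  have "simple_function lebesgue (\<lambda>t. s i (t + c))" for i
    by (rule simple_function_comp[OF meas s])
  moreover have "AE t in lebesgue. (\<lambda>i. s i (t + c)) \<longlonglongrightarrow> f (t + c)"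
  proof -
    obtain N where N: "N \<in> null_sets lebesgue" "\<And>t. t \<notin> N \<Longrightarrow> (\<lambda>i. s i t) \<longlonglongrightarrow> f t"
      using sl unfolding completion.AE_iff_null_sets by auto
    have "(+) (-c) ` N \<in> null_sets lebesgue"
      using negligible_translation[of N "-c"] N(1) unfolding negligible_iff_null_sets by simp
    moreover have "(\<lambda>i. s i (t + c)) \<longlonglongrightarrow> f (t + c)" if "t \<notin> (+) (-c) ` N" for t
      using that by (intro N(2)) (auto simp: image_iff)
    ultimately show ?thesis by (intro AE_I') auto
  qed
  ultimately show ?thesis unfolding strongly_measurable_def
    by (intro exI[of _ "\<lambda>i t. s i (t + c)"]) auto
qed

text \<open>
  Simple functions that approximate the identity are composed with \<open>f\<close>.
\<close>

lemma continuous_imp_strongly_measurable: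
  fixes f :: "real \<Rightarrow> 'b::real_normed_vector"
  assumes "continuous_on UNIV f"
  shows "strongly_measurable f"
proof -
  have "(\<lambda>t. t :: real) \<in> borel_measurable lebesgue" by (simp add: measurable_completion)
  from borel_measurable_implies_sequence_metric[OF this, of 0]
  obtain F :: "nat \<Rightarrow> real \<Rightarrow> real" where "\<forall>i. simple_function lebesgue (F i)" "\<forall>t\<in>space lebesgue. (\<lambda>i. F i t) \<longlonglongrightarrow> t"
    by blast
  then have F: "simple_function lebesgue (F i)" "(\<lambda>i. F i t) \<longlonglongrightarrow> t" for i t by simp_all
  have "simple_function lebesgue (\<lambda>t. f (F i t))" for i
    by (rule simple_function_compose1[OF F(1)])
  moreover have "(\<lambda>i. f (F i t)) \<longlonglongrightarrow> f t" for t
    by (rule continuous_on_tendsto_compose[OF assms F(2)]) auto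
  ultimately show ?thesis
    unfolding strongly_measurable_def by (intro exI[of _ "\<lambda>i t. f (F i t)"]) auto
qed

text \<open>
  Joint measurability of \<open>p\<close> is replaced by measurability in the first argument, because the
  second argument takes finitely many values.
\<close>

lemma measurable_simple_compose:
  fixes f :: "'a \<Rightarrow> 'b::topological_space" and s :: "'a \<Rightarrow> 'c"
  assumes f: "f \<in> borel_measurable M" and s: "simple_function M s"
    and p: "\<And>y. (\<lambda>x. p x y) \<in> borel_measurable borel"
  shows "(\<lambda>t. p (f t) (s t)) \<in> borel_measurable M"
proof (rule measurable_compose_countable'[where I="s ` space M" and g=s and f="\<lambda>y t. p (f t) y"])
  show "countable (s ` space M)" using s by (simp add: simple_function_def countable_finite)
  then show "s \<in> M \<rightarrow>\<^sub>M count_space (s ` space M)"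
    using s by (auto simp: measurable_count_space_eq_countable simple_function_def 
       intro!: countable_finite)
  show "(\<lambda>t. p (f t) y) \<in> borel_measurable M" if "y \<in> s ` space M" for y
    using measurable_compose[OF f p] .
qed

lemma borel_measurable_norm_diff_simple:
  fixes f :: "real \<Rightarrow> 'b::real_normed_vector"
  assumes "f \<in> borel_measurable lebesgue" "simple_function lebesgue s"
  shows "(\<lambda>t. norm (f t - s t)) \<in> borel_measurable lebesgue"
  using assms
  by (rule measurable_simple_compose[where p="\<lambda>x y. norm (x - y)"])
     (intro borel_measurable_continuous_onI continuous_intros)

text \<open>
  Hence the integrals of simple functions that approximate \<open>f\<close> in mean form a Cauchy sequence.
\<close>

lemma norm_simple_bochner_integral_diff_le:
  fixes f :: "real \<Rightarrow> 'b::real_normed_vector"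
  assumes f: "f \<in> borel_measurable lebesgue"
    and s: "simple_integrable s"
    and r: "simple_integrable r"
  shows "ennreal (norm (simple_integral s
                        - simple_integral r))
         \<le> (\<integral>\<^sup>+t. norm (f t - s t) \<partial>lebesgue) + (\<integral>\<^sup>+t. norm (f t - r t) \<partial>lebesgue)"
proof -
  have sf: "simple_function lebesgue s" "simple_function lebesgue r"
    using s r by (auto elim: Bochner_Integration.simple_bochner_integrable.cases)
  note m = borel_measurable_norm_diff_simple[OF f sf(1)] borel_measurable_norm_diff_simple[OF f sf(2)]
  have d: "simple_integrable (\<lambda>x. s x - r x)"
    by (rule simple_bochner_integrable_compose2[OF _ s r]) simp
  have nd: "simple_integrable (\<lambda>x. norm (s x - r x))"
    by (rule simple_bochner_integrable_compose2[OF _ s r, where p="\<lambda>x y. norm (x - y)"]) simp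
  have "ennreal (norm (simple_integral s
                        - simple_integral r))
      = norm (simple_integral (\<lambda>x. s x - r x))"
    by (simp add: simple_bochner_integral_diff[OF s r])
  also have "\<dots> \<le> simple_integral (\<lambda>x. norm (s x - r x))"
    using simple_bochner_integral_norm_bound[OF d] by (rule ennreal_leI)
  also have "\<dots> = (\<integral>\<^sup>+x. norm (s x - r x) \<partial>lebesgue)"
    by (rule simple_bochner_integral_eq_nn_integral[OF nd]) simp
  also have "\<dots> \<le> (\<integral>\<^sup>+x. ennreal (norm (f x - s x)) + ennreal (norm (f x - r x)) \<partial>lebesgue)"
  proof (rule nn_integral_mono)
    fix x
    have "norm (s x - r x) \<le> norm (f x - s x) + norm (f x - r x)"
      by (metis norm_diff_triangle_le norm_minus_commute order_refl)
    then show "ennreal (norm (s x - r x)) \<le> ennreal (norm (f x - s x)) + ennreal (norm (f x - r x))"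
      by (metis ennreal_leI ennreal_plus norm_ge_zero)
  qed
  also have "\<dots> = (\<integral>\<^sup>+t. norm (f t - s t) \<partial>lebesgue) + (\<integral>\<^sup>+t. norm (f t - r t) \<partial>lebesgue)"
    using m by (intro nn_integral_add) auto
  finally show ?thesis .
qed

text \<open>
  Approximation in mean yields a subsequence that converges almost everywhere.
\<close>

lemma bochner_integrable_imp_strongly_measurable:
  fixes f :: "real \<Rightarrow> 'b::real_normed_vector"
  assumes "bochner_integrable lebesgue f"
  shows "strongly_measurable f" and "(\<integral>\<^sup>+t. norm (f t) \<partial>lebesgue) < \<infinity>"
proof -
  obtain s where f: "f \<in> borel_measurable lebesgue"
    and s: "\<And>i. simple_integrable (s i)"
    and lim: "(\<lambda>i. \<integral>\<^sup>+t. norm (f t - s i t) \<partial>lebesgue) \<longlonglongrightarrow> 0"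
    using assms unfolding bochner_integrable_def has_bochner_def by blast
  have sf: "simple_function lebesgue (s i)" for i
    using s[of i] by (auto elim: Bochner_Integration.simple_bochner_integrable.cases)
  note m = borel_measurable_norm_diff_simple[OF f sf]
  have "\<forall>\<^sub>F i in sequentially. (\<integral>\<^sup>+t. norm (f t - s i t) \<partial>lebesgue) < 1"
    using lim by (rule order_tendstoD) simp
  \<comment> \<open>from \<open>k\<close> on the errors are finite, so that they are real integrals\<close>
  then obtain k where k: "\<And>i. i \<ge> k \<Longrightarrow> (\<integral>\<^sup>+t. norm (f t - s i t) \<partial>lebesgue) < 1"
    unfolding eventually_sequentially by auto
  have fin: "(\<integral>\<^sup>+t. norm (f t - s i t) \<partial>lebesgue) < \<infinity>" if "i \<ge> k" for i
    using k[OF that] by (simp add: ennreal_one_less_top order.strict_trans)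
  define u where "u n t = norm (f t - s (n + k) t)" for n t
  have u: "integrable lebesgue (u n)" for n
    unfolding u_def using fin[of "n + k"] m[of "n + k"] by (intro integrableI_bounded) auto
  have "(\<lambda>n. \<integral>t. norm (u n t) \<partial>lebesgue) \<longlonglongrightarrow> 0"
  proof -
    have "(\<integral>\<^sup>+t. norm (f t - s (n + k) t) \<partial>lebesgue) = ennreal (\<integral>t. norm (u n t) \<partial>lebesgue)" for n
      using nn_integral_eq_integral[OF integrable_norm[OF u[of n]]] by (simp add: u_def)
    moreover have "(\<lambda>n. \<integral>\<^sup>+t. norm (f t - s (n + k) t) \<partial>lebesgue) \<longlonglongrightarrow> 0"
      using LIMSEQ_ignore_initial_segment[OF lim, of k] .
    ultimately have "(\<lambda>n. ennreal (\<integral>t. norm (u n t) \<partial>lebesgue)) \<longlonglongrightarrow> ennreal 0" by simp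
    then show ?thesis
      by (subst (asm) tendsto_ennreal_iff) auto
  qed
  from tendsto_L1_AE_subseq[OF u this] obtain r where
     "AE t in lebesgue. (\<lambda>n. u (r n) t) \<longlonglongrightarrow> 0" by blast
  then have "AE t in lebesgue. (\<lambda>n. s (r n + k) t) \<longlonglongrightarrow> f t"
  proof eventually_elim
    fix t assume "(\<lambda>n. u (r n) t) \<longlonglongrightarrow> 0"
    then have "(\<lambda>n. f t - s (r n + k) t) \<longlonglongrightarrow> 0"
      unfolding u_def by (simp add: tendsto_norm_zero_iff)
    from tendsto_diff[OF tendsto_const[of "f t"] this]
    show "(\<lambda>n. s (r n + k) t) \<longlonglongrightarrow> f t" by simp
  qed
  then show "strongly_measurable f"
    unfolding strongly_measurable_def using sf by (intro exI[of _ "\<lambda>n. s (r n + k)"]) auto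
  have ns: "simple_integrable (\<lambda>x. norm (s k x))"
    by (rule simple_bochner_integrable_compose2[OF _ s s, where p="\<lambda>x y. norm x"]) simp
  have "(\<integral>\<^sup>+t. norm (f t) \<partial>lebesgue) \<le> (\<integral>\<^sup>+t. ennreal (norm (f t - s k t)) + ennreal (norm (s k t)) \<partial>lebesgue)"
  proof (rule nn_integral_mono)
    fix t
    have "norm (f t) \<le> norm (f t - s k t) + norm (s k t)"
      by (metis diff_add_cancel norm_triangle_ineq)
    then show "ennreal (norm (f t)) \<le> ennreal (norm (f t - s k t)) + ennreal (norm (s k t))"
      by (metis ennreal_leI ennreal_plus norm_ge_zero)
  qed
  also have "\<dots> = (\<integral>\<^sup>+t. norm (f t - s k t) \<partial>lebesgue) + (\<integral>\<^sup>+t. norm (s k t) \<partial>lebesgue)"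
    using m[of k] borel_measurable_simple_function[OF simple_function_compose1[OF sf[of k], of norm]]
    by (intro nn_integral_add) auto
  also have "(\<integral>\<^sup>+t. norm (s k t) \<partial>lebesgue)
      = simple_integral (\<lambda>t. norm (s k t))"
    by (rule simple_bochner_integral_eq_nn_integral[OF ns, symmetric]) simp
  also have "(\<integral>\<^sup>+t. norm (f t - s k t) \<partial>lebesgue) + \<dots> < \<infinity>"
    using fin[of k] by (simp add: ennreal_add_less_top)
  finally show "(\<integral>\<^sup>+t. norm (f t) \<partial>lebesgue) < \<infinity>" .
qed

text \<open>
  The approximating simple functions are set to 0 where their norm exceeds \<open>2 * norm (f t)\<close>.
  This does not affect the limit and makes dominated convergence available for the norm of the
  error.
\<close>

lemma bochner_integrableI:
  fixes f :: "real \<Rightarrow> 'b::banach"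
  assumes sm: "strongly_measurable f" and fin: "(\<integral>\<^sup>+t. norm (f t) \<partial>lebesgue) < \<infinity>"
  shows "bochner_integrable lebesgue f"
proof -
  obtain s where s: "\<And>i. simple_function lebesgue (s i)"
      and sl: "AE t in lebesgue. (\<lambda>i. s i t) \<longlonglongrightarrow> f t"
    using sm unfolding strongly_measurable_def by auto
  have f: "f \<in> borel_measurable lebesgue" by (rule strongly_measurable_imp_borel_measurable[OF sm])
  have nf: "(\<lambda>t. norm (f t)) \<in> borel_measurable lebesgue"
    by (rule strongly_measurable_imp_borel_measurable[OF strongly_measurable_norm[OF sm]])
  define r where "r i t = (if norm (s i t) \<le> 2 * norm (f t) then s i t else 0)" for i t
  have r: "simple_function lebesgue (r i)" for i
    unfolding r_def
  proof (rule simple_function_If[OF s])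
    have "(\<lambda>t. norm (s i t)) \<in> borel_measurable lebesgue"
      by (rule borel_measurable_simple_function[OF simple_function_compose1[OF s]])
    then show "{t \<in> space lebesgue. norm (s i t) \<le> 2 * norm (f t)} \<in> sets lebesgue"
      using nf by measurable
  qed simp
  have rle: "norm (r i t) \<le> 2 * norm (f t)" for i t by (auto simp: r_def)
  have rl: "AE t in lebesgue. (\<lambda>i. r i t) \<longlonglongrightarrow> f t"
    using sl
  proof eventually_elim
    fix t assume l: "(\<lambda>i. s i t) \<longlonglongrightarrow> f t"
    show "(\<lambda>i. r i t) \<longlonglongrightarrow> f t"
    proof (cases "f t = 0")
      case True
      then have "r i t = 0" for i by (auto simp: r_def)
      then show ?thesis using True by simp
    next
      case False
      have "\<forall>\<^sub>F i in sequentially. norm (s i t) < 2 * norm (f t)"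
        by (rule order_tendstoD(2)[OF tendsto_norm[OF l]]) (use False in simp)
      then have "\<forall>\<^sub>F i in sequentially. s i t = r i t"
        by eventually_elim (simp add: r_def)
      with l show ?thesis by (rule Lim_transform_eventually)
    qed
  qed
  have fin2: "(\<integral>\<^sup>+t. ennreal c * norm (f t) \<partial>lebesgue) < \<infinity>" for c
    using fin nf by (subst nn_integral_cmult) (auto simp: ennreal_mult_less_top)
  have ri: "simple_integrable (r i)" for i
  proof (rule simple_bochner_integrableI_bounded[OF r])
    have "(\<integral>\<^sup>+t. norm (r i t) \<partial>lebesgue) \<le> (\<integral>\<^sup>+t. ennreal 2 * norm (f t) \<partial>lebesgue)"
    proof (rule nn_integral_mono)
      fix t
      have "ennreal 2 * ennreal (norm (f t)) = ennreal (2 * norm (f t))"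
        by (rule ennreal_mult[symmetric]) auto
      then show "ennreal (norm (r i t)) \<le> ennreal 2 * norm (f t)"
        using rle[of i t] by (metis ennreal_leI)
    qed
    also note fin2
    finally show "(\<integral>\<^sup>+t. norm (r i t) \<partial>lebesgue) < \<infinity>" .
  qed
  have lim: "(\<lambda>i. \<integral>\<^sup>+t. norm (f t - r i t) \<partial>lebesgue) \<longlonglongrightarrow> 0"
  proof -
    have "(\<lambda>i. \<integral>\<^sup>+t. norm (f t - r i t) \<partial>lebesgue) \<longlonglongrightarrow> (\<integral>\<^sup>+t. 0 \<partial>(lebesgue::real measure))"
    proof (rule nn_integral_dominated_convergence[where w="\<lambda>t. ennreal 3 * norm (f t)"])
      show "(\<lambda>t. ennreal (norm (f t - r i t))) \<in> borel_measurable lebesgue" for i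
        using borel_measurable_norm_diff_simple[OF f r] by measurable
      show "(\<lambda>t. ennreal 3 * norm (f t)) \<in> borel_measurable lebesgue"
        using nf by measurable
      show "AE t in lebesgue. ennreal (norm (f t - r i t)) \<le> ennreal 3 * norm (f t)" for i
      proof (intro always_eventually allI)
        fix t
        have "norm (f t - r i t) \<le> 3 * norm (f t)"
          using norm_triangle_ineq4[of "f t" "r i t"] rle[of i t] by linarith
        moreover have "ennreal 3 * ennreal (norm (f t)) = ennreal (3 * norm (f t))"
          by (rule ennreal_mult[symmetric]) auto
        ultimately show "ennreal (norm (f t - r i t)) \<le> ennreal 3 * norm (f t)"
          by (metis ennreal_leI)
      qed
      show "AE t in lebesgue. (\<lambda>i. ennreal (norm (f t - r i t))) \<longlonglongrightarrow> 0"
        using rl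
      proof eventually_elim
        fix t assume "(\<lambda>i. r i t) \<longlonglongrightarrow> f t"
        from tendsto_norm[OF tendsto_diff[OF tendsto_const[of "f t"] this]]
        have "(\<lambda>i. norm (f t - r i t)) \<longlonglongrightarrow> 0" by simp
        from tendsto_ennrealI[OF this] show "(\<lambda>i. ennreal (norm (f t - r i t))) \<longlonglongrightarrow> 0" by simp
      qed
      show "(\<integral>\<^sup>+t. ennreal 3 * norm (f t) \<partial>lebesgue) < \<infinity>" by (rule fin2)
    qed simp
    then show ?thesis by simp
  qed
  have "Cauchy (\<lambda>i. simple_integral (r i))"
  proof (rule metric_CauchyI)
    fix e :: real assume "e > 0"
    then have "\<forall>\<^sub>F i in sequentially. (\<integral>\<^sup>+t. norm (f t - r i t) \<partial>lebesgue) < ennreal (e / 2)"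
      by (intro order_tendstoD(2)[OF lim]) (simp add: ennreal_zero_less_divide)
    then obtain k where k: "\<And>i. i \<ge> k \<Longrightarrow> (\<integral>\<^sup>+t. norm (f t - r i t) \<partial>lebesgue) < ennreal (e / 2)"
      unfolding eventually_sequentially by auto
    show "\<exists>M. \<forall>m\<ge>M. \<forall>n\<ge>M. dist (simple_integral (r m))
               (simple_integral (r n)) < e"
    proof (intro exI[of _ k] allI impI)
      fix m n assume "k \<le> m" "k \<le> n"
      have "ennreal (dist (simple_integral (r m))
               (simple_integral (r n)))
          \<le> (\<integral>\<^sup>+t. norm (f t - r m t) \<partial>lebesgue) + (\<integral>\<^sup>+t. norm (f t - r n t) \<partial>lebesgue)"
        unfolding dist_norm by (rule norm_simple_bochner_integral_diff_le[OF f ri ri])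
      also have "\<dots> < ennreal (e / 2) + ennreal (e / 2)"
        by (rule add_strict_mono[OF k[OF \<open>k \<le> m\<close>] k[OF \<open>k \<le> n\<close>]])
      also have "\<dots> = ennreal e" using \<open>e > 0\<close> by (simp flip: ennreal_plus)
      finally show "dist (simple_integral (r m))
               (simple_integral (r n)) < e"
        using \<open>e > 0\<close> by (simp add: ennreal_less_iff)
    qed
  qed
  then obtain x where "(\<lambda>i. simple_integral (r i)) \<longlonglongrightarrow> x"
    using Cauchy_convergent convergent_def by blast
  then show ?thesis
    unfolding bochner_integrable_def has_bochner_def using f ri lim by blast
qed

lemma simple_bochner_integrable_has_integral:
  fixes s :: "real \<Rightarrow> 'b::real_normed_vector"
  assumes s: "simple_integrable s"
  shows "(s has_integral simple_integral s) UNIV"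
proof -
  have sf: "simple_function lebesgue s" and fin: "emeasure lebesgue {t. s t \<noteq> 0} \<noteq> \<infinity>"
    using s by (auto elim: Bochner_Integration.simple_bochner_integrable.cases)
  have fr: "finite (range s)" using sf by (simp add: simple_function_def)
  have "((\<lambda>t. \<Sum>y\<in>range s. indicat_real {t. s t = y} t *\<^sub>R y) has_integral
          (\<Sum>y\<in>range s. measure lebesgue {t. s t = y} *\<^sub>R y)) UNIV"
  proof (rule has_integral_sum[OF fr])
    fix y assume "y \<in> range s"
    show "((\<lambda>t. indicat_real {t. s t = y} t *\<^sub>R y) has_integral measure lebesgue {t. s t = y} *\<^sub>R y) UNIV"
    proof (cases "y = 0")
      case False
      have sets: "{t. s t = y} \<in> sets lebesgue" for y
        using simple_functionD(2)[OF sf, of "{y}"] by (simp add: vimage_def)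
      have "space lebesgue - {t. s t = 0} = {t. s t \<noteq> 0}" by auto
      then have "{t. s t \<noteq> 0} \<in> sets lebesgue" using sets.compl_sets[OF sets[of 0]] by simp
      then have "emeasure lebesgue {t. s t = y} \<le> emeasure lebesgue {t. s t \<noteq> 0}"
        using False by (intro emeasure_mono) auto
      then have "{t. s t = y} \<in> lmeasurable"
        using sets fin by (auto simp: fmeasurable_def top.not_eq_extremum)
      then have "(indicat_real {t. s t = y} has_integral measure lebesgue {t. s t = y}) UNIV"
        by (rule lmeasurable_iff_has_integral[THEN iffD1])
      then show ?thesis by (rule has_integral_scaleR_left)
    qed simp
  qed
  moreover have "(\<Sum>y\<in>range s. indicat_real {t. s t = y} t *\<^sub>R y) = s t" for t
  proof -
    have "(\<Sum>y\<in>range s. indicat_real {t. s t = y} t *\<^sub>R y) = (\<Sum>y\<in>range s. if y = s t then y else 0)"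
      by (rule sum.cong) (auto simp: indicator_def)
    also have "\<dots> = s t" using fr by (simp add: sum.delta)
    finally show ?thesis .
  qed
  ultimately show ?thesis
    by (simp add: Bochner_Integration.simple_bochner_integral_def)
qed

text \<open>
  The real function \<open>norm (f t - s i t)\<close> is Lebesgue integrable, hence Henstock-Kurzweil
  integrable with the same small integral. Its Riemann sums over fine divisions are therefore
  small, and they bound the distance between the Riemann sums of \<open>f\<close> and of the simple function
  \<open>s i\<close>. The latter are close to the integral of \<open>s i\<close>, which is close to the Bochner integral
  of \<open>f\<close>.
\<close>

lemma has_bochner_imp_has_integral:
  fixes f :: "real \<Rightarrow> 'b::banach"
  assumes "has_bochner lebesgue (\<lambda>t. indicator {a..b} t *\<^sub>R f t) x"
  shows "(f has_integral x) {a..b}"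
proof -
  define g where "g t = indicat_real {a..b} t *\<^sub>R f t" for t
  obtain s where g: "g \<in> borel_measurable lebesgue"
    and s: "\<And>i. simple_integrable (s i)"
    and lim: "(\<lambda>i. \<integral>\<^sup>+t. norm (g t - s i t) \<partial>lebesgue) \<longlonglongrightarrow> 0"
    and limx: "(\<lambda>i. simple_integral (s i)) \<longlonglongrightarrow> x"
    using assms unfolding has_bochner_def g_def[abs_def] by blast
  have sf: "simple_function lebesgue (s i)" for i
    using s[of i] by (auto elim: Bochner_Integration.simple_bochner_integrable.cases)
  note m = borel_measurable_norm_diff_simple[OF g sf]
  show ?thesis
    unfolding has_integral_real
  proof (intro allI impI)
    fix e :: real assume e: "e > 0"
    have "\<forall>\<^sub>F i in sequentially. (\<integral>\<^sup>+t. norm (g t - s i t) \<partial>lebesgue) < ennreal (e / 5)"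
      by (intro order_tendstoD(2)[OF lim]) (use e in simp)
    moreover have "\<forall>\<^sub>F i in sequentially. dist (simple_integral (s i)) x < e / 5"
      by (rule tendstoD[OF limx]) (use e in simp)
    ultimately have "\<forall>\<^sub>F i in sequentially. (\<integral>\<^sup>+t. norm (g t - s i t) \<partial>lebesgue) < ennreal (e / 5)
        \<and> dist (simple_integral (s i)) x < e / 5"
      by (rule eventually_conj)
    then obtain i where i: "(\<integral>\<^sup>+t. norm (g t - s i t) \<partial>lebesgue) < ennreal (e / 5)"
        and ix: "dist (simple_integral (s i)) x < e / 5"
      unfolding eventually_sequentially by auto
    define S where "S = simple_integral (s i)"
    define h where "h t = norm (g t - s i t)" for t
    have fin: "(\<integral>\<^sup>+t. norm (g t - s i t) \<partial>lebesgue) < \<infinity>"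
      using i by (metis ennreal_less_top infinity_ennreal_def order.strict_trans)
    have hi: "integrable lebesgue h"
      unfolding h_def using m[of i] fin by (intro integrableI_bounded) auto
    define d where "d = integral\<^sup>L lebesgue h"
    have hd: "(h has_integral d) UNIV"
      unfolding d_def by (rule has_integral_integral_lebesgue[OF hi])
    have "ennreal d < ennreal (e / 5)"
      using i nn_integral_eq_integral[OF hi] by (simp add: h_def d_def)
    then have d: "d < e / 5" using e by (simp add: ennreal_less_iff d_def h_def)
    have sU: "(s i has_integral S) UNIV"
      unfolding S_def by (rule simple_bochner_integrable_has_integral[OF s])
    obtain I where sI: "(s i has_integral I) {a..b}"
      using integrable_on_subcbox[of "s i" UNIV a b] sU unfolding integrable_on_def by auto
    obtain H where hH: "(h has_integral H) {a..b}"
      using integrable_on_subcbox[of h UNIV a b] hd unfolding integrable_on_def by auto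
    have Hd: "H \<le> d"
      by (rule has_integral_subset_le[OF _ hH hd]) (auto simp: h_def)
    \<comment> \<open>outside \<open>{a..b}\<close> the function \<open>g\<close> is 0, so there the norm of \<open>s i\<close> is part of the error\<close>
    have "norm (S - I) \<le> d"
    proof -
      have "((\<lambda>t. if t \<in> {a..b} then s i t else 0) has_integral I) UNIV"
        using sI by (subst has_integral_restrict_UNIV)
      from has_integral_diff[OF sU this]
      have *: "((\<lambda>t. s i t - (if t \<in> {a..b} then s i t else 0)) has_integral S - I) UNIV" .
      show ?thesis
      proof -
        have "norm (integral UNIV (\<lambda>t. s i t - (if t \<in> {a..b} then s i t else 0))) \<le> integral UNIV h"
        proof (rule Henstock_Kurzweil_Integration.integral_norm_bound_integral)
          fix t
          show "norm (s i t - (if t \<in> {a..b} then s i t else 0)) \<le> h t"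
            by (auto simp: h_def g_def indicator_def)
        qed (use * hd in auto)
        then show ?thesis
          using integral_unique[OF *] integral_unique[OF hd] by simp
      qed
    qed
    have e5: "0 < e / 5" using e by simp
    obtain \<gamma>1 where \<gamma>1: "gauge \<gamma>1" "\<And>p. p tagged_division_of {a..b} \<Longrightarrow> \<gamma>1 fine p \<Longrightarrow>
        norm ((\<Sum>(t,K)\<in>p. measure lborel K *\<^sub>R s i t) - I) < e / 5"
      using has_integralD[OF sI[folded box_real(2)] e5] unfolding box_real(2) by metis
    obtain \<gamma>2 where \<gamma>2: "gauge \<gamma>2" "\<And>p. p tagged_division_of {a..b} \<Longrightarrow> \<gamma>2 fine p \<Longrightarrow>
        norm ((\<Sum>(t,K)\<in>p. measure lborel K *\<^sub>R h t) - H) < e / 5"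
      using has_integralD[OF hH[folded box_real(2)] e5] unfolding box_real(2) by metis
    show "\<exists>\<gamma>. gauge \<gamma> \<and> (\<forall>p. p tagged_division_of {a..b} \<and> \<gamma> fine p \<longrightarrow>
        norm ((\<Sum>(t,K)\<in>p. measure lborel K *\<^sub>R f t) - x) < e)"
    proof (intro exI[of _ "\<lambda>t. \<gamma>1 t \<inter> \<gamma>2 t"] conjI allI impI)
      show "gauge (\<lambda>t. \<gamma>1 t \<inter> \<gamma>2 t)" using \<gamma>1(1) \<gamma>2(1) by (rule gauge_Int)
      fix p assume p: "p tagged_division_of {a..b} \<and> (\<lambda>t. \<gamma>1 t \<inter> \<gamma>2 t) fine p"
      then have pt: "p tagged_division_of {a..b}" and f12: "\<gamma>1 fine p" "\<gamma>2 fine p"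
        by (auto simp: fine_Int)
      have "norm ((\<Sum>(t,K)\<in>p. measure lborel K *\<^sub>R f t) - (\<Sum>(t,K)\<in>p. measure lborel K *\<^sub>R s i t))
          = norm (\<Sum>(t,K)\<in>p. measure lborel K *\<^sub>R (f t - s i t))"
        by (simp add: sum_subtractf[symmetric] scaleR_diff_right split_def)
      also have "\<dots> \<le> (\<Sum>(t,K)\<in>p. norm (measure lborel K *\<^sub>R (f t - s i t)))"
        unfolding split_def by (rule norm_sum)
      also have "\<dots> = (\<Sum>(t,K)\<in>p. measure lborel K *\<^sub>R h t)"
      proof (rule sum.cong[OF refl], clarify)
        fix t K assume "(t, K) \<in> p"
        then have "t \<in> {a..b}" using tagged_division_ofD(2,3)[OF pt] by blast
        then show "norm (measure lborel K *\<^sub>R (f t - s i t)) = measure lborel K *\<^sub>R h t"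
          by (simp add: h_def g_def)
      qed
      finally have 1: "norm ((\<Sum>(t,K)\<in>p. measure lborel K *\<^sub>R f t) - (\<Sum>(t,K)\<in>p. measure lborel K *\<^sub>R s i t))
         < H + e / 5"
        using \<gamma>2(2)[OF pt f12(2)] unfolding real_norm_def by linarith
      have tri: "norm (A - x) \<le> norm (A - B) + norm (B - I) + norm (S - I) + dist S x" for A B
      proof -
        have "A - x = (A - B) + (B - I) - (S - I) + (S - x)" by simp
        then show ?thesis
          unfolding dist_norm
          using norm_triangle_ineq[of "(A - B) + (B - I) - (S - I)" "S - x"]
            norm_triangle_ineq4[of "(A - B) + (B - I)" "S - I"]
            norm_triangle_ineq[of "A - B" "B - I"] by simp
      qed
      show "norm ((\<Sum>(t,K)\<in>p. measure lborel K *\<^sub>R f t) - x) < e"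
        using tri[of "\<Sum>(t,K)\<in>p. measure lborel K *\<^sub>R f t" "\<Sum>(t,K)\<in>p. measure lborel K *\<^sub>R s i t"]
          1 \<gamma>1(2)[OF pt f12(1)] \<open>norm (S - I) \<le> d\<close> d Hd ix[folded S_def] by linarith
    qed
  qed
qed

lemma bochner_integral_eq_integral:
  fixes f :: "real \<Rightarrow> 'b::banach"
  assumes "bochner_integrable lebesgue (\<lambda>t. indicator {a..b} t *\<^sub>R f t)"
  shows "f integrable_on {a..b}"
    and "bochner_integral lebesgue (\<lambda>t. indicator {a..b} t *\<^sub>R f t) = integral {a..b} f"
proof -
  obtain x where x: "has_bochner lebesgue (\<lambda>t. indicator {a..b} t *\<^sub>R f t) x"
    using assms unfolding bochner_integrable_def by blast
  note hx = has_bochner_imp_has_integral[OF this]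
  then show "f integrable_on {a..b}" by blast
  show "bochner_integral lebesgue (\<lambda>t. indicator {a..b} t *\<^sub>R f t) = integral {a..b} f"
    unfolding bochner_integral_def integral_unique[OF hx]
  proof (rule the_equality)
    show "has_bochner lebesgue (\<lambda>t. indicator {a..b} t *\<^sub>R f t) x" by (rule x)
    fix y assume "has_bochner lebesgue (\<lambda>t. indicator {a..b} t *\<^sub>R f t) y"
    from has_bochner_imp_has_integral[OF this] show "y = x" using hx by (rule has_integral_unique)
  qed
qed

section \<open>Locally integrable functions\<close>

text \<open>
  The definition speaks about each bounded interval separately. One sequence of simple functions
  for the whole line is what the differentiation theorem for indefinite integrals needs.
\<close>

lemma L1loc_iff:
  fixes f :: "real \<Rightarrow> 'b::banach"
  shows "f \<in> L1loc \<longleftrightarrow> strongly_measurable f \<and> (\<forall>a b. (\<lambda>t. norm (f t)) absolutely_integrable_on {a..b})"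
    (is "_ \<longleftrightarrow> _ \<and> ?I")
proof -
  let ?g = "\<lambda>a b t. indicat_real {a..b} t *\<^sub>R f t"
  have abs_iff: "(\<lambda>t. norm (f t)) absolutely_integrable_on {a..b} \<longleftrightarrow> (\<integral>\<^sup>+t. norm (?g a b t) \<partial>lebesgue) < \<infinity>"
    if "strongly_measurable (?g a b)" for a b
    using strongly_measurable_imp_borel_measurable[OF strongly_measurable_norm[OF that]]
    unfolding set_integrable_def integrable_iff_bounded by (simp add: norm_mult)
  show ?thesis
  proof
    assume "f \<in> L1loc"
    then have bi: "bochner_integrable lebesgue (?g a b)" for a b
      by (simp add: L1loc_def)
    note sm = bochner_integrable_imp_strongly_measurable[OF bi]
    have "\<forall>n::nat. \<exists>s. (\<forall>i. simple_function lebesgue (s i)) \<and>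
        (AE t in lebesgue. (\<lambda>i. s i t) \<longlonglongrightarrow> ?g (- real n) (real n) t)"
      using sm(1) unfolding strongly_measurable_def by blast
    then obtain s where s: "\<And>n i. simple_function lebesgue (s n i)"
      and sl: "\<And>n. AE t in lebesgue. (\<lambda>i. s n i t) \<longlonglongrightarrow> ?g (- real n) (real n) t"
      by metis
    \<comment> \<open>glue the approximations along the annuli \<open>n - 1 \<le> \<bar>t\<bar> < n\<close>, using only finitely many at a time\<close>
    define N where "N t = nat \<lfloor>\<bar>t\<bar>\<rfloor> + 1" for t :: real
    define r where "r i t = (\<Sum>n\<le>i. indicat_real {t. N t = n} t *\<^sub>R s n i t)" for i t
    have Nm: "{t. N t = n} \<in> sets lebesgue" for n
    proof -
      have "N \<in> measurable lborel (count_space UNIV)" unfolding N_def[abs_def] by measurable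
      from measurable_sets[OF this, of "{n}"] show ?thesis by (simp add: vimage_def)
    qed
    have "simple_function lebesgue (r i)" for i
      unfolding r_def
    proof (rule simple_function_sum)
      fix n
      show "simple_function lebesgue (\<lambda>t. indicat_real {t. N t = n} t *\<^sub>R s n i t)"
        by (rule simple_function_compose2[OF simple_function_indicator s]) (use Nm in simp)
    qed
    moreover have "AE t in lebesgue. (\<lambda>i. r i t) \<longlonglongrightarrow> f t"
      using sl[THEN AE_all_countable[THEN iffD2, OF allI]]
    proof eventually_elim
      fix t assume l: "\<forall>n. (\<lambda>i. s n i t) \<longlonglongrightarrow> ?g (- real n) (real n) t"
      have "t \<in> {- real (N t)..real (N t)}" unfolding N_def by auto linarith+
      then have "(\<lambda>i. s (N t) i t) \<longlonglongrightarrow> f t" using l[rule_format, of "N t"] by simp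
      moreover have "\<forall>\<^sub>F i in sequentially. s (N t) i t = r i t"
      proof (rule eventually_sequentiallyI)
        fix i assume i: "N t \<le> i"
        have "r i t = (\<Sum>n\<le>i. if n = N t then s n i t else 0)"
          unfolding r_def by (rule sum.cong) (auto simp: indicator_def)
        then show "s (N t) i t = r i t" using i by simp
      qed
      ultimately show "(\<lambda>i. r i t) \<longlonglongrightarrow> f t" by (rule Lim_transform_eventually)
    qed
    ultimately have "strongly_measurable f"
      unfolding strongly_measurable_def by (intro exI[of _ r]) auto
    moreover have ?I using abs_iff[OF sm(1)] sm(2) by auto
    ultimately show "strongly_measurable f \<and> ?I" ..
  next
    assume a: "strongly_measurable f \<and> ?I"
    then have "strongly_measurable (?g a b)" for a b
      by (intro strongly_measurable_indicator) auto
    then show "f \<in> L1loc"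
      unfolding L1loc_def using abs_iff a by (auto intro!: bochner_integrableI)
  qed
qed

lemma L1loc_dominated:
  fixes f :: "real \<Rightarrow> 'b::banach"
  assumes "strongly_measurable f"
    and "\<And>a b. (g a b) integrable_on {a..b}"
    and "\<And>a b t. t \<in> {a..b} \<Longrightarrow> norm (f t) \<le> g a b t"
  shows "f \<in> L1loc"
  unfolding L1loc_iff
proof (intro conjI allI)
  fix a b
  show "(\<lambda>t. norm (f t)) absolutely_integrable_on {a..b}"
  proof (rule measurable_bounded_by_integrable_imp_absolutely_integrable[OF _ _ assms(2)[of a b]])
    show "(\<lambda>t. norm (f t)) \<in> borel_measurable (lebesgue_on {a..b})"
      using strongly_measurable_imp_borel_measurable[OF strongly_measurable_norm[OF assms(1)]]
      by (rule measurable_restrict_space1)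
  qed (use assms(3) in auto)
qed (rule assms)

lemma L1loc_norm_integrable:
  fixes f :: "real \<Rightarrow> 'b::banach"
  assumes "f \<in> L1loc"
  shows "(\<lambda>t. norm (f t)) integrable_on {a..b}"
  using assms unfolding L1loc_iff by (blast intro: set_lebesgue_integral_eq_integral(1))

lemma L1loc_integrable:
  fixes f :: "real \<Rightarrow> 'b::banach"
  assumes "f \<in> L1loc"
  shows "f integrable_on {a..b}"
  using assms bochner_integral_eq_integral(1) unfolding L1loc_def by blast

lemma L1loc_bochner_integral:
  fixes f :: "real \<Rightarrow> 'b::banach"
  assumes "f \<in> L1loc"
  shows "bochner_integral lebesgue (\<lambda>t. indicator {a..b} t *\<^sub>R f t) = integral {a..b} f"
  using assms bochner_integral_eq_integral(2) unfolding L1loc_def by blast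

lemma L1loc_norm_integral_le:
  fixes f :: "real \<Rightarrow> 'b::banach"
  assumes "f \<in> L1loc"
  shows "norm (integral {a..b} f) \<le> integral {a..b} (\<lambda>t. norm (f t))"
  by (rule Henstock_Kurzweil_Integration.integral_norm_bound_integral)
     (use L1loc_integrable[OF assms] L1loc_norm_integrable[OF assms] in auto)

lemma continuous_imp_L1loc:
  fixes f :: "real \<Rightarrow> 'b::banach"
  assumes "continuous_on UNIV f"
  shows "f \<in> L1loc"
proof (rule L1loc_dominated[where g="\<lambda>a b t. norm (f t)"])
  show "strongly_measurable f" by (rule continuous_imp_strongly_measurable[OF assms])
  show "(\<lambda>t. norm (f t)) integrable_on {a..b}" for a b
    by (intro integrable_continuous_interval continuous_on_norm continuous_on_subset[OF assms]) simp
qed simp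

lemma L1loc_add:
  fixes f g :: "real \<Rightarrow> 'b::banach"
  assumes "f \<in> L1loc" "g \<in> L1loc"
  shows "(\<lambda>t. f t + g t) \<in> L1loc"
proof (rule L1loc_dominated)
  show "strongly_measurable (\<lambda>t. f t + g t)"
    by (rule strongly_measurable_compose2[where p="(+)"])
       (use assms in \<open>auto simp: L1loc_iff intro: tendsto_add\<close>)
  show "(\<lambda>t. norm (f t) + norm (g t)) integrable_on {a..b}" for a b
    using assms by (intro integrable_add L1loc_norm_integrable)
qed (rule norm_triangle_ineq)

lemma L1loc_scaleR:
  fixes f :: "real \<Rightarrow> 'b::banach"
  assumes "f \<in> L1loc"
  shows "(\<lambda>t. c *\<^sub>R f t) \<in> L1loc"
proof (rule L1loc_dominated)
  show "strongly_measurable (\<lambda>t. c *\<^sub>R f t)"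
    by (rule strongly_measurable_compose2[where p="\<lambda>x y. c *\<^sub>R x" and g=f])
       (use assms in \<open>auto simp: L1loc_iff intro: tendsto_intros\<close>)
  show "(\<lambda>t. \<bar>c\<bar> * norm (f t)) integrable_on {a..b}" for a b
    using assms by (intro integrable_on_mult_right L1loc_norm_integrable)
qed simp

lemma L1loc_diff:
  fixes f g :: "real \<Rightarrow> 'b::banach"
  assumes "f \<in> L1loc" "g \<in> L1loc"
  shows "(\<lambda>t. f t - g t) \<in> L1loc"
  using L1loc_add[OF assms(1) L1loc_scaleR[OF assms(2), of "-1"]] by simp

lemma has_integral_shift:
  fixes f :: "real \<Rightarrow> 'b::real_normed_vector"
  assumes "(f has_integral i) {a + c..b + c}"
  shows "((\<lambda>t. f (t + c)) has_integral i) {a..b}"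
  using has_integral_affinity'[of f i "a + c" "b + c" 1 c] assms by simp

lemma integral_shift_interval:
  fixes f :: "real \<Rightarrow> 'b::banach"
  assumes "f integrable_on {a + c..b + c}"
  shows "integral {a..b} (\<lambda>t. f (t + c)) = integral {a + c..b + c} f"
  using has_integral_shift[OF integrable_integral[OF assms]] by (rule integral_unique)

lemma L1loc_shift:
  fixes f :: "real \<Rightarrow> 'b::banach"
  assumes "f \<in> L1loc"
  shows "(\<lambda>t. f (t + c)) \<in> L1loc"
proof (rule L1loc_dominated)
  show "strongly_measurable (\<lambda>t. f (t + c))"
    by (rule strongly_measurable_shift) (use assms in \<open>simp add: L1loc_iff\<close>)
  show "(\<lambda>t. norm (f (t + c))) integrable_on {a..b}" for a b
    using has_integral_shift[OF integrable_integral[OF L1loc_norm_integrable[OF assms]]] by blast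
qed simp

lemma L1loc_bilinear:
  fixes p :: "'a::banach \<Rightarrow> 'b::banach \<Rightarrow> 'c::banach"
  assumes p: "bounded_bilinear p" and g: "continuous_on UNIV g" and f: "f \<in> L1loc"
  shows "(\<lambda>t. p (g t) (f t)) \<in> L1loc"
proof -
  interpret bounded_bilinear p by (rule p)
  obtain K where K: "K > 0" "\<And>x y. norm (p x y) \<le> norm x * norm y * K"
    using pos_bounded by blast
  have "\<exists>B. \<forall>t\<in>{a..b}. norm (g t) \<le> B" for a b
  proof -
    have "compact (g ` {a..b})"
      by (intro compact_continuous_image continuous_on_subset[OF g]) auto
    then show ?thesis using bounded_iff compact_imp_bounded by (metis imageI)
  qed
  then obtain B where B: "\<And>a b t. t \<in> {a..b} \<Longrightarrow> norm (g t) \<le> B a b" by metis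
  show ?thesis
  proof (rule L1loc_dominated)
    show "strongly_measurable (\<lambda>t. p (g t) (f t))"
      by (rule strongly_measurable_compose2[OF tendsto continuous_imp_strongly_measurable[OF g]])
         (use f in \<open>auto simp: L1loc_iff\<close>)
    show "(\<lambda>t. (B a b * K) * norm (f t)) integrable_on {a..b}" for a b
      using f by (intro integrable_on_mult_right L1loc_norm_integrable)
    show "norm (p (g t) (f t)) \<le> (B a b * K) * norm (f t)" if "t \<in> {a..b}" for a b t
    proof -
      have "norm (p (g t) (f t)) \<le> norm (g t) * norm (f t) * K" by (rule K)
      also have "\<dots> \<le> B a b * norm (f t) * K"
        using B[OF that] K(1) by (intro mult_right_mono) auto
      finally show ?thesis by (simp add: mult_ac)
    qed
  qed
qed

section \<open>Primitives, absolute continuity and the fundamental theorem of calculus\<close>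

text \<open>
  The oriented integral from 0 to \<open>t\<close>: at least one of the two intervals is empty or a point.
\<close>

definition primitive :: "(real \<Rightarrow> 'b::banach) \<Rightarrow> real \<Rightarrow> 'b" where
  "primitive f t = integral {0..t} f - integral {t..0} f"

lemma primitive_diff:
  assumes f: "\<And>a b. f integrable_on {a..b}" and "s \<le> t"
  shows "primitive f t - primitive f s = integral {s..t} f"
proof -
  note comb = Henstock_Kurzweil_Integration.integral_combine[OF _ _ f]
  consider "0 \<le> s" | "s \<le> 0" "0 \<le> t" | "t \<le> 0" by linarith
  then show ?thesis
  proof cases
    case 1
    then have "integral {s..0} f = 0" "integral {t..0} f = 0"
      using assms(2) by (cases "s = 0"; cases "t = 0"; simp)+
    then show ?thesis using comb[of 0 s t] 1 assms(2) by (simp add: primitive_def algebra_simps)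
  next
    case 2
    then have "integral {0..s} f = 0" "integral {t..0} f = 0"
      by (cases "s = 0"; cases "t = 0"; simp)+
    then show ?thesis using comb[of s 0 t] 2 assms(2) by (simp add: primitive_def algebra_simps)
  next
    case 3
    then have "integral {0..s} f = 0" "integral {0..t} f = 0"
      using assms(2) by (cases "s = 0"; cases "t = 0"; simp)+
    then show ?thesis using comb[of s t 0] 3 assms(2) by (simp add: primitive_def algebra_simps)
  qed
qed

lemma primitive_derivative:
  assumes f: "continuous_on UNIV f"
  shows "(primitive f has_vector_derivative f t) (at t)"
proof -
  have int: "f integrable_on {a..b}" for a b
    by (intro integrable_continuous_interval continuous_on_subset[OF f]) simp
  have "((\<lambda>u. integral {t - 1..u} f) has_vector_derivative f t) (at t within {t - 1..t + 1})"
    by (intro integral_has_vector_derivative continuous_on_subset[OF f]) auto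
  then have "((\<lambda>u. primitive f (t - 1) + integral {t - 1..u} f) has_vector_derivative 0 + f t) (at t within {t - 1..t + 1})"
    by (intro has_vector_derivative_add has_vector_derivative_const)
  then have "((\<lambda>u. primitive f (t - 1) + integral {t - 1..u} f) has_vector_derivative f t) (at t)"
    by (simp add: at_within_Icc_at)
  then show ?thesis
  proof (rule has_vector_derivative_transform_within_open[where S="{t - 1<..<t + 1}"])
    fix u assume "u \<in> {t - 1<..<t + 1}"
    then show "primitive f (t - 1) + integral {t - 1..u} f = primitive f u"
      using primitive_diff[of f "t - 1" u, OF int] by (simp add: algebra_simps)
  qed auto
qed

text \<open>
  The families of intervals over which absolute continuity quantifies, up to their total length.
\<close>

definition nonoverlapping :: "real \<Rightarrow> real \<Rightarrow> (real \<times> real) set \<Rightarrow> bool" where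
  "nonoverlapping a b I \<longleftrightarrow> finite I \<and> (\<forall>(u, v)\<in>I. a \<le> u \<and> u \<le> v \<and> v \<le> b) \<and>
     pairwise (\<lambda>p q. disjnt {fst p<..<snd p} {fst q<..<snd q}) I"

lemma locally_abs_continuous_iff:
  "locally_abs_continuous f \<longleftrightarrow> (\<forall>a b. \<forall>e>0. \<exists>d>0. \<forall>I. nonoverlapping a b I \<longrightarrow>
     (\<Sum>(u, v)\<in>I. v - u) < d \<longrightarrow> (\<Sum>(u, v)\<in>I. norm (f v - f u)) < e)"
  unfolding locally_abs_continuous_def nonoverlapping_def by (simp only: conj_assoc imp_conjL)

lemma nonoverlappingD: "nonoverlapping a b I \<Longrightarrow> (u, v) \<in> I \<Longrightarrow> a \<le> u \<and> u \<le> v \<and> v \<le> b"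
  unfolding nonoverlapping_def by blast

text \<open>
  At every point at most one of the open intervals contributes to the sum of the restrictions of
  \<open>k\<close>.
\<close>

lemma sum_integral_disjoint_intervals_le:
  fixes k :: "real \<Rightarrow> real"
  assumes k: "k integrable_on {a..b}" "\<And>t. 0 \<le> k t"
    and non: "nonoverlapping a b I"
  shows "(\<Sum>(u, v)\<in>I. integral {u..v} k) \<le> integral {a..b} k"
proof -
  have I: "finite I" "pairwise (\<lambda>p q. disjnt {fst p<..<snd p} {fst q<..<snd q}) I"
    using non by (simp_all add: nonoverlapping_def)
  let ?r = "\<lambda>p t. if t \<in> {fst p<..<snd p} then k t else 0"
  have r: "(?r p has_integral integral {fst p..snd p} k) {a..b}" if "p \<in> I" for p
  proof -
    have sub: "{fst p..snd p} \<subseteq> {a..b}" using nonoverlappingD[OF non, of "fst p" "snd p"] that by auto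
    then have "k integrable_on {fst p..snd p}" using integrable_on_subinterval[OF k(1)] by blast
    then have "(k has_integral integral {fst p..snd p} k) {fst p<..<snd p}"
      using has_integral_open_interval[of k _ "fst p" "snd p"] by (simp add: integrable_integral)
    moreover have "{fst p<..<snd p} \<subseteq> {a..b}" using sub by (auto simp: subset_iff)
    ultimately show ?thesis by (subst has_integral_restrict) auto
  qed
  have rs: "((\<lambda>t. \<Sum>p\<in>I. ?r p t) has_integral (\<Sum>p\<in>I. integral {fst p..snd p} k)) {a..b}"
    by (rule has_integral_sum[OF I(1) r])
  then have "(\<Sum>(u, v)\<in>I. integral {u..v} k) = integral {a..b} (\<lambda>t. \<Sum>p\<in>I. ?r p t)"
    using integral_unique[OF rs] by (simp add: split_def)
  also have "\<dots> \<le> integral {a..b} k"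
  proof (rule integral_le)
    show "(\<lambda>t. \<Sum>p\<in>I. ?r p t) integrable_on {a..b}"
      using rs by blast
    fix t
    show "(\<Sum>p\<in>I. ?r p t) \<le> k t"
    proof (cases "\<exists>p\<in>I. t \<in> {fst p<..<snd p}")
      case True
      then obtain p where p: "p \<in> I" "t \<in> {fst p<..<snd p}" by blast
      have "?r q t = 0" if "q \<in> I - {p}" for q
        using pairwiseD[OF I(2), of p q] p that by (auto simp: disjnt_iff)
      then have "(\<Sum>p\<in>I. ?r p t) = ?r p t"
        using sum.mono_neutral_right[of I "{p}" "\<lambda>p. ?r p t"] I(1) p(1) by simp
      then show ?thesis using p(2) by simp
    next
      case False
      then have "(\<Sum>p\<in>I. ?r p t) = 0" by (intro sum.neutral) auto
      then show ?thesis using k(2) by simp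
    qed
  qed (rule k)
  finally show ?thesis .
qed

text \<open>
  Cut \<open>norm (f t)\<close> off at a height \<open>n\<close> such that the integral of the excess is below \<open>e / 2\<close>.
  The excess contributes at most \<open>e / 2\<close> to any non-overlapping family of intervals, and the
  bounded part contributes at most \<open>n\<close> times their total length.
\<close>

lemma locally_abs_continuous_primitive:
  fixes f :: "real \<Rightarrow> 'b::banach"
  assumes f: "f \<in> L1loc"
  shows "locally_abs_continuous (primitive f)"
  unfolding locally_abs_continuous_iff
proof (intro allI impI)
  fix a b e :: real assume e: "e > 0"
  let ?g = "\<lambda>t. norm (f t)"
  let ?h = "\<lambda>n t. min (norm (f t)) (real n)"
  have g: "?g integrable_on {a..b}" for a b by (rule L1loc_norm_integrable[OF f])
  have ga: "?g absolutely_integrable_on {a..b}" for a b using f by (simp add: L1loc_iff)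
  have h: "?h n integrable_on {a..b}" for n a b
    by (intro set_lebesgue_integral_eq_integral(1) absolutely_integrable_min_1 ga
         absolutely_integrable_on_const) auto
  have "(\<lambda>n. integral {a..b} (?h n)) \<longlonglongrightarrow> integral {a..b} ?g"
  proof (rule dominated_convergence(2)[OF h g])
    fix t
    obtain m where "norm (f t) \<le> real m" using real_arch_simple by auto
    then have "\<forall>\<^sub>F n in sequentially. norm (f t) = ?h n t"
      by (intro eventually_sequentiallyI[of m]) auto
    then show "(\<lambda>n. ?h n t) \<longlonglongrightarrow> norm (f t)"
      by (rule Lim_transform_eventually[OF tendsto_const])
  qed auto
  then have "\<forall>\<^sub>F n in sequentially. dist (integral {a..b} (?h n)) (integral {a..b} ?g) < e / 2"
    by (rule tendstoD) (use e in simp)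
  then obtain n where n: "dist (integral {a..b} (?h n)) (integral {a..b} ?g) < e / 2"
    unfolding eventually_sequentially by auto
  let ?k = "\<lambda>t. ?g t - ?h n t"
  have k: "?k integrable_on {a..b}" for a b by (rule integrable_diff[OF g h])
  have kint: "integral {a..b} ?k < e / 2"
    using n unfolding integral_diff[OF g h] dist_real_def by linarith
  define d where "d = e / (2 * (real n + 1))"
  have "d > 0" using e by (simp add: d_def)
  moreover have "(\<Sum>(u, v)\<in>I. norm (primitive f v - primitive f u)) < e"
    if I: "nonoverlapping a b I" and small: "(\<Sum>(u, v)\<in>I. v - u) < d" for I
  proof -
    have "(\<Sum>(u, v)\<in>I. norm (primitive f v - primitive f u))
        \<le> (\<Sum>(u, v)\<in>I. integral {u..v} ?k + real n * (v - u))"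
    proof (rule sum_mono, clarify)
      fix u v assume "(u, v) \<in> I"
      then have uv: "u \<le> v" using nonoverlappingD[OF I] by blast
      have "norm (primitive f v - primitive f u) \<le> integral {u..v} ?g"
        using primitive_diff[OF L1loc_integrable[OF f] uv] L1loc_norm_integral_le[OF f] by simp
      also have "integral {u..v} ?g = integral {u..v} ?k + integral {u..v} (?h n)"
        using integral_diff[OF g h] by simp
      also have "integral {u..v} (?h n) \<le> integral {u..v} (\<lambda>t. real n)"
        by (rule integral_le[OF h]) auto
      finally show "norm (primitive f v - primitive f u) \<le> integral {u..v} ?k + real n * (v - u)"
        using uv by (simp add: mult.commute)
    qed
    also have "\<dots> = (\<Sum>(u, v)\<in>I. integral {u..v} ?k) + real n * (\<Sum>(u, v)\<in>I. v - u)"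
      by (simp add: split_def sum.distrib sum_distrib_left)
    also have "(\<Sum>(u, v)\<in>I. integral {u..v} ?k) \<le> integral {a..b} ?k"
      by (rule sum_integral_disjoint_intervals_le[OF k _ I]) auto
    also have "real n * (\<Sum>(u, v)\<in>I. v - u) \<le> real n * d"
      using small by (intro mult_left_mono) auto
    also have "real n * d \<le> e / 2"
      using e by (simp add: d_def field_simps)
    finally show ?thesis using kint by simp
  qed
  ultimately show "\<exists>d>0. \<forall>I. nonoverlapping a b I \<longrightarrow> (\<Sum>(u, v)\<in>I. v - u) < d \<longrightarrow>
      (\<Sum>(u, v)\<in>I. norm (primitive f v - primitive f u)) < e"
    by blast
qed

lemma locally_abs_continuousD:
  assumes "locally_abs_continuous f" "e > 0"
  obtains d where "d > 0"
    "\<And>I. nonoverlapping a b I \<Longrightarrow> (\<Sum>(u, v)\<in>I. v - u) < d \<Longrightarrow> (\<Sum>(u, v)\<in>I. norm (f v - f u)) < e"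
  using assms unfolding locally_abs_continuous_iff by meson

lemma locally_abs_continuous_imp_continuous:
  assumes "locally_abs_continuous f"
  shows "continuous_on UNIV f"
  unfolding continuous_on_iff
proof (intro ballI allI impI)
  fix x e :: real assume e: "e > 0"
  obtain d where d: "d > 0" "\<And>I. nonoverlapping (x - 1) (x + 1) I \<Longrightarrow>
        (\<Sum>(u, v)\<in>I. v - u) < d \<Longrightarrow> (\<Sum>(u, v)\<in>I. norm (f v - f u)) < e"
    by (rule locally_abs_continuousD[OF assms e, of "x - 1" "x + 1"]) blast
  show "\<exists>d>0. \<forall>y\<in>UNIV. dist y x < d \<longrightarrow> dist (f y) (f x) < e"
  proof (intro exI[of _ "min d 1"] conjI ballI impI)
    fix y assume y: "dist y x < min d 1"
    have "(\<Sum>(u, v)\<in>{(min x y, max x y)}. norm (f v - f u)) < e"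
      by (rule d(2)) (use y in \<open>auto simp: dist_real_def nonoverlapping_def\<close>)
    then show "dist (f y) (f x) < e"
      by (cases "x \<le> y") (auto simp: dist_norm norm_minus_commute)
  qed (use d in auto)
qed

lemma locally_abs_continuous_add_const:
  assumes "locally_abs_continuous f" "\<And>t. g t = f t + c"
  shows "locally_abs_continuous g"
  using assms(1) unfolding locally_abs_continuous_def assms(2) by simp

text \<open>
  On a compact interval both factors are bounded, so an increment of the product is at most a
  multiple of the sum of the increments of the factors.
\<close>

lemma locally_abs_continuous_bilinear:
  fixes p :: "'a::real_normed_vector \<Rightarrow> 'b::real_normed_vector \<Rightarrow> 'c::real_normed_vector"
  assumes p: "bounded_bilinear p"
    and f: "locally_abs_continuous f" and g: "locally_abs_continuous g"
  shows "locally_abs_continuous (\<lambda>t. p (f t) (g t))"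
proof -
  interpret bounded_bilinear p by (rule p)
  obtain K where K: "K > 0" "\<And>x y. norm (p x y) \<le> norm x * norm y * K"
    using pos_bounded by blast
  show ?thesis
    unfolding locally_abs_continuous_iff
  proof (intro allI impI)
    fix a b e :: real assume e: "e > 0"
    have "compact (f ` {a..b})" "compact (g ` {a..b})"
      by (intro compact_continuous_image continuous_on_subset[OF locally_abs_continuous_imp_continuous] f g; simp)+
    then have "bounded (f ` {a..b})" "bounded (g ` {a..b})" by (auto intro: compact_imp_bounded)
    then obtain B1 B2 where B12: "\<And>t. t \<in> {a..b} \<Longrightarrow> norm (f t) \<le> B1" "\<And>t. t \<in> {a..b} \<Longrightarrow> norm (g t) \<le> B2"
      unfolding bounded_iff by blast
    define B where "B = max 1 (max B1 B2)"
    have B: "B > 0" "\<And>t. t \<in> {a..b} \<Longrightarrow> norm (f t) \<le> B" "\<And>t. t \<in> {a..b} \<Longrightarrow> norm (g t) \<le> B"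
      using B12 unfolding B_def by (auto simp: le_max_iff_disj)
    define e' where "e' = e / (2 * K * B)"
    have e': "e' > 0" using e K(1) B(1) by (simp add: e'_def)
    obtain d1 where d1: "d1 > 0" "\<And>I. nonoverlapping a b I \<Longrightarrow>
        (\<Sum>(u, v)\<in>I. v - u) < d1 \<Longrightarrow> (\<Sum>(u, v)\<in>I. norm (f v - f u)) < e'"
      by (rule locally_abs_continuousD[OF f e', of a b]) blast
    obtain d2 where d2: "d2 > 0" "\<And>I. nonoverlapping a b I \<Longrightarrow>
        (\<Sum>(u, v)\<in>I. v - u) < d2 \<Longrightarrow> (\<Sum>(u, v)\<in>I. norm (g v - g u)) < e'"
      by (rule locally_abs_continuousD[OF g e', of a b]) blast
    show "\<exists>d>0. \<forall>I. nonoverlapping a b I \<longrightarrow> (\<Sum>(u, v)\<in>I. v - u) < d \<longrightarrow>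
      (\<Sum>(u, v)\<in>I. norm (p (f v) (g v) - p (f u) (g u))) < e"
    proof (intro exI[of _ "min d1 d2"] conjI allI impI)
      show "0 < min d1 d2" using d1 d2 by simp
      fix I assume I: "nonoverlapping a b I" and small: "(\<Sum>(u, v)\<in>I. v - u) < min d1 d2"
      have "(\<Sum>(u, v)\<in>I. norm (p (f v) (g v) - p (f u) (g u)))
          \<le> (\<Sum>(u, v)\<in>I. K * B * norm (f v - f u) + K * B * norm (g v - g u))"
      proof (rule sum_mono, clarify)
        fix u v assume uv: "(u, v) \<in> I"
        then have t: "u \<in> {a..b}" "v \<in> {a..b}" using nonoverlappingD[OF I uv] by auto
        have "p (f v) (g v) - p (f u) (g u) = p (f v - f u) (g v) + p (f u) (g v - g u)"
          by (simp add: diff_left diff_right)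
        then have "norm (p (f v) (g v) - p (f u) (g u)) \<le> norm (p (f v - f u) (g v)) + norm (p (f u) (g v - g u))"
          by (metis norm_triangle_ineq)
        also have "\<dots> \<le> norm (f v - f u) * norm (g v) * K + norm (f u) * norm (g v - g u) * K"
          by (intro add_mono K)
        also have "\<dots> \<le> norm (f v - f u) * B * K + B * norm (g v - g u) * K"
          using B t K(1) by (intro add_mono mult_right_mono mult_left_mono) auto
        finally show "norm (p (f v) (g v) - p (f u) (g u)) \<le> K * B * norm (f v - f u) + K * B * norm (g v - g u)"
          by (simp add: mult_ac)
      qed
      also have "\<dots> = K * B * ((\<Sum>(u, v)\<in>I. norm (f v - f u)) + (\<Sum>(u, v)\<in>I. norm (g v - g u)))"
        by (simp add: split_def sum.distrib sum_distrib_left distrib_left)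
      also have "\<dots> < K * B * (e' + e')"
        using d1(2)[OF I] d2(2)[OF I] small K(1) B(1)
        by (intro mult_strict_left_mono add_strict_mono) auto
      also have "\<dots> = e" using K(1) B(1) by (simp add: e'_def field_simps)
      finally show "(\<Sum>(u, v)\<in>I. norm (p (f v) (g v) - p (f u) (g u))) < e" .
    qed
  qed
qed

text \<open>
  A gauge can treat the exceptional points separately. At a tag outside \<open>N\<close> it is chosen by
  differentiability, and the error on an interval is a small multiple of its length. Intervals
  tagged in \<open>N\<close> are kept inside an open set \<open>U\<close> of small measure. There \<open>f\<close> contributes nothing
  to the Riemann sum, and absolute continuity makes the increments of \<open>F\<close> small in total.
\<close>

theorem abs_continuous_has_integral:
  fixes F f :: "real \<Rightarrow> 'b::banach"
  assumes F: "locally_abs_continuous F" and N: "negligible N" and "a \<le> b"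
    and deriv: "\<And>t. t \<notin> N \<Longrightarrow> (F has_vector_derivative f t) (at t)"
    and zero: "\<And>t. t \<in> N \<Longrightarrow> f t = 0"
  shows "(f has_integral F b - F a) {a..b}"
  unfolding has_integral_real
proof (intro allI impI)
  fix e :: real assume e: "e > 0"
  define \<eta> where "\<eta> = e / (2 * (b - a + 1))"
  have \<eta>: "\<eta> > 0" "\<eta> * (b - a) \<le> e / 2" using e \<open>a \<le> b\<close> by (auto simp: \<eta>_def field_simps)
  have "\<exists>d>0. \<forall>y. norm (y - t) < d \<longrightarrow> norm (F y - F t - (y - t) *\<^sub>R f t) \<le> \<eta> * norm (y - t)"
    if "t \<notin> N" for t
    using deriv[OF that] \<eta>(1) unfolding has_vector_derivative_def has_derivative_at_alt by blast
  then obtain d where d: "\<And>t. t \<notin> N \<Longrightarrow> d t > 0"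
    "\<And>t y. t \<notin> N \<Longrightarrow> norm (y - t) < d t \<Longrightarrow> norm (F y - F t - (y - t) *\<^sub>R f t) \<le> \<eta> * norm (y - t)"
    by metis
  obtain \<delta> where \<delta>: "\<delta> > 0" "\<And>I. nonoverlapping a b I \<Longrightarrow>
        (\<Sum>(u, v)\<in>I. v - u) < \<delta> \<Longrightarrow> (\<Sum>(u, v)\<in>I. norm (F v - F u)) < e / 2"
    by (rule locally_abs_continuousD[OF F, of "e / 2" a b]) (use e in auto)
  have Nn: "N \<in> null_sets lebesgue" using N by (simp add: negligible_iff_null_sets)
  obtain U where U: "open U" "N \<subseteq> U" "U \<in> lmeasurable" "measure lebesgue U < \<delta>"
  proof -
    obtain U where U: "open U" "N \<subseteq> U" "U - N \<in> lmeasurable" "emeasure lebesgue (U - N) < ennreal \<delta>"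
      using sets_lebesgue_outer_open[of N \<delta>] Nn \<delta>(1) by auto
    have UU: "(U - N) \<union> N = U" using U(2) by auto
    have "N \<in> lmeasurable" by (rule negligible_imp_measurable[OF N])
    then have "U \<in> lmeasurable" using fmeasurable.Un[OF U(3)] UU by metis
    moreover have "measure lebesgue U = measure lebesgue (U - N)"
      using emeasure_Un_null_set[of "U - N" lebesgue N] Nn U(3) UU by (auto simp: measure_def)
    moreover have "ennreal (measure lebesgue (U - N)) < ennreal \<delta>"
      using U(4) emeasure_eq_measure2[OF U(3)] by simp
    ultimately have "U \<in> lmeasurable" "measure lebesgue U < \<delta>"
      by (simp_all add: ennreal_less_iff)
    then show ?thesis using that U by blast
  qed
  have dU: "((\<lambda>t. indicat_real U t) has_integral measure lebesgue U) UNIV"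
    using U(3) by (rule lmeasurable_iff_has_integral[THEN iffD1])
  then have iU: "(\<lambda>t. indicat_real U t) integrable_on {u..v}" for u v
    using integrable_on_subcbox[of "\<lambda>t. indicat_real U t" UNIV u v] by auto
  define \<gamma> where "\<gamma> t = (if t \<in> N then U else ball t (d t))" for t
  show "\<exists>\<gamma>. gauge \<gamma> \<and> (\<forall>p. p tagged_division_of {a..b} \<and> \<gamma> fine p \<longrightarrow>
      norm ((\<Sum>(t,K)\<in>p. measure lborel K *\<^sub>R f t) - (F b - F a)) < e)"
  proof (intro exI[of _ \<gamma>] conjI allI impI; (elim conjE)?)
    show "gauge \<gamma>"
      using U(1,2) d(1) by (auto simp: gauge_def \<gamma>_def)
    fix p assume p: "p tagged_division_of {a..b}" and fine: "\<gamma> fine p"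
    have finp: "finite p" using p by (rule tagged_division_of_finite)
    have K: "\<exists>u v. K = {u..v} \<and> Inf K = u \<and> Sup K = v \<and> u \<le> t \<and> t \<le> v \<and> a \<le> u \<and> v \<le> b \<and> K \<subseteq> \<gamma> t"
      if tK: "(t, K) \<in> p" for t K
    proof -
      obtain u v where uv: "K = cbox u v" using tagged_division_ofD(4)[OF p tK] by blast
      moreover have "t \<in> K" by (rule tagged_division_ofD(2)[OF p tK])
      moreover have "K \<subseteq> {a..b}" by (rule tagged_division_ofD(3)[OF p tK])
      moreover have "K \<subseteq> \<gamma> t" using fineD[OF fine tK] .
      ultimately show ?thesis by (intro exI[of _ u] exI[of _ v]) auto
    qed
    define p1 where "p1 = {(t, K) \<in> p. t \<notin> N}"
    define p2 where "p2 = {(t, K) \<in> p. t \<in> N}"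
    have fin: "finite p1" "finite p2" and un: "p = p1 \<union> p2" "p1 \<inter> p2 = {}"
      using finp by (auto simp: p1_def p2_def intro: finite_subset[OF _ finp])
    let ?D = "\<lambda>(t, K). measure lborel K *\<^sub>R f t - (F (Sup K) - F (Inf K))"
    have "(\<Sum>(t,K)\<in>p. measure lborel K *\<^sub>R f t) - (F b - F a) = (\<Sum>x\<in>p. ?D x)"
      using additive_tagged_division_1[OF \<open>a \<le> b\<close> p, of F] by (simp add: split_def sum_subtractf)
    also have "\<dots> = (\<Sum>x\<in>p1. ?D x) + (\<Sum>x\<in>p2. ?D x)"
      unfolding un(1) by (rule sum.union_disjoint[OF fin un(2)])
    finally have "norm ((\<Sum>(t,K)\<in>p. measure lborel K *\<^sub>R f t) - (F b - F a))
        \<le> norm (\<Sum>x\<in>p1. ?D x) + norm (\<Sum>x\<in>p2. ?D x)"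
      by (simp add: norm_triangle_ineq)
    also have "norm (\<Sum>x\<in>p1. ?D x) \<le> e / 2"
    proof -
      have "norm (\<Sum>x\<in>p1. ?D x) \<le> (\<Sum>(t, K)\<in>p1. \<eta> * measure lborel K)"
      proof (rule sum_norm_le, clarify)
        fix t K assume "(t, K) \<in> p1"
        then have tK: "(t, K) \<in> p" and t: "t \<notin> N" by (auto simp: p1_def)
        obtain u v where uv: "K = {u..v}" "Inf K = u" "Sup K = v" "u \<le> t" "t \<le> v" "K \<subseteq> \<gamma> t"
          using K[OF tK] by blast
        have "u \<in> \<gamma> t" "v \<in> \<gamma> t" using uv by auto
        then have "norm (u - t) < d t" "norm (v - t) < d t"
          using t by (simp_all add: \<gamma>_def dist_norm norm_minus_commute)
        note du = d(2)[OF t this(1)] d(2)[OF t this(2)]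
        have "measure lborel K *\<^sub>R f t - (F (Sup K) - F (Inf K))
            = (F u - F t - (u - t) *\<^sub>R f t) - (F v - F t - (v - t) *\<^sub>R f t)"
          using uv by (simp add: algebra_simps)
        then have "norm (measure lborel K *\<^sub>R f t - (F (Sup K) - F (Inf K)))
            \<le> norm (F u - F t - (u - t) *\<^sub>R f t) + norm (F v - F t - (v - t) *\<^sub>R f t)"
          by (metis norm_triangle_ineq4)
        also have "\<dots> \<le> \<eta> * norm (u - t) + \<eta> * norm (v - t)" using du by simp
        also have "norm (u - t) = t - u" using uv by simp
        also have "norm (v - t) = v - t" using uv by simp
        also have "\<eta> * (t - u) + \<eta> * (v - t) = \<eta> * measure lborel K"
          using uv by (simp add: algebra_simps)
        finally show "norm (measure lborel K *\<^sub>R f t - (F (Sup K) - F (Inf K))) \<le> \<eta> * measure lborel K" .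
      qed
      also have "\<dots> \<le> (\<Sum>(t, K)\<in>p. \<eta> * measure lborel K)"
        using finp un(1) \<eta>(1) by (intro sum_mono2) auto
      also have "\<dots> = \<eta> * (b - a)"
        using additive_content_tagged_division[of p a b] p \<open>a \<le> b\<close> by (simp add: split_def sum_distrib_left[symmetric])
      finally show ?thesis using \<eta>(2) by linarith
    qed
    also have "norm (\<Sum>x\<in>p2. ?D x) < e / 2"
    proof -
      let ?i = "\<lambda>(t::real, K::real set). (Inf K, Sup K)"
      let ?I = "?i ` p2"
      have disj: "{Inf K<..<Sup K} \<inter> {Inf K'<..<Sup K'} = {}"
        if "(t, K) \<in> p2" "(t', K') \<in> p2" "(t, K) \<noteq> (t', K')" for t K t' K'
      proof -
        have "(t, K) \<in> p" "(t', K') \<in> p" using that by (auto simp: p2_def)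
        then have "interior K \<inter> interior K' = {}" using tagged_division_ofD(5)[OF p] that(3) by blast
        moreover have "interior L = {Inf L<..<Sup L}" if tL: "(s, L) \<in> p" for s L
        proof -
          obtain u v where "L = {u..v}" "Inf L = u" "Sup L = v" using K[OF tL] by blast
          then show ?thesis by (simp only: interior_atLeastAtMost_real)
        qed
        ultimately show ?thesis using \<open>(t, K) \<in> p\<close> \<open>(t', K') \<in> p\<close> by metis
      qed
      \<comment> \<open>two tagged pairs can share an interval only if it is a point, and there \<open>g\<close> vanishes\<close>
      have reindex: "(\<Sum>(u, v)\<in>?I. g u v) = (\<Sum>(t, K)\<in>p2. g (Inf K) (Sup K))"
        if "\<And>u. g u u = 0" for g :: "real \<Rightarrow> real \<Rightarrow> real"
      proof -
        have "(\<Sum>x\<in>?I. case x of (u, v) \<Rightarrow> g u v) = (\<Sum>x\<in>p2. ((\<lambda>(u, v). g u v) \<circ> ?i) x)"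
        proof (rule sum.reindex_nontrivial[OF fin(2)])
          fix x y assume xy: "x \<in> p2" "y \<in> p2" "x \<noteq> y" "?i x = ?i y"
          obtain t K t' K' where x: "x = (t, K)" and y: "y = (t', K')" by fastforce
          have "Inf K \<le> Sup K" using K[of t K] xy(1) x by (auto simp: p2_def)
          moreover have "{Inf K<..<Sup K} = {}" using disj[of t K t' K'] xy x y by force
          ultimately have "Inf K = Sup K" by simp
          then show "(case ?i x of (u, v) \<Rightarrow> g u v) = 0" using that x by simp
        qed
        also have "\<dots> = (\<Sum>(t, K)\<in>p2. g (Inf K) (Sup K))"
          by (rule sum.cong) auto
        finally show ?thesis .
      qed
      have If: "finite ?I" using fin(2) by simp
      have Ib: "a \<le> u \<and> u \<le> v \<and> v \<le> b" if "(u, v) \<in> ?I" for u v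
        using that K by (force simp: p2_def)
      have Id: "pairwise (\<lambda>p q. disjnt {fst p<..<snd p} {fst q<..<snd q}) ?I"
        unfolding pairwise_def disjnt_def
      proof (intro ballI impI)
        fix x y assume "x \<in> ?I" "y \<in> ?I" "x \<noteq> y"
        then obtain t K t' K' where "(t, K) \<in> p2" "(t', K') \<in> p2" "x = (Inf K, Sup K)" "y = (Inf K', Sup K')"
          by auto
        then show "{fst x<..<snd x} \<inter> {fst y<..<snd y} = {}"
          using disj[of t K t' K'] \<open>x \<noteq> y\<close> by auto
      qed
      have non: "nonoverlapping a b ?I"
        unfolding nonoverlapping_def using If Ib Id by blast
      have "(\<Sum>(u, v)\<in>?I. v - u) \<le> (\<Sum>(u, v)\<in>?I. integral {u..v} (indicat_real U))"
      proof (rule sum_mono, clarify)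
        fix t K assume "(t, K) \<in> p2"
        then have tK: "(t, K) \<in> p" "t \<in> N" by (auto simp: p2_def)
        then obtain u v where uv: "K = {u..v}" "Inf K = u" "Sup K = v" "u \<le> t" "t \<le> v" "K \<subseteq> U"
          using K[OF tK(1)] tK(2) by (auto simp: \<gamma>_def)
        have "integral {u..v} (indicat_real U) = integral {u..v} (\<lambda>t. 1)"
          by (rule integral_cong) (use uv in auto)
        then show "Sup K - Inf K \<le> integral {Inf K..Sup K} (indicat_real U)"
          using uv by simp
      qed
      also have "\<dots> \<le> integral {a..b} (indicat_real U)"
        by (rule sum_integral_disjoint_intervals_le[OF iU _ non]) auto
      also have "\<dots> \<le> measure lebesgue U"
        by (rule has_integral_subset_le[OF _ integrable_integral[OF iU] dU]) auto
      also note U(4)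
      finally have "(\<Sum>(u, v)\<in>?I. norm (F v - F u)) < e / 2"
        by (rule \<delta>(2)[OF non])
      moreover have "norm (\<Sum>x\<in>p2. ?D x) \<le> (\<Sum>(t, K)\<in>p2. norm (F (Sup K) - F (Inf K)))"
        by (rule sum_norm_le) (auto simp: p2_def zero norm_minus_commute)
      ultimately show ?thesis using reindex[of "\<lambda>u v. norm (F v - F u)"] by simp
    qed
    finally show "norm ((\<Sum>(t,K)\<in>p. measure lborel K *\<^sub>R f t) - (F b - F a)) < e" by simp
  qed
qed

lemma negligible_uminus_image:
  fixes N :: "real set"
  assumes "negligible N"
  shows "negligible (uminus ` N)"
  by (rule negligible_differentiable_image_negligible[OF _ assms])
     (auto intro!: derivative_intros simp: differentiable_on_def)

text \<open>
  The right derivative exists almost everywhere. The left derivative of the primitive of \<open>g\<close> at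
  \<open>t\<close> is the right derivative at \<open>- t\<close> of the primitive of the reflected function.
\<close>

lemma primitive_has_derivative_real:
  fixes g :: "real \<Rightarrow> real"
  assumes g: "\<And>a b. g integrable_on {a..b}"
  shows "\<exists>N. negligible N \<and> (\<forall>t. t \<notin> N \<longrightarrow> (primitive g has_vector_derivative g t) (at t))"
proof -
  obtain N1 where N1: "negligible N1"
    "\<And>x e. x \<notin> N1 \<Longrightarrow> 0 < e \<Longrightarrow> \<exists>d>0. \<forall>h. 0 < h \<and> h < d \<longrightarrow>
        norm (integral (cbox x (x + h *\<^sub>R One)) g /\<^sub>R h ^ DIM(real) - g x) < e"
    using integrable_ccontinuous_explicit[of g] g by auto
  have gr: "(\<lambda>t. g (- t)) integrable_on {a..b}" for a b
    using g[of "- b" "- a"] Henstock_Kurzweil_Integration.integrable_reflect_real[of g "- a" "- b"] by simp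
  obtain N2 where N2: "negligible N2"
    "\<And>x e. x \<notin> N2 \<Longrightarrow> 0 < e \<Longrightarrow> \<exists>d>0. \<forall>h. 0 < h \<and> h < d \<longrightarrow>
        norm (integral (cbox x (x + h *\<^sub>R One)) (\<lambda>t. g (- t)) /\<^sub>R h ^ DIM(real) - g (- x)) < e"
    using integrable_ccontinuous_explicit[of "\<lambda>t. g (- t)"] gr by auto
  have "(primitive g has_vector_derivative g t) (at t)" if t: "t \<notin> N1 \<union> uminus ` N2" for t
    unfolding has_vector_derivative_def has_derivative_at_alt
  proof (intro conjI allI impI)
    fix e :: real assume e: "e > 0"
    have t1: "t \<notin> N1" and t2: "- t \<notin> N2" using t by (auto simp: image_iff) 
    obtain d1 where d1: "d1 > 0" "\<And>h. 0 < h \<Longrightarrow> h < d1 \<Longrightarrow> \<bar>integral {t..t + h} g / h - g t\<bar> < e"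
      using N1(2)[OF t1 e] by (auto simp: divide_inverse mult.commute)
    obtain d2 where d2: "d2 > 0" "\<And>h. 0 < h \<Longrightarrow> h < d2 \<Longrightarrow> \<bar>integral {- t..- t + h} (\<lambda>t. g (- t)) / h - g t\<bar> < e"
      using N2(2)[OF t2 e] by (auto simp: divide_inverse mult.commute)
    \<comment> \<open>from difference quotients to increments\<close>
    have scale: "\<bar>I - h * c\<bar> \<le> e * h" if "\<bar>I / h - c\<bar> < e" "h > 0" for I h c :: real
    proof -
      have "\<bar>I - h * c\<bar> = \<bar>I / h - c\<bar> * h" using that(2) by (simp add: abs_mult_pos field_simps)
      then show ?thesis using that by (simp add: mult_right_mono)
    qed
    show "\<exists>d>0. \<forall>y. norm (y - t) < d \<longrightarrow>
        norm (primitive g y - primitive g t - (y - t) *\<^sub>R g t) \<le> e * norm (y - t)"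
    proof (intro exI[of _ "min d1 d2"] conjI allI impI)
      fix y assume y: "norm (y - t) < min d1 d2"
      consider "y = t" | "y > t" | "y < t" by linarith
      then show "norm (primitive g y - primitive g t - (y - t) *\<^sub>R g t) \<le> e * norm (y - t)"
      proof cases
        case 2
        then have "primitive g y - primitive g t = integral {t..t + (y - t)} g"
          using primitive_diff[of g t y, OF g] by simp
        then show ?thesis using scale[OF d1(2)[of "y - t"]] 2 y by simp
      next
        case 3
        then have "primitive g t - primitive g y = integral {- t..- t + (t - y)} (\<lambda>t. g (- t))"
          using primitive_diff[of g y t, OF g] Henstock_Kurzweil_Integration.integral_reflect_real[of t y g] by simp
        then have "\<bar>(primitive g t - primitive g y) - (t - y) * g t\<bar> \<le> e * (t - y)"
          using scale[OF d2(2)[of "t - y"]] 3 y by simp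
        moreover have "(primitive g t - primitive g y) - (t - y) * g t = - (primitive g y - primitive g t - (y - t) *\<^sub>R g t)"
          by (simp add: algebra_simps)
        ultimately show ?thesis using 3 by simp
      qed simp
    qed (use d1 d2 in auto)
  qed (rule bounded_linear_scaleR_left)
  moreover have "negligible (N1 \<union> uminus ` N2)"
    using N1(1) N2(1) by (intro negligible_Un negligible_uminus_image)
  ultimately show ?thesis by blast
qed

text \<open>
  Let \<open>c\<close> range over the countably many values of the simple functions that approximate \<open>f\<close>, and
  discard the null sets on which the real theorem fails for some \<open>norm (f t - c)\<close>. At any other
  \<open>t\<close> where the approximation converges, some \<open>c\<close> is close to \<open>f t\<close>. The difference quotients of
  the primitive of \<open>f\<close> differ from \<open>c\<close> by at most those of the primitive of \<open>norm (f t - c)\<close>,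
  and these tend to the small number \<open>norm (f t - c)\<close>.
\<close>

theorem primitive_has_derivative_AE:
  fixes f :: "real \<Rightarrow> 'b::banach"
  assumes f: "f \<in> L1loc"
  shows "AE t in lebesgue. (primitive f has_vector_derivative f t) (at t)"
proof -
  obtain s where s: "\<And>i::nat. simple_function lebesgue (s i)"
      and sl: "AE t in lebesgue. (\<lambda>i. s i t) \<longlonglongrightarrow> f t"
    using f unfolding L1loc_iff strongly_measurable_def by auto
  define C where "C = (\<Union>i. range (s i))"
  have "countable C"
    using s unfolding C_def by (auto simp: simple_function_def intro: countable_finite)
  have fc: "(\<lambda>t. f t - c) \<in> L1loc" for c
    by (rule L1loc_diff[OF f continuous_imp_L1loc]) simp
  note nfc = L1loc_norm_integrable[OF fc]
  obtain N where N: "\<And>c. negligible (N c)"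
    "\<And>c t. t \<notin> N c \<Longrightarrow> (primitive (\<lambda>t. norm (f t - c)) has_vector_derivative norm (f t - c)) (at t)"
    using primitive_has_derivative_real[OF nfc] by metis
  have "negligible (\<Union>c\<in>C. N c)"
    using \<open>countable C\<close> N(1) by (intro negligible_countable_Union) auto
  then have "AE t in lebesgue. t \<notin> (\<Union>c\<in>C. N c)"
    unfolding negligible_iff_null_sets by (rule AE_not_in)
  with sl show ?thesis
  proof eventually_elim
    fix t assume l: "(\<lambda>i. s i t) \<longlonglongrightarrow> f t" and tN: "t \<notin> (\<Union>c\<in>C. N c)"
    show "(primitive f has_vector_derivative f t) (at t)"
      unfolding has_vector_derivative_def has_derivative_at_alt
    proof (intro conjI allI impI)
      fix e :: real assume e: "e > 0"
      have "\<forall>\<^sub>F i in sequentially. dist (s i t) (f t) < e / 3"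
        by (rule tendstoD[OF l]) (use e in simp)
      then obtain i where i: "dist (s i t) (f t) < e / 3" unfolding eventually_sequentially by auto
      define c where "c = s i t"
      have c: "c \<in> C" "norm (f t - c) < e / 3"
        using i unfolding C_def c_def by (auto simp: dist_norm norm_minus_commute)
      let ?G = "primitive (\<lambda>t. norm (f t - c))"
      obtain d where d: "d > 0" "\<And>y. norm (y - t) < d \<Longrightarrow>
          norm (?G y - ?G t - (y - t) *\<^sub>R norm (f t - c)) \<le> e / 3 * norm (y - t)"
        using N(2)[of t c] tN c(1) e unfolding has_vector_derivative_def has_derivative_at_alt
        by (metis UN_I divide_pos_pos zero_less_numeral)
      have est: "norm (primitive f v - primitive f u - (v - u) *\<^sub>R c) \<le> ?G v - ?G u" if "u \<le> v" for u v
      proof -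
        have "primitive f v - primitive f u - (v - u) *\<^sub>R c = integral {u..v} (\<lambda>t. f t - c)"
          using primitive_diff[OF L1loc_integrable[OF f] that] that
            integral_unique[OF has_integral_diff[OF integrable_integral[OF L1loc_integrable[OF f, of u v]]
              has_integral_const_real[of c u v]]] by simp
        then show ?thesis
          using L1loc_norm_integral_le[OF fc] primitive_diff[OF nfc that] by simp
      qed
      have est': "norm (primitive f y - primitive f t - (y - t) *\<^sub>R c) \<le> \<bar>?G y - ?G t\<bar>" for y
      proof (cases "t \<le> y")
        case True
        then show ?thesis using est[OF True] by linarith
      next
        case False
        then have "norm (primitive f t - primitive f y - (t - y) *\<^sub>R c) \<le> ?G t - ?G y"
          by (intro est) simp
        moreover have "primitive f t - primitive f y - (t - y) *\<^sub>R c = - (primitive f y - primitive f t - (y - t) *\<^sub>R c)"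
          by (simp add: algebra_simps)
        ultimately have "norm (primitive f y - primitive f t - (y - t) *\<^sub>R c) \<le> ?G t - ?G y"
          by (simp only: norm_minus_cancel)
        then show ?thesis by linarith
      qed
      show "\<exists>d>0. \<forall>y. norm (y - t) < d \<longrightarrow>
          norm (primitive f y - primitive f t - (y - t) *\<^sub>R f t) \<le> e * norm (y - t)"
      proof (intro exI[of _ d] conjI allI impI)
        fix y assume y: "norm (y - t) < d"
        have "primitive f y - primitive f t - (y - t) *\<^sub>R f t
            = (primitive f y - primitive f t - (y - t) *\<^sub>R c) - (y - t) *\<^sub>R (f t - c)"
          by (simp add: scaleR_diff_right)
        then have "norm (primitive f y - primitive f t - (y - t) *\<^sub>R f t)
            \<le> norm (primitive f y - primitive f t - (y - t) *\<^sub>R c) + norm ((y - t) *\<^sub>R (f t - c))"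
          by (simp only: norm_triangle_ineq4)
        also have "\<dots> \<le> \<bar>?G y - ?G t\<bar> + norm (y - t) * norm (f t - c)"
          using est'[of y] by simp
        also have "\<bar>?G y - ?G t\<bar> \<le> norm (?G y - ?G t - (y - t) *\<^sub>R norm (f t - c)) + norm (y - t) * norm (f t - c)"
          using norm_triangle_ineq[of "?G y - ?G t - (y - t) *\<^sub>R norm (f t - c)" "(y - t) *\<^sub>R norm (f t - c)"]
          by (simp add: abs_mult)
        also have "norm (?G y - ?G t - (y - t) *\<^sub>R norm (f t - c)) \<le> e / 3 * norm (y - t)" by (rule d(2)[OF y])
        finally have "norm (primitive f y - primitive f t - (y - t) *\<^sub>R f t)
            \<le> norm (y - t) * (e / 3 + 2 * norm (f t - c))"
          by (simp add: algebra_simps)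
        also have "\<dots> \<le> norm (y - t) * e" using c(2) by (intro mult_left_mono) auto
        finally show "norm (primitive f y - primitive f t - (y - t) *\<^sub>R f t) \<le> e * norm (y - t)"
          by (simp add: mult.commute)
      qed (rule d)
    qed (rule bounded_linear_scaleR_left)
  qed
qed

lemma eq_primitive:
  fixes f f' :: "real \<Rightarrow> 'b::banach"
  assumes "\<And>t. (f has_vector_derivative f' t) (at t)" "continuous_on UNIV f'"
  shows "f t = primitive f' t + f 0"
proof -
  have "((\<lambda>t. f t - primitive f' t) has_vector_derivative f' t - f' t) (at t within UNIV)" for t
    using assms by (intro has_vector_derivative_diff primitive_derivative)
  then obtain c where "\<And>t. f t - primitive f' t = c"
    using has_vector_derivative_zero_constant[of UNIV "\<lambda>t. f t - primitive f' t"] by auto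
  from this[of t] this[of 0] show ?thesis by (simp add: primitive_def algebra_simps)
qed

lemma locally_abs_continuous_C1:
  fixes f f' :: "real \<Rightarrow> 'b::banach"
  assumes "\<And>t. (f has_vector_derivative f' t) (at t)" "continuous_on UNIV f'"
  shows "locally_abs_continuous f"
  using locally_abs_continuous_primitive[OF continuous_imp_L1loc[OF assms(2)]] eq_primitive[OF assms]
  by (rule locally_abs_continuous_add_const)

text \<open>
  The product \<open>p (\<phi> t) (F t)\<close> is locally absolutely continuous, vanishes at both end points, and
  satisfies the product rule almost everywhere.
\<close>

lemma integral_by_parts_vanishing:
  fixes p :: "'a::banach \<Rightarrow> 'b::banach \<Rightarrow> 'c::banach"
  assumes p: "bounded_bilinear p"
    and \<phi>: "\<And>t. (\<phi> has_vector_derivative \<phi>' t) (at t)" "continuous_on UNIV \<phi>'"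
    and "a \<le> b" "\<phi> a = 0" "\<phi> b = 0"
    and F: "locally_abs_continuous F" "AE t in lebesgue. (F has_vector_derivative f t) (at t)"
    and f: "f \<in> L1loc"
  shows "integral {a..b} (\<lambda>t. p (\<phi> t) (f t)) = - integral {a..b} (\<lambda>t. p (\<phi>' t) (F t))"
proof -
  interpret bounded_bilinear p by (rule p)
  obtain N where N: "N \<in> null_sets lebesgue" "\<And>t. t \<notin> N \<Longrightarrow> (F has_vector_derivative f t) (at t)"
    using F(2) unfolding completion.AE_iff_null_sets by auto
  have Nn: "negligible N" using N(1) by (simp add: negligible_iff_null_sets)
  have \<phi>c: "continuous_on UNIV \<phi>"
    using \<phi>(1) by (meson continuous_at_imp_continuous_on has_vector_derivative_continuous)
  let ?h = "\<lambda>t. p (\<phi> t) (f t) + p (\<phi>' t) (F t)"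
  have "((\<lambda>t. if t \<in> N then 0 else ?h t) has_integral p (\<phi> b) (F b) - p (\<phi> a) (F a)) {a..b}"
  proof (rule abs_continuous_has_integral[OF _ Nn \<open>a \<le> b\<close>])
    show "locally_abs_continuous (\<lambda>t. p (\<phi> t) (F t))"
      by (rule locally_abs_continuous_bilinear[OF p locally_abs_continuous_C1[OF \<phi>] F(1)])
    show "((\<lambda>t. p (\<phi> t) (F t)) has_vector_derivative (if t \<in> N then 0 else ?h t)) (at t)" if "t \<notin> N" for t
      using has_vector_derivative[OF \<phi>(1) N(2)[OF that]] that by simp
  qed simp
  then have "((\<lambda>t. if t \<in> N then 0 else ?h t) has_integral 0) {a..b}"
    using assms(5,6) by (simp add: zero_left)
  then have h0: "(?h has_integral 0) {a..b}"
    by (rule has_integral_spike[OF Nn, rotated]) auto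
  have "(\<lambda>t. p (\<phi> t) (f t)) integrable_on {a..b}"
    by (rule L1loc_integrable[OF L1loc_bilinear[OF p \<phi>c f]])
  moreover have "(\<lambda>t. p (\<phi>' t) (F t)) integrable_on {a..b}"
    by (rule L1loc_integrable[OF L1loc_bilinear[OF p \<phi>(2) continuous_imp_L1loc]])
       (rule locally_abs_continuous_imp_continuous[OF F(1)])
  ultimately show ?thesis
    using integral_unique[OF h0] by (simp add: Henstock_Kurzweil_Integration.integral_add eq_neg_iff_add_eq_0)
qed

section \<open>Test functions\<close>

text \<open>
  The iterated derivatives are determined by a sequence of functions each of which is the
  derivative of its predecessor; all closure properties of smooth functions below exhibit such a
  sequence.
\<close>

lemma smoothI:
  assumes "F 0 = f" "\<And>k t. (F k has_vector_derivative F (Suc k) t) (at t)"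
  shows "smooth f" and "(vderiv ^^ k) f = F k"
proof -
  have *: "(vderiv ^^ k) f = F k" for k
  proof (induction k)
    case (Suc k)
    have "vderiv (F k) = F (Suc k)"
      unfolding vderiv_def using assms(2) by (auto intro: vector_derivative_at)
    then show ?case using Suc by simp
  qed (simp add: assms(1))
  then show "(vderiv ^^ k) f = F k" .
  show "smooth f"
    unfolding smooth_def * using assms(2) by (blast intro: differentiableI_vector)
qed

lemma smoothD:
  assumes "smooth f"
  shows "((vderiv ^^ k) f has_vector_derivative (vderiv ^^ Suc k) f t) (at t)"
proof -
  have "(vderiv ^^ k) f differentiable (at t)" using assms by (simp add: smooth_def)
  then have "((vderiv ^^ k) f has_vector_derivative vector_derivative ((vderiv ^^ k) f) (at t)) (at t)"
    by (rule vector_derivative_works[THEN iffD1])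
  then show ?thesis by (simp add: vderiv_def)
qed

lemma smooth_has_derivative: "smooth f \<Longrightarrow> (f has_vector_derivative vderiv f t) (at t)"
  using smoothD[of f 0] by simp

lemma smooth_continuous: "smooth f \<Longrightarrow> continuous_on UNIV ((vderiv ^^ k) f)"
  using smoothD[of f k] by (meson continuous_at_imp_continuous_on has_vector_derivative_continuous)

lemma smooth_vderiv:
  assumes "smooth f"
  shows "smooth (vderiv f)" and "(vderiv ^^ k) (vderiv f) = (vderiv ^^ Suc k) f"
proof -
  have d: "((vderiv ^^ Suc k) f has_vector_derivative (vderiv ^^ Suc (Suc k)) f t) (at t)" for k t
    by (rule smoothD[OF assms])
  note s = smoothI[of "\<lambda>k. (vderiv ^^ Suc k) f" "vderiv f", OF _ d]
  show "smooth (vderiv f)" by (rule s(1)) simp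
  show "(vderiv ^^ k) (vderiv f) = (vderiv ^^ Suc k) f" by (rule s(2)) simp
qed

lemma test_functions_in_iff:
  "\<phi> \<in> test_functions_in {- r..r} \<longleftrightarrow> smooth \<phi> \<and> (\<forall>t. r < \<bar>t\<bar> \<longrightarrow> \<phi> t = 0)"
proof -
  have "closure {t. \<phi> t \<noteq> 0} \<subseteq> {- r..r} \<longleftrightarrow> {t. \<phi> t \<noteq> 0} \<subseteq> {- r..r}"
    by (meson closed_atLeastAtMost closure_minimal closure_subset subset_trans)
  also have "\<dots> \<longleftrightarrow> (\<forall>t. t \<notin> {- r..r} \<longrightarrow> \<phi> t = 0)" by blast
  also have "\<dots> \<longleftrightarrow> (\<forall>t. r < \<bar>t\<bar> \<longrightarrow> \<phi> t = 0)"
  proof -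
    have "t \<notin> {- r..r} \<longleftrightarrow> r < \<bar>t\<bar>" for t by auto
    then show ?thesis by (simp only:)
  qed
  finally have "closure {t. \<phi> t \<noteq> 0} \<subseteq> {- r..r} \<longleftrightarrow> (\<forall>t. r < \<bar>t\<bar> \<longrightarrow> \<phi> t = 0)" .
  moreover have "compact (closure {t. \<phi> t \<noteq> 0})" if "closure {t. \<phi> t \<noteq> 0} \<subseteq> {- r..r}"
    using compact_Int_closed[OF compact_Icc closed_closure, of "- r" r "{t. \<phi> t \<noteq> 0}"] that
    by (simp add: Int_absorb1)
  ultimately show ?thesis
    unfolding test_functions_in_def test_functions_def by blast
qed

lemma test_functions_obtain:
  assumes "\<phi> \<in> test_functions"
  obtains r where "r > 0" "\<phi> \<in> test_functions_in {- r..r}"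
proof -
  have "bounded (closure {t. \<phi> t \<noteq> 0})"
    using assms by (simp add: test_functions_def compact_imp_bounded)
  then obtain r where r: "r > 0" "\<And>t. t \<in> closure {t. \<phi> t \<noteq> 0} \<Longrightarrow> \<bar>t\<bar> \<le> r"
    unfolding bounded_pos by auto
  have "closure {t. \<phi> t \<noteq> 0} \<subseteq> {- r..r}" using r(2) by (auto simp: abs_le_iff) (metis minus_le_iff)
  then have "\<phi> \<in> test_functions_in {- r..r}"
    using assms by (simp add: test_functions_in_def)
  then show thesis using that r(1) by blast
qed

lemma test_functions_inD: "\<phi> \<in> test_functions_in K \<Longrightarrow> \<phi> \<in> test_functions"
  by (simp add: test_functions_in_def)

lemma test_functions_smooth: "\<phi> \<in> test_functions \<Longrightarrow> smooth \<phi>"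
  by (simp add: test_functions_def)

lemma test_functions_in_mono: "K \<subseteq> L \<Longrightarrow> \<phi> \<in> test_functions_in K \<Longrightarrow> \<phi> \<in> test_functions_in L"
  by (auto simp: test_functions_in_def)

lemma test_functions_in_add:
  assumes "\<phi> \<in> test_functions_in {- r..r}" "\<psi> \<in> test_functions_in {- r..r}"
  shows "(\<lambda>t. \<phi> t + \<psi> t) \<in> test_functions_in {- r..r}"
    and "(vderiv ^^ k) (\<lambda>t. \<phi> t + \<psi> t) = (\<lambda>t. (vderiv ^^ k) \<phi> t + (vderiv ^^ k) \<psi> t)"
proof -
  have "smooth \<phi>" "smooth \<psi>" using assms by (auto simp: test_functions_in_iff)
  note s = smoothI[of "\<lambda>k t. (vderiv ^^ k) \<phi> t + (vderiv ^^ k) \<psi> t" "\<lambda>t. \<phi> t + \<psi> t",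
      OF _ has_vector_derivative_add[OF smoothD[OF this(1)] smoothD[OF this(2)]]]
  show "(\<lambda>t. \<phi> t + \<psi> t) \<in> test_functions_in {- r..r}"
    using assms s(1) by (simp add: test_functions_in_iff)
  show "(vderiv ^^ k) (\<lambda>t. \<phi> t + \<psi> t) = (\<lambda>t. (vderiv ^^ k) \<phi> t + (vderiv ^^ k) \<psi> t)"
    by (rule s(2)) simp
qed

lemma test_functions_in_cmult:
  assumes "\<phi> \<in> test_functions_in {- r..r}"
  shows "(\<lambda>t. c * \<phi> t) \<in> test_functions_in {- r..r}"
    and "(vderiv ^^ k) (\<lambda>t. c * \<phi> t) = (\<lambda>t. c * (vderiv ^^ k) \<phi> t)"
proof -
  have "smooth \<phi>" using assms by (auto simp: test_functions_in_iff)
  note s = smoothI[of "\<lambda>k t. c * (vderiv ^^ k) \<phi> t" "\<lambda>t. c * \<phi> t",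
      OF _ bounded_linear.has_vector_derivative[OF bounded_linear_mult_right smoothD[OF this]]]
  show "(\<lambda>t. c * \<phi> t) \<in> test_functions_in {- r..r}"
    using assms s(1) by (simp add: test_functions_in_iff)
  show "(vderiv ^^ k) (\<lambda>t. c * \<phi> t) = (\<lambda>t. c * (vderiv ^^ k) \<phi> t)"
    by (rule s(2)) simp
qed

lemma test_functions_add:
  assumes "\<phi> \<in> test_functions" "\<psi> \<in> test_functions"
  shows "(\<lambda>t. \<phi> t + \<psi> t) \<in> test_functions"
    and "(vderiv ^^ k) (\<lambda>t. \<phi> t + \<psi> t) = (\<lambda>t. (vderiv ^^ k) \<phi> t + (vderiv ^^ k) \<psi> t)"
proof -
  obtain r s where r: "\<phi> \<in> test_functions_in {- r..r}" and s: "\<psi> \<in> test_functions_in {- s..s}"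
    using assms test_functions_obtain by metis
  have "\<phi> \<in> test_functions_in {- max r s..max r s}" "\<psi> \<in> test_functions_in {- max r s..max r s}"
    by (rule test_functions_in_mono[OF _ r], simp) (rule test_functions_in_mono[OF _ s], simp)
  note a = test_functions_in_add[OF this]
  show "(\<lambda>t. \<phi> t + \<psi> t) \<in> test_functions" using a(1) by (rule test_functions_inD)
  show "(vderiv ^^ k) (\<lambda>t. \<phi> t + \<psi> t) = (\<lambda>t. (vderiv ^^ k) \<phi> t + (vderiv ^^ k) \<psi> t)" by (rule a(2))
qed

lemma test_functions_cmult:
  assumes "\<phi> \<in> test_functions"
  shows "(\<lambda>t. c * \<phi> t) \<in> test_functions"
    and "(vderiv ^^ k) (\<lambda>t. c * \<phi> t) = (\<lambda>t. c * (vderiv ^^ k) \<phi> t)"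
  using test_functions_obtain[OF assms] test_functions_in_cmult test_functions_inD by metis+

lemma test_functions_scaleR:
  fixes \<phi> :: "real \<Rightarrow> 'k::real_normed_field"
  assumes "\<phi> \<in> test_functions"
  shows "(\<lambda>t. c *\<^sub>R \<phi> t) \<in> test_functions"
  using test_functions_cmult(1)[OF assms, of "of_real c"] by (simp add: scaleR_conv_of_real)

lemma test_functions_diff:
  fixes \<phi> \<psi> :: "real \<Rightarrow> 'k::real_normed_field"
  assumes "\<phi> \<in> test_functions" "\<psi> \<in> test_functions"
  shows "(\<lambda>t. \<phi> t - \<psi> t) \<in> test_functions"
    and "(vderiv ^^ k) (\<lambda>t. \<phi> t - \<psi> t) = (\<lambda>t. (vderiv ^^ k) \<phi> t - (vderiv ^^ k) \<psi> t)"
  using test_functions_add[OF assms(1) test_functions_cmult(1)[OF assms(2), of "-1"]]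
    test_functions_cmult(2)[OF assms(2), of _ "-1"] by simp_all

lemma test_functions_in_vderiv:
  assumes "\<phi> \<in> test_functions_in {- r..r}"
  shows "vderiv \<phi> \<in> test_functions_in {- r..r}"
  unfolding test_functions_in_iff
proof (intro conjI allI impI)
  have sm: "smooth \<phi>" using assms by (auto simp: test_functions_in_iff)
  then show "smooth (vderiv \<phi>)" by (rule smooth_vderiv)
  fix t assume t: "r < \<bar>t\<bar>"
  have "open {t. r < \<bar>t\<bar>}" by (intro open_Collect_less continuous_intros)
  then have "(\<phi> has_vector_derivative 0) (at t)"
    by (rule has_vector_derivative_transform_within_open[OF has_vector_derivative_const])
       (use assms t in \<open>auto simp: test_functions_in_iff\<close>)
  then show "vderiv \<phi> t = 0"
    unfolding vderiv_def by (rule vector_derivative_at)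
qed

lemma test_functions_in_vderiv_pow:
  "\<phi> \<in> test_functions_in {- r..r} \<Longrightarrow> (vderiv ^^ k) \<phi> \<in> test_functions_in {- r..r}"
  by (induction k) (auto intro: test_functions_in_vderiv)

lemma test_functions_vderiv: "\<phi> \<in> test_functions \<Longrightarrow> vderiv \<phi> \<in> test_functions"
  using test_functions_obtain test_functions_in_vderiv test_functions_inD by metis

lemma test_functions_vderiv_pow: "\<phi> \<in> test_functions \<Longrightarrow> (vderiv ^^ k) \<phi> \<in> test_functions"
  by (induction k) (auto intro: test_functions_vderiv)

lemma test_functions_in_shift:
  assumes "\<phi> \<in> test_functions_in {- r..r}"
  shows "shift a \<phi> \<in> test_functions_in {- (r + \<bar>a\<bar>)..r + \<bar>a\<bar>}"
    and "(vderiv ^^ k) (shift a \<phi>) = shift a ((vderiv ^^ k) \<phi>)"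
proof -
  have sm: "smooth \<phi>" using assms by (auto simp: test_functions_in_iff)
  have d: "(shift a ((vderiv ^^ k) \<phi>) has_vector_derivative shift a ((vderiv ^^ Suc k) \<phi>) t) (at t)" for k t
  proof -
    have "((\<lambda>t. t + a) has_vector_derivative 1) (at t)"
      by (auto intro!: derivative_eq_intros)
    from vector_diff_chain_at[OF this smoothD[OF sm, of k "t + a"]]
    show ?thesis by (simp add: shift_def o_def)
  qed
  note s = smoothI[of "\<lambda>k. shift a ((vderiv ^^ k) \<phi>)" "shift a \<phi>", OF _ d]
  show "shift a \<phi> \<in> test_functions_in {- (r + \<bar>a\<bar>)..r + \<bar>a\<bar>}"
    unfolding test_functions_in_iff
  proof (intro conjI allI impI)
    fix t assume "r + \<bar>a\<bar> < \<bar>t\<bar>"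
    then have "r < \<bar>t + a\<bar>" by linarith
    then show "shift a \<phi> t = 0" using assms by (simp add: test_functions_in_iff shift_def)
  qed (simp add: s(1))
  show "(vderiv ^^ k) (shift a \<phi>) = shift a ((vderiv ^^ k) \<phi>)" by (rule s(2)) simp
qed

lemma test_functions_shift_iff: "shift a \<phi> \<in> test_functions \<longleftrightarrow> \<phi> \<in> test_functions"
proof -
  have *: "shift a \<phi> \<in> test_functions" if "\<phi> \<in> test_functions" for a and \<phi> :: "real \<Rightarrow> 'a"
    using that test_functions_obtain test_functions_in_shift(1) test_functions_inD by metis
  have "shift (- a) (shift a \<phi>) = \<phi>" by (simp add: shift_def)
  then show ?thesis using *[of \<phi> a] *[of "shift a \<phi>" "- a"] by metis
qed

text \<open>
  The formula holds for both signs of \<open>h\<close>; the mean over \<open>- h\<close> acts on test functions when the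
  mean over \<open>h\<close> acts on distributions.
\<close>

lemma mean_eq_primitive:
  fixes f :: "real \<Rightarrow> 'b::banach"
  assumes f: "f \<in> L1loc" and "h \<noteq> 0"
  shows "mean h f t = (1 / h) *\<^sub>R (primitive f (t + h) - primitive f t)"
proof -
  have *: "bochner_integral lebesgue (\<lambda>s. indicator {a..b} s *\<^sub>R f (t + s)) = primitive f (t + b) - primitive f (t + a)"
    if "a \<le> b" for a b
  proof -
    have "bochner_integral lebesgue (\<lambda>s. indicator {a..b} s *\<^sub>R f (t + s)) = integral {a..b} (\<lambda>s. f (s + t))"
      using L1loc_bochner_integral[OF L1loc_shift[OF f], of a b t] by (simp add: add.commute)
    also have "\<dots> = integral {a + t..b + t} f"
      by (rule integral_shift_interval[OF L1loc_integrable[OF f]])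
    finally show ?thesis
      using primitive_diff[OF L1loc_integrable[OF f], of "a + t" "b + t"] that by (simp add: add.commute)
  qed
  show ?thesis
  proof (cases "h > 0")
    case True
    then show ?thesis using *[of 0 h] by (simp add: mean_def oriented_integral_def)
  next
    case False
    then show ?thesis using *[of h 0] \<open>h \<noteq> 0\<close>
      by (simp add: mean_def oriented_integral_def scaleR_diff_right)
  qed
qed

lemma mean_derivative:
  fixes f f' :: "real \<Rightarrow> 'b::banach"
  assumes f: "\<And>t. (f has_vector_derivative f' t) (at t)" and f': "continuous_on UNIV f'" and "h \<noteq> 0"
  shows "mean h f' t = (1 / h) *\<^sub>R (f (t + h) - f t)"
    and "(mean h f has_vector_derivative mean h f' t) (at t)"
proof -
  have fc: "continuous_on UNIV f"
    using f by (meson continuous_at_imp_continuous_on has_vector_derivative_continuous)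
  show *: "mean h f' t = (1 / h) *\<^sub>R (f (t + h) - f t)"
    unfolding mean_eq_primitive[OF continuous_imp_L1loc[OF f'] \<open>h \<noteq> 0\<close>]
    using eq_primitive[OF f f', of "t + h"] eq_primitive[OF f f', of t] by simp
  have "((\<lambda>t. t + h) has_vector_derivative 1) (at t)"
    by (auto intro!: derivative_eq_intros)
  from vector_diff_chain_at[OF this primitive_derivative[OF fc, of "t + h"]]
  have "((\<lambda>t. primitive f (t + h)) has_vector_derivative f (t + h)) (at t)" by (simp add: o_def)
  then have "((\<lambda>t. (1 / h) *\<^sub>R (primitive f (t + h) - primitive f t)) has_vector_derivative
      (1 / h) *\<^sub>R (f (t + h) - f t)) (at t)"
    by (intro bounded_linear.has_vector_derivative[OF bounded_linear_scaleR_right]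
        has_vector_derivative_diff primitive_derivative[OF fc])
  then show "(mean h f has_vector_derivative mean h f' t) (at t)"
    unfolding * using mean_eq_primitive[OF continuous_imp_L1loc[OF fc] \<open>h \<noteq> 0\<close>] by presburger
qed

lemma norm_mean_le:
  fixes f :: "real \<Rightarrow> 'b::banach"
  assumes f: "continuous_on UNIV f" and "h \<noteq> 0" and B: "\<And>s. \<bar>s - t\<bar> \<le> \<bar>h\<bar> \<Longrightarrow> norm (f s) \<le> B"
  shows "norm (mean h f t) \<le> B"
proof -
  have int: "f integrable_on {a..b}" for a b
    by (intro integrable_continuous_interval continuous_on_subset[OF f]) simp
  define u v where "u = min t (t + h)" and "v = max t (t + h)"
  have uv: "u \<le> v" "v - u = \<bar>h\<bar>" by (auto simp: u_def v_def)
  have "norm (primitive f (t + h) - primitive f t) = norm (primitive f v - primitive f u)"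
    by (auto simp: u_def v_def min_def max_def norm_minus_commute)
  also have "\<dots> = norm (integral {u..v} f)" using primitive_diff[OF int uv(1)] by simp
  also have "\<dots> \<le> integral {u..v} (\<lambda>_. B)"
    by (rule Henstock_Kurzweil_Integration.integral_norm_bound_integral[OF int])
       (use B in \<open>auto simp: u_def v_def\<close>)
  also have "\<dots> = \<bar>h\<bar> * B" using uv by simp
  finally have "norm (primitive f (t + h) - primitive f t) \<le> \<bar>h\<bar> * B" .
  then show ?thesis
    using \<open>h \<noteq> 0\<close> unfolding mean_eq_primitive[OF continuous_imp_L1loc[OF f] \<open>h \<noteq> 0\<close>] norm_scaleR
    by (simp add: divide_le_eq mult.commute)
qed

lemma test_functions_in_mean:
  fixes \<phi> :: "real \<Rightarrow> 'k::{real_normed_field, banach}"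
  assumes "\<phi> \<in> test_functions_in {- r..r}" "h \<noteq> 0"
  shows "mean h \<phi> \<in> test_functions_in {- (r + \<bar>h\<bar>)..r + \<bar>h\<bar>}"
    and "(vderiv ^^ k) (mean h \<phi>) = mean h ((vderiv ^^ k) \<phi>)"
proof -
  have sm: "smooth \<phi>" using assms by (auto simp: test_functions_in_iff)
  note s = smoothI[of "\<lambda>k. mean h ((vderiv ^^ k) \<phi>)" "mean h \<phi>", OF _
      mean_derivative(2)[OF smoothD[OF sm] smooth_continuous[OF sm] \<open>h \<noteq> 0\<close>]]
  show "mean h \<phi> \<in> test_functions_in {- (r + \<bar>h\<bar>)..r + \<bar>h\<bar>}"
    unfolding test_functions_in_iff
  proof (intro conjI allI impI)
    fix t assume t: "r + \<bar>h\<bar> < \<bar>t\<bar>"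
    have "norm (mean h \<phi> t) \<le> 0"
    proof (rule norm_mean_le[OF _ \<open>h \<noteq> 0\<close>])
      show "continuous_on UNIV \<phi>" using smooth_continuous[OF sm, of 0] by simp
      fix s assume "\<bar>s - t\<bar> \<le> \<bar>h\<bar>"
      then have "r < \<bar>s\<bar>" using t by linarith
      then show "norm (\<phi> s) \<le> 0" using assms(1) by (simp add: test_functions_in_iff)
    qed
    then show "mean h \<phi> t = 0" by simp
  qed (simp add: s(1))
  show "(vderiv ^^ k) (mean h \<phi>) = mean h ((vderiv ^^ k) \<phi>)" by (rule s(2)) simp
qed

lemma test_functions_mean:
  fixes \<phi> :: "real \<Rightarrow> 'k::{real_normed_field, banach}"
  assumes "\<phi> \<in> test_functions" "h \<noteq> 0"
  shows "mean h \<phi> \<in> test_functions"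
    and "(vderiv ^^ k) (mean h \<phi>) = mean h ((vderiv ^^ k) \<phi>)"
  using test_functions_obtain[OF assms(1)] test_functions_in_mean[OF _ assms(2)] test_functions_inD by metis+

text \<open>
  The difference is constant and vanishes outside a bounded set.
\<close>

lemma test_functions_eqI:
  fixes \<phi> \<psi> :: "real \<Rightarrow> 'k::{real_normed_field, banach}"
  assumes "\<phi> \<in> test_functions" "\<psi> \<in> test_functions" "vderiv \<phi> = vderiv \<psi>"
  shows "\<phi> = \<psi>"
proof -
  let ?d = "\<lambda>t. \<phi> t - \<psi> t"
  have d: "?d \<in> test_functions" using assms(1,2) by (rule test_functions_diff)
  have "vderiv ?d t = 0" for t
    using test_functions_diff(2)[OF assms(1,2), of 1] assms(3) by simp
  then have "(?d has_vector_derivative 0) (at t within UNIV)" for t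
    using smooth_has_derivative[OF test_functions_smooth[OF d], of t] by simp
  then obtain c where c: "\<And>t. ?d t = c"
    using has_vector_derivative_zero_constant[of UNIV ?d] by auto
  obtain r where "?d \<in> test_functions_in {- r..r}" using test_functions_obtain[OF d] by blast
  then have "?d (\<bar>r\<bar> + 1) = 0" by (simp add: test_functions_in_iff)
  then have "\<phi> t = \<psi> t" for t using c[of t] c[of "\<bar>r\<bar> + 1"] by simp
  then show ?thesis by blast
qed

lemma vderiv_mean:
  fixes \<phi> :: "real \<Rightarrow> 'k::{real_normed_field, banach}"
  assumes \<phi>: "\<phi> \<in> test_functions" and h: "h \<noteq> 0"
  shows "vderiv (mean h \<phi>) t = (1 / h) *\<^sub>R (\<phi> (t + h) - \<phi> t)"
proof -
  have sm: "smooth \<phi>" using \<phi> by (rule test_functions_smooth)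
  have c: "continuous_on UNIV (vderiv \<phi>)" using smooth_continuous[OF sm, of 1] by simp
  show ?thesis
    using mean_derivative[OF smooth_has_derivative[OF sm] c h, of t]
    by (simp add: vderiv_def vector_derivative_at)
qed

text \<open>
  Both sides have the second derivative \<open>\<Delta> h (\<Delta> k \<phi>)\<close> divided by \<open>h * k\<close>.
\<close>

lemma mean_mean_commute:
  fixes \<phi> :: "real \<Rightarrow> 'k::{real_normed_field, banach}"
  assumes \<phi>: "\<phi> \<in> test_functions" and h: "h \<noteq> 0" and k: "k \<noteq> 0"
  shows "mean h (mean k \<phi>) = mean k (mean h \<phi>)"
proof -
  have *: "vderiv (vderiv (mean h (mean k \<phi>))) t
      = (1 / h) *\<^sub>R (1 / k) *\<^sub>R (\<phi> (t + h + k) - \<phi> (t + h) - (\<phi> (t + k) - \<phi> t))"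
    if h: "h \<noteq> 0" and k: "k \<noteq> 0" for h k t
  proof -
    have mk: "mean k \<phi> \<in> test_functions" using \<phi> k by (rule test_functions_mean)
    have "vderiv (mean h (mean k \<phi>)) = mean h (vderiv (mean k \<phi>))"
      using test_functions_mean(2)[OF mk h, of 1] by simp
    then have "vderiv (vderiv (mean h (mean k \<phi>))) t
        = (1 / h) *\<^sub>R (vderiv (mean k \<phi>) (t + h) - vderiv (mean k \<phi>) t)"
      using vderiv_mean[OF test_functions_vderiv[OF mk] h] by simp
    then show ?thesis
      by (simp add: vderiv_mean[OF \<phi> k] scaleR_diff_right)
  qed
  have "vderiv (vderiv (mean h (mean k \<phi>))) t = vderiv (vderiv (mean k (mean h \<phi>))) t" for t
    unfolding *[OF h k] *[OF k h] by (simp add: algebra_simps)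
  then have 2: "vderiv (vderiv (mean h (mean k \<phi>))) = vderiv (vderiv (mean k (mean h \<phi>)))" by blast
  have t: "mean h (mean k \<phi>) \<in> test_functions" "mean k (mean h \<phi>) \<in> test_functions"
    using \<phi> h k by (simp_all add: test_functions_mean(1))
  show ?thesis
    by (rule test_functions_eqI[OF t test_functions_eqI[OF t[THEN test_functions_vderiv] 2]])
qed

section \<open>Distributions\<close>

lemma scl_bounded_bilinear:
  fixes scl :: "'k::real_normed_field \<Rightarrow> 'x::real_normed_vector \<Rightarrow> 'x"
  assumes "normed_space_over scl"
  shows "bounded_bilinear scl"
proof -
  interpret normed_space_over scl by (rule assms)
  show ?thesis
  proof
    fix r :: real and a :: 'k and b :: 'x
    show "scl (r *\<^sub>R a) b = r *\<^sub>R scl a b"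
      unfolding scaleR_conv_of_real by (simp flip: scale_of_real)
    show "scl a (r *\<^sub>R b) = r *\<^sub>R scl a b"
      by (simp add: mult.commute flip: scale_of_real)
    show "\<exists>K. \<forall>a b. norm (scl a b) \<le> norm a * norm b * K"
      by (intro exI[of _ 1]) (simp add: norm_scale)
  qed (simp_all add: scale_left_distrib scale_right_distrib)
qed

lemma scl_simps:
  assumes "normed_space_over scl"
  shows "scl 0 x = 0" "norm (scl c x) = norm c * norm x" "scl (of_real r) x = r *\<^sub>R x"
proof -
  interpret normed_space_over scl by (rule assms)
  show "scl 0 x = 0" "norm (scl c x) = norm c * norm x" "scl (of_real r) x = r *\<^sub>R x"
    by (simp_all add: norm_scale scale_of_real)
qed

text \<open>
  For linear maps this is continuity in the inductive limit topology, in the form in which all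
  later proofs use it. The order \<open>N\<close> of the bound may grow with \<open>r\<close>.
\<close>

definition seminorm_bounded :: "((real \<Rightarrow> 'k::real_normed_field) \<Rightarrow> 'x::real_normed_vector) \<Rightarrow> bool" where
  "seminorm_bounded T \<longleftrightarrow> (\<forall>r. \<exists>N C. \<forall>\<phi>\<in>test_functions_in {- r..r}. \<forall>B.
     (\<forall>k\<le>N. \<forall>t. norm ((vderiv ^^ k) \<phi> t) \<le> B) \<longrightarrow> norm (T \<phi>) \<le> C * B)"

lemma bounded_subset_symmetric_interval:
  fixes K :: "real set"
  assumes "bounded K"
  obtains r where "r \<ge> s" "K \<subseteq> {- r..r}"
proof -
  obtain b where b: "\<And>t. t \<in> K \<Longrightarrow> \<bar>t\<bar> \<le> b" using assms unfolding bounded_iff by auto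
  show thesis
  proof (rule that[of "max s b"])
    show "K \<subseteq> {- max s b..max s b}"
    proof
      fix t assume "t \<in> K"
      from b[OF this] show "t \<in> {- max s b..max s b}" by auto
    qed
  qed simp
qed

text \<open>
  The inductive limit topology induces on each \<open>\<D>_K\<close> a topology that is coarser than the one
  given by the seminorms. For a basic open set this is the openness of the traces of its
  generating neighbourhood, taken on an interval that also supports the translating test
  function.
\<close>

lemma openin_test_topology_trace:
  fixes \<phi> :: "real \<Rightarrow> 'k::real_normed_field"
  assumes "openin test_topology U" "\<phi> \<in> U" "\<phi> \<in> test_functions_in {- r..r}"
  shows "\<exists>N. \<exists>e>0. \<forall>\<psi>\<in>test_functions_in {- r..r}.
    (\<forall>k\<le>N. \<forall>t. norm ((vderiv ^^ k) \<psi> t - (vderiv ^^ k) \<phi> t) < e) \<longrightarrow> \<psi> \<in> U"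
  using assms(1)[unfolded test_topology_def openin_topology_generated_by_iff] assms(2,3)
proof (induction arbitrary: \<phi> r)
  case (Int U V)
  obtain N1 e1 where 1: "e1 > 0" "\<And>\<psi>. \<psi> \<in> test_functions_in {- r..r} \<Longrightarrow>
      \<forall>k\<le>N1. \<forall>t. norm ((vderiv ^^ k) \<psi> t - (vderiv ^^ k) \<phi> t) < e1 \<Longrightarrow> \<psi> \<in> U"
    using Int.IH(1)[OF _ Int.prems(2)] Int.prems(1) by blast
  obtain N2 e2 where 2: "e2 > 0" "\<And>\<psi>. \<psi> \<in> test_functions_in {- r..r} \<Longrightarrow>
      \<forall>k\<le>N2. \<forall>t. norm ((vderiv ^^ k) \<psi> t - (vderiv ^^ k) \<phi> t) < e2 \<Longrightarrow> \<psi> \<in> V"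
    using Int.IH(2)[OF _ Int.prems(2)] Int.prems(1) by blast
  show ?case
  proof (intro exI[of _ "max N1 N2"] exI[of _ "min e1 e2"] conjI ballI impI)
    fix \<psi> :: "real \<Rightarrow> 'k" assume \<psi>: "\<psi> \<in> test_functions_in {- r..r}"
      "\<forall>k\<le>max N1 N2. \<forall>t. norm ((vderiv ^^ k) \<psi> t - (vderiv ^^ k) \<phi> t) < min e1 e2"
    show "\<psi> \<in> U \<inter> V" using 1(2)[OF \<psi>(1)] 2(2)[OF \<psi>(1)] \<psi>(2) by simp
  qed (use 1 2 in simp)
next
  case (UN K)
  then obtain V where V: "V \<in> K" "\<phi> \<in> V" by blast
  show ?case using UN.IH[OF V UN.prems(2)] V(1) by (meson UnionI)
next
  case (Basis U)
  then obtain \<theta> W where U: "U = (\<lambda>w t. \<theta> t + w t) ` W" and \<theta>: "\<theta> \<in> test_functions"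
    and W: "W \<in> test_neighbourhoods" by blast
  obtain w where w: "w \<in> W" and \<phi>: "\<phi> = (\<lambda>t. \<theta> t + w t)" using Basis.prems(1) U by blast
  obtain s where s: "\<theta> \<in> test_functions_in {- s..s}" using test_functions_obtain[OF \<theta>] by blast
  define R where "R = max r s"
  have R: "test_functions_in {- r..r} \<subseteq> test_functions_in {- R..R}" "\<theta> \<in> test_functions_in {- R..R}"
    using test_functions_in_mono[of "{- r..r}" "{- R..R}"] test_functions_in_mono[OF _ s, of "{- R..R}"]
    by (auto simp: R_def)
  have diff: "(\<lambda>t. \<psi> t - \<theta> t) \<in> test_functions_in {- R..R}" if "\<psi> \<in> test_functions_in {- r..r}" for \<psi>
    using test_functions_in_add(1)[OF _ test_functions_in_cmult(1)[OF R(2), of "-1"], of \<psi>] that R(1) by auto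
  have ws: "w = (\<lambda>t. \<phi> t - \<theta> t)" by (simp add: \<phi>)
  have "w \<in> W \<inter> test_functions_in {- R..R}" using diff[OF Basis.prems(2)] w ws by simp
  moreover have "open_in_test_functions_in {- R..R} (W \<inter> test_functions_in {- R..R})"
    using W by (simp add: test_neighbourhoods_def)
  ultimately obtain N e where e: "e > 0" "\<And>\<psi>. \<psi> \<in> test_functions_in {- R..R} \<Longrightarrow>
      \<forall>k\<le>N. \<forall>t. norm ((vderiv ^^ k) \<psi> t - (vderiv ^^ k) w t) < e \<Longrightarrow> \<psi> \<in> W"
    unfolding open_in_test_functions_in_def by (metis (no_types, lifting) IntD1)
  show ?case
  proof (intro exI[of _ N] exI[of _ e] conjI ballI impI e(1))
    fix \<psi> :: "real \<Rightarrow> 'k" assume \<psi>: "\<psi> \<in> test_functions_in {- r..r}"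
      "\<forall>k\<le>N. \<forall>t. norm ((vderiv ^^ k) \<psi> t - (vderiv ^^ k) \<phi> t) < e"
    have "(\<lambda>t. \<psi> t - \<theta> t) \<in> W"
    proof (rule e(2)[OF diff[OF \<psi>(1)]])
      note t = test_functions_inD[OF \<psi>(1)] test_functions_inD[OF Basis.prems(2)]
      show "\<forall>k\<le>N. \<forall>t. norm ((vderiv ^^ k) (\<lambda>t. \<psi> t - \<theta> t) t - (vderiv ^^ k) w t) < e"
        unfolding ws test_functions_diff(2)[OF t(1) \<theta>] test_functions_diff(2)[OF t(2) \<theta>]
        using \<psi>(2) by simp
    qed
    then show "\<psi> \<in> U" unfolding U by (intro image_eqI[where x="\<lambda>t. \<psi> t - \<theta> t"]) auto
  qed
qed simp

lemma zero_test_function: "(\<lambda>t. 0) \<in> test_functions_in {- r..r}"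
  unfolding test_functions_in_iff by (auto intro!: smoothI(1)[of "\<lambda>k t. 0"])

lemma vderiv_zero: "(vderiv ^^ k) (\<lambda>t. 0) = (\<lambda>t. 0)"
  by (rule smoothI(2)[of "\<lambda>k t. 0"]) auto

lemma topspace_test_topology: "topspace test_topology = (test_functions :: (real \<Rightarrow> 'k::real_normed_field) set)"
proof -
  have "(test_functions :: (real \<Rightarrow> 'k) set) \<in> test_neighbourhoods"
    unfolding test_neighbourhoods_def
  proof (intro CollectI conjI ballI allI impI subset_refl)
    fix \<phi> \<psi> :: "real \<Rightarrow> 'k" and u assume "\<phi> \<in> test_functions" "\<psi> \<in> test_functions"
    then show "(\<lambda>t. (1 - u) *\<^sub>R \<phi> t + u *\<^sub>R \<psi> t) \<in> test_functions"
      by (intro test_functions_add test_functions_scaleR)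
  next
    fix \<phi> :: "real \<Rightarrow> 'k" and c assume "\<phi> \<in> test_functions"
    then show "(\<lambda>t. c * \<phi> t) \<in> test_functions" by (rule test_functions_cmult)
  next
    fix K :: "real set"
    show "open_in_test_functions_in K (test_functions \<inter> (test_functions_in K :: (real \<Rightarrow> 'k) set))"
      unfolding open_in_test_functions_in_def by (auto simp: test_functions_in_def intro: exI[of _ 1])
  qed
  moreover have "\<phi> \<in> (\<lambda>w t. (\<lambda>t. 0) t + w t) ` test_functions" if "\<phi> \<in> test_functions" for \<phi> :: "real \<Rightarrow> 'k"
    using that by (intro image_eqI[where x=\<phi>]) auto
  ultimately have "(test_functions :: (real \<Rightarrow> 'k) set) \<subseteq> topspace test_topology"
    unfolding test_topology_def topology_generated_by_topspace
    using test_functions_inD[OF zero_test_function] by blast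
  moreover have "topspace test_topology \<subseteq> (test_functions :: (real \<Rightarrow> 'k) set)"
    unfolding test_topology_def topology_generated_by_topspace
    by (auto simp: test_neighbourhoods_def intro!: test_functions_add)
  ultimately show ?thesis by blast
qed

text \<open>
  If \<open>T\<close> is continuous, the preimage of the unit ball contains a seminorm ball of \<open>\<D>_K\<close>, and
  scaling turns this into a bound. Conversely, the bounds say that the convex balanced set where
  \<open>norm (T w) < e\<close> has open traces, so its translates are basic open sets; by linearity they fit
  into preimages of open sets.
\<close>

theorem continuous_map_test_topology_iff:
  fixes T :: "(real \<Rightarrow> 'k::real_normed_field) \<Rightarrow> 'x::real_normed_vector"
  assumes scl: "normed_space_over scl"
    and add: "\<And>\<phi> \<psi>. \<phi> \<in> test_functions \<Longrightarrow> \<psi> \<in> test_functions \<Longrightarrow> T (\<lambda>t. \<phi> t + \<psi> t) = T \<phi> + T \<psi>"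
    and mult: "\<And>\<phi> c. \<phi> \<in> test_functions \<Longrightarrow> T (\<lambda>t. c * \<phi> t) = scl c (T \<phi>)"
  shows "continuous_map test_topology euclidean T \<longleftrightarrow> seminorm_bounded T"
proof
  note s = scl_simps[OF scl]
  have z: "T (\<lambda>t. 0) = 0"
    using mult[OF test_functions_inD[OF zero_test_function], of 0] s(1) by simp
  assume cont: "continuous_map test_topology euclidean T"
  define U where "U = {\<phi> \<in> topspace test_topology. T \<phi> \<in> ball 0 1}"
  have U: "openin test_topology U"
    unfolding U_def using cont openin_continuous_map_preimage[OF cont, of "ball 0 1"] by simp
  have 0: "(\<lambda>t. 0) \<in> U"
    unfolding U_def topspace_test_topology using z test_functions_inD[OF zero_test_function] by auto
  show "seminorm_bounded T"
    unfolding seminorm_bounded_def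
  proof
    fix r
    obtain N e where e: "e > 0" "\<forall>\<psi>\<in>test_functions_in {- r..r}.
        (\<forall>k\<le>N. \<forall>t. norm ((vderiv ^^ k) \<psi> t) < e) \<longrightarrow> \<psi> \<in> U"
      using openin_test_topology_trace[OF U 0 zero_test_function[of r]] by (auto simp: vderiv_zero)
    show "\<exists>N C. \<forall>\<phi>\<in>test_functions_in {- r..r}. \<forall>B.
        (\<forall>k\<le>N. \<forall>t. norm ((vderiv ^^ k) \<phi> t) \<le> B) \<longrightarrow> norm (T \<phi>) \<le> C * B"
    proof (intro exI[of _ N] exI[of _ "1 / e"] ballI allI impI)
      fix \<phi> :: "real \<Rightarrow> 'k" and B
      assume \<phi>: "\<phi> \<in> test_functions_in {- r..r}" and B: "\<forall>k\<le>N. \<forall>t. norm ((vderiv ^^ k) \<phi> t) \<le> B"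
      have "B \<ge> 0" using B[rule_format, of 0 0] norm_ge_zero order_trans by blast
      have "norm (T \<phi>) * e \<le> B"
      proof (rule field_le_epsilon)
        fix d :: real assume d: "d > 0"
        \<comment> \<open>\<open>B\<close> may be 0, hence the summand \<open>d\<close>\<close>
        let ?c = "e / (B + d)"
        have c: "?c > 0" using e(1) d \<open>B \<ge> 0\<close> by simp
        have "(\<lambda>t. of_real ?c * \<phi> t) \<in> U"
        proof (rule e(2)[rule_format, OF test_functions_in_cmult(1)[OF \<phi>]])
          fix k t assume "k \<le> N"
          have "norm (of_real ?c * (vderiv ^^ k) \<phi> t) = ?c * norm ((vderiv ^^ k) \<phi> t)"
            using c by (simp only: norm_mult norm_of_real)
          also have "\<dots> \<le> ?c * B" using B \<open>k \<le> N\<close> c by (intro mult_left_mono) auto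
          also have "\<dots> < e" using e(1) d \<open>B \<ge> 0\<close> by (simp add: field_simps)
          finally show "norm ((vderiv ^^ k) (\<lambda>t. of_real ?c * \<phi> t) t) < e"
            unfolding test_functions_in_cmult(2)[OF \<phi>] .
        qed
        then have "norm (T (\<lambda>t. of_real ?c * \<phi> t)) < 1" by (simp add: U_def)
        then have "?c * norm (T \<phi>) < 1"
          unfolding mult[OF test_functions_inD[OF \<phi>]] s(3) norm_scaleR abs_of_pos[OF c] .
        then show "norm (T \<phi>) * e \<le> B + d" using d \<open>B \<ge> 0\<close> by (simp add: field_simps)
      qed
      then show "norm (T \<phi>) \<le> 1 / e * B" using e(1) by (simp add: field_simps)
    qed
  qed
next
  note s = scl_simps[OF scl]
  assume bound: "seminorm_bounded T"
  have scale: "T (\<lambda>t. c *\<^sub>R \<phi> t) = c *\<^sub>R T \<phi>" if "\<phi> \<in> test_functions" for \<phi> c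
    using mult[OF that, of "of_real c"] s(3) by (simp add: scaleR_conv_of_real)
  have diff: "T (\<lambda>t. \<phi> t - \<psi> t) = T \<phi> - T \<psi>" if "\<phi> \<in> test_functions" "\<psi> \<in> test_functions" for \<phi> \<psi>
    using add[OF that(1) test_functions_scaleR[OF that(2), of "-1"]] scale[OF that(2), of "-1"] by simp
  show "continuous_map test_topology euclidean T"
    unfolding continuous_map_def
  proof (intro conjI allI impI)
    fix V :: "'x set" assume "openin euclidean V"
    then have V: "open V" by simp
    show "openin test_topology {\<phi> \<in> topspace test_topology. T \<phi> \<in> V}"
    proof (subst openin_subopen, intro ballI)
      fix \<phi> assume "\<phi> \<in> {\<phi> \<in> topspace test_topology. T \<phi> \<in> V}"
      then have \<phi>: "\<phi> \<in> test_functions" "T \<phi> \<in> V" by (auto simp: topspace_test_topology)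
      obtain e where e: "e > 0" "ball (T \<phi>) e \<subseteq> V" using V \<phi>(2) by (meson open_contains_ball)
      define W where "W = {w \<in> test_functions. norm (T w) < e}"
      have "W \<in> test_neighbourhoods"
        unfolding test_neighbourhoods_def
      proof (intro CollectI conjI ballI allI impI)
        fix \<psi> \<theta> :: "real \<Rightarrow> 'k" and u :: real assume a: "\<psi> \<in> W" "\<theta> \<in> W" "u \<in> {0..1}"
        then have t: "\<psi> \<in> test_functions" "\<theta> \<in> test_functions" by (auto simp: W_def)
        have "T (\<lambda>t. (1 - u) *\<^sub>R \<psi> t + u *\<^sub>R \<theta> t) = (1 - u) *\<^sub>R T \<psi> + u *\<^sub>R T \<theta>"
          using add[OF test_functions_scaleR[OF t(1)] test_functions_scaleR[OF t(2)]] scale t by simp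
        moreover have "(1 - u) *\<^sub>R T \<psi> + u *\<^sub>R T \<theta> \<in> ball 0 e"
          by (rule convexD[OF convex_ball]) (use a in \<open>auto simp: W_def\<close>)
        ultimately show "(\<lambda>t. (1 - u) *\<^sub>R \<psi> t + u *\<^sub>R \<theta> t) \<in> W"
          using test_functions_add(1)[OF test_functions_scaleR[OF t(1)] test_functions_scaleR[OF t(2)]]
          by (simp add: W_def)
      next
        fix \<psi> :: "real \<Rightarrow> 'k" and c :: 'k assume a: "\<psi> \<in> W" "norm c \<le> 1"
        have "norm c * norm (T \<psi>) \<le> 1 * norm (T \<psi>)" using a(2) by (rule mult_right_mono) simp
        then show "(\<lambda>t. c * \<psi> t) \<in> W"
          using a mult s(2) test_functions_cmult(1) by (auto simp: W_def)
      next
        fix K :: "real set" assume "compact K"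
        then obtain r where r: "K \<subseteq> {- r..r}"
          using bounded_subset_symmetric_interval[OF compact_imp_bounded] by metis
        obtain N C where C: "\<And>\<phi> B. \<phi> \<in> test_functions_in {- r..r} \<Longrightarrow>
            \<forall>k\<le>N. \<forall>t. norm ((vderiv ^^ k) \<phi> t) \<le> B \<Longrightarrow> norm (T \<phi>) \<le> C * B"
          using bound unfolding seminorm_bounded_def by meson
        show "open_in_test_functions_in K (W \<inter> test_functions_in K)"
          unfolding open_in_test_functions_in_def
        proof (intro conjI ballI)
          fix \<psi> assume \<psi>: "\<psi> \<in> W \<inter> test_functions_in K"
          define d where "d = (e - norm (T \<psi>)) / (\<bar>C\<bar> + 1)"
          have d: "d > 0" using \<psi> by (simp add: d_def W_def)
          show "\<exists>N. \<exists>e>0. \<forall>\<theta>\<in>test_functions_in K.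
              (\<forall>k\<le>N. \<forall>t. norm ((vderiv ^^ k) \<theta> t - (vderiv ^^ k) \<psi> t) < e) \<longrightarrow> \<theta> \<in> W \<inter> test_functions_in K"
          proof (intro exI[of _ N] exI[of _ d] conjI ballI impI d)
            fix \<theta> :: "real \<Rightarrow> 'k" assume \<theta>: "\<theta> \<in> test_functions_in K"
              "\<forall>k\<le>N. \<forall>t. norm ((vderiv ^^ k) \<theta> t - (vderiv ^^ k) \<psi> t) < d"
            have t: "\<theta> \<in> test_functions" "\<psi> \<in> test_functions"
              using \<theta>(1) \<psi> by (auto dest: test_functions_inD)
            have tr: "\<theta> \<in> test_functions_in {- r..r}" "\<psi> \<in> test_functions_in {- r..r}"
              using \<theta>(1) \<psi> r test_functions_in_mono by blast+
            have "norm (T (\<lambda>t. \<theta> t - \<psi> t)) \<le> C * d"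
            proof (rule C)
              show "(\<lambda>t. \<theta> t - \<psi> t) \<in> test_functions_in {- r..r}"
                using test_functions_in_add(1)[OF tr(1) test_functions_in_cmult(1)[OF tr(2), of "-1"]] by simp
              show "\<forall>k\<le>N. \<forall>t. norm ((vderiv ^^ k) (\<lambda>t. \<theta> t - \<psi> t) t) \<le> d"
                unfolding test_functions_diff(2)[OF t] using \<theta>(2) by (simp add: less_imp_le)
            qed
            also have "C * d < (\<bar>C\<bar> + 1) * d" using d by (intro mult_strict_right_mono) auto
            also have "\<dots> = e - norm (T \<psi>)" by (simp add: d_def)
            finally have "norm (T \<theta>) < e"
              using norm_triangle_ineq2[of "T \<theta>" "T \<psi>"] unfolding diff[OF t] by linarith
            then show "\<theta> \<in> W \<inter> test_functions_in K" using \<theta>(1) t by (simp add: W_def)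
          qed
        qed simp
      qed (simp add: W_def)
      then have "openin test_topology ((\<lambda>w t. \<phi> t + w t) ` W)"
        unfolding test_topology_def using \<phi>(1) by (intro topology_generated_by_Basis) blast
      moreover have "\<phi> \<in> (\<lambda>w t. \<phi> t + w t) ` W"
        by (rule image_eqI[where x="\<lambda>t. 0"])
           (use e(1) scale[OF \<phi>(1), of 0] test_functions_inD[OF zero_test_function] in \<open>auto simp: W_def\<close>)
      moreover have "(\<lambda>w t. \<phi> t + w t) ` W \<subseteq> {\<phi> \<in> topspace test_topology. T \<phi> \<in> V}"
        unfolding topspace_test_topology
      proof safe
        fix w assume w: "w \<in> W"
        then have wt: "w \<in> test_functions" by (simp add: W_def)
        show "(\<lambda>t. \<phi> t + w t) \<in> test_functions" by (rule test_functions_add[OF \<phi>(1) wt])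
        have "T \<phi> + T w \<in> ball (T \<phi>) e" using w by (simp add: W_def dist_norm)
        then show "T (\<lambda>t. \<phi> t + w t) \<in> V" using add[OF \<phi>(1) wt] e(2) by auto
      qed
      ultimately show "\<exists>S. openin test_topology S \<and> \<phi> \<in> S \<and> S \<subseteq> {\<phi> \<in> topspace test_topology. T \<phi> \<in> V}"
        by blast
    qed
  qed simp
qed

lemma distributions_iff:
  fixes T :: "(real \<Rightarrow> 'k::real_normed_field) \<Rightarrow> 'x::real_normed_vector"
  assumes scl: "normed_space_over scl"
  shows "T \<in> distributions scl \<longleftrightarrow> (\<forall>\<phi>. \<phi> \<notin> test_functions \<longrightarrow> T \<phi> = 0) \<and>
     (\<forall>\<phi>\<in>test_functions. \<forall>\<psi>\<in>test_functions. T (\<lambda>t. \<phi> t + \<psi> t) = T \<phi> + T \<psi>) \<and>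
     (\<forall>\<phi>\<in>test_functions. \<forall>c. T (\<lambda>t. c * \<phi> t) = scl c (T \<phi>)) \<and> seminorm_bounded T"
  unfolding distributions_def mem_Collect_eq
  using continuous_map_test_topology_iff[OF scl, of T] by blast

lemma distributionsD:
  assumes "T \<in> distributions scl"
  shows "\<phi> \<notin> test_functions \<Longrightarrow> T \<phi> = 0"
    and "\<phi> \<in> test_functions \<Longrightarrow> \<psi> \<in> test_functions \<Longrightarrow> T (\<lambda>t. \<phi> t + \<psi> t) = T \<phi> + T \<psi>"
    and "\<phi> \<in> test_functions \<Longrightarrow> T (\<lambda>t. c * \<phi> t) = scl c (T \<phi>)"
  using assms unfolding distributions_def by blast+

lemma distribution_scaleR:
  assumes "normed_space_over scl" "T \<in> distributions scl" "\<phi> \<in> test_functions"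
  shows "T (\<lambda>t. c *\<^sub>R \<phi> t) = c *\<^sub>R T \<phi>"
  using distributionsD(3)[OF assms(2,3), of "of_real c"] scl_simps(3)[OF assms(1)]
  by (simp add: scaleR_conv_of_real)

lemma distribution_diff:
  assumes "normed_space_over scl" "T \<in> distributions scl" "\<phi> \<in> test_functions" "\<psi> \<in> test_functions"
  shows "T (\<lambda>t. \<phi> t - \<psi> t) = T \<phi> - T \<psi>"
  using distributionsD(2)[OF assms(2,3) test_functions_scaleR[OF assms(4), of "-1"]]
    distribution_scaleR[OF assms(1,2,4), of "-1"] by simp

lemma distributions_lincomb:
  assumes scl: "normed_space_over scl" and F: "F \<in> distributions scl" and G: "G \<in> distributions scl"
  shows "(\<lambda>\<phi>. s *\<^sub>R F \<phi> + t *\<^sub>R G \<phi>) \<in> distributions scl"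
proof -
  interpret bounded_bilinear scl by (rule scl_bounded_bilinear[OF scl])
  have "seminorm_bounded (\<lambda>\<phi>. s *\<^sub>R F \<phi> + t *\<^sub>R G \<phi>)"
    unfolding seminorm_bounded_def
  proof
    fix r
    obtain N1 C1 where 1: "\<And>\<phi> B. \<phi> \<in> test_functions_in {- r..r} \<Longrightarrow>
        \<forall>k\<le>N1. \<forall>t. norm ((vderiv ^^ k) \<phi> t) \<le> B \<Longrightarrow> norm (F \<phi>) \<le> C1 * B"
      using F unfolding distributions_iff[OF scl] seminorm_bounded_def by meson
    obtain N2 C2 where 2: "\<And>\<phi> B. \<phi> \<in> test_functions_in {- r..r} \<Longrightarrow>
        \<forall>k\<le>N2. \<forall>t. norm ((vderiv ^^ k) \<phi> t) \<le> B \<Longrightarrow> norm (G \<phi>) \<le> C2 * B"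
      using G unfolding distributions_iff[OF scl] seminorm_bounded_def by meson
    show "\<exists>N C. \<forall>\<phi>\<in>test_functions_in {- r..r}. \<forall>B. (\<forall>k\<le>N. \<forall>t. norm ((vderiv ^^ k) \<phi> t) \<le> B) \<longrightarrow>
        norm (s *\<^sub>R F \<phi> + t *\<^sub>R G \<phi>) \<le> C * B"
    proof (intro exI[of _ "max N1 N2"] exI[of _ "\<bar>s\<bar> * C1 + \<bar>t\<bar> * C2"] ballI allI impI)
      fix \<phi> :: "real \<Rightarrow> 'a" and B
      assume \<phi>: "\<phi> \<in> test_functions_in {- r..r}" "\<forall>k\<le>max N1 N2. \<forall>t. norm ((vderiv ^^ k) \<phi> t) \<le> B"
      have "norm (s *\<^sub>R F \<phi> + t *\<^sub>R G \<phi>) \<le> \<bar>s\<bar> * norm (F \<phi>) + \<bar>t\<bar> * norm (G \<phi>)"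
        using norm_triangle_ineq[of "s *\<^sub>R F \<phi>" "t *\<^sub>R G \<phi>"] by simp
      also have "\<dots> \<le> \<bar>s\<bar> * (C1 * B) + \<bar>t\<bar> * (C2 * B)"
        using 1[OF \<phi>(1), of B] 2[OF \<phi>(1), of B] \<phi>(2) by (intro add_mono mult_left_mono) auto
      finally show "norm (s *\<^sub>R F \<phi> + t *\<^sub>R G \<phi>) \<le> (\<bar>s\<bar> * C1 + \<bar>t\<bar> * C2) * B"
        by (simp add: algebra_simps)
    qed
  qed
  then show ?thesis
    unfolding distributions_iff[OF scl]
    using distributionsD[OF F] distributionsD[OF G] 
    by (auto simp: scaleR_add_right add_right scaleR_right)
qed

text \<open>
  The transpose of a linear operator that maps each \<open>\<D>_K\<close> continuously into some \<open>\<D>_L\<close>.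
\<close>

lemma distributions_compose:
  fixes T :: "(real \<Rightarrow> 'k::real_normed_field) \<Rightarrow> 'x::real_normed_vector"
    and L :: "(real \<Rightarrow> 'k) \<Rightarrow> real \<Rightarrow> 'k"
  assumes scl: "normed_space_over scl" and T: "T \<in> distributions scl"
    and test: "\<And>r. \<exists>r'. \<forall>\<phi>\<in>test_functions_in {- r..r}. L \<phi> \<in> test_functions_in {- r'..r'}"
    and add: "\<And>\<phi> \<psi>. \<phi> \<in> test_functions \<Longrightarrow> \<psi> \<in> test_functions \<Longrightarrow>
                L (\<lambda>t. \<phi> t + \<psi> t) = (\<lambda>t. L \<phi> t + L \<psi> t)"
    and mult: "\<And>\<phi> c. \<phi> \<in> test_functions \<Longrightarrow> L (\<lambda>t. c * \<phi> t) = (\<lambda>t. c * L \<phi> t)"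
    and bound: "\<And>r N. \<exists>M D. \<forall>\<phi>\<in>test_functions_in {- r..r}. \<forall>B.
                (\<forall>k\<le>M. \<forall>t. norm ((vderiv ^^ k) \<phi> t) \<le> B) \<longrightarrow> (\<forall>k\<le>N. \<forall>t. norm ((vderiv ^^ k) (L \<phi>) t) \<le> D * B)"
  shows "(\<lambda>\<phi>. if \<phi> \<in> test_functions then T (L \<phi>) else 0) \<in> distributions scl"
proof -
  have L: "L \<phi> \<in> test_functions" if "\<phi> \<in> test_functions" for \<phi>
    using test_functions_obtain[OF that] test test_functions_inD by metis
  have "seminorm_bounded (\<lambda>\<phi>. if \<phi> \<in> test_functions then T (L \<phi>) else 0)"
    unfolding seminorm_bounded_def
  proof
    fix r
    obtain r' where r': "\<And>\<phi>. \<phi> \<in> test_functions_in {- r..r} \<Longrightarrow> L \<phi> \<in> test_functions_in {- r'..r'}"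
      using test by blast
    obtain N C where C: "\<And>\<phi> B. \<phi> \<in> test_functions_in {- r'..r'} \<Longrightarrow>
        \<forall>k\<le>N. \<forall>t. norm ((vderiv ^^ k) \<phi> t) \<le> B \<Longrightarrow> norm (T \<phi>) \<le> C * B"
      using T unfolding distributions_iff[OF scl] seminorm_bounded_def by meson
    obtain M D where D: "\<And>\<phi> B. \<phi> \<in> test_functions_in {- r..r} \<Longrightarrow>
        \<forall>k\<le>M. \<forall>t. norm ((vderiv ^^ k) \<phi> t) \<le> B \<Longrightarrow> \<forall>k\<le>N. \<forall>t. norm ((vderiv ^^ k) (L \<phi>) t) \<le> D * B"
      using bound[of r N] by meson
    show "\<exists>N C. \<forall>\<phi>\<in>test_functions_in {- r..r}. \<forall>B. (\<forall>k\<le>N. \<forall>t. norm ((vderiv ^^ k) \<phi> t) \<le> B) \<longrightarrow>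
        norm (if \<phi> \<in> test_functions then T (L \<phi>) else 0) \<le> C * B"
    proof (intro exI[of _ M] exI[of _ "C * D"] ballI allI impI)
      fix \<phi> :: "real \<Rightarrow> 'k" and B
      assume \<phi>: "\<phi> \<in> test_functions_in {- r..r}" "\<forall>k\<le>M. \<forall>t. norm ((vderiv ^^ k) \<phi> t) \<le> B"
      show "norm (if \<phi> \<in> test_functions then T (L \<phi>) else 0) \<le> C * D * B"
        using C[OF r'[OF \<phi>(1)] D[OF \<phi>]] test_functions_inD[OF \<phi>(1)] by (simp add: mult.assoc)
    qed
  qed
  moreover have "T (L (\<lambda>t. \<phi> t + \<psi> t)) = T (L \<phi>) + T (L \<psi>)"
    if "\<phi> \<in> test_functions" "\<psi> \<in> test_functions" for \<phi> \<psi>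
    unfolding add[OF that] by (rule distributionsD(2)[OF T L[OF that(1)] L[OF that(2)]])
  moreover have "T (L (\<lambda>t. c * \<phi> t)) = scl c (T (L \<phi>))" if "\<phi> \<in> test_functions" for \<phi> c
    unfolding mult[OF that] by (rule distributionsD(3)[OF T L[OF that]])
  ultimately show ?thesis
    unfolding distributions_iff[OF scl]
    by (simp add: test_functions_add(1) test_functions_cmult(1))
qed

lemma dist_deriv_distribution_1:
  assumes scl: "normed_space_over scl" and T: "T \<in> distributions scl"
  shows "dist_deriv 1 T \<in> distributions scl"
proof -
  have "(\<lambda>\<phi>. if \<phi> \<in> test_functions then T (vderiv \<phi>) else 0) \<in> distributions scl"
  proof (rule distributions_compose[OF scl T])
    show "\<exists>r'. \<forall>\<phi>\<in>test_functions_in {- r..r}. vderiv \<phi> \<in> test_functions_in {- r'..r'}" for r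
      using test_functions_in_vderiv by blast
    show "\<exists>M D. \<forall>\<phi>\<in>test_functions_in {- r..r}. \<forall>B. (\<forall>k\<le>M. \<forall>t. norm ((vderiv ^^ k) \<phi> t) \<le> B) \<longrightarrow>
        (\<forall>k\<le>N. \<forall>t. norm ((vderiv ^^ k) (vderiv \<phi>) t) \<le> D * B)" for r N
    proof (intro exI[of _ "Suc N"] exI[of _ 1] ballI allI impI)
      fix \<phi> B k t assume "\<forall>k\<le>Suc N. \<forall>t. norm ((vderiv ^^ k) \<phi> t) \<le> B" "k \<le> N"
      then have "norm ((vderiv ^^ Suc k) \<phi> t) \<le> B" by blast
      then show "norm ((vderiv ^^ k) (vderiv \<phi>) t) \<le> 1 * B" by (simp add: funpow_swap1)
    qed
  qed (use test_functions_add(2)[of _ _ 1] test_functions_cmult(2)[of _ 1] in auto)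
  from distributions_lincomb[OF scl this this, of "-1" 0]
  moreover have "dist_deriv 1 T = (\<lambda>\<phi>. - 1 *\<^sub>R (if \<phi> \<in> test_functions then T (vderiv \<phi>) else 0)
      + 0 *\<^sub>R (if \<phi> \<in> test_functions then T (vderiv \<phi>) else 0))"
    by (simp add: dist_deriv_def fun_eq_iff)
  ultimately show ?thesis by simp
qed

lemma dist_deriv_0: "(\<And>\<phi>. \<phi> \<notin> test_functions \<Longrightarrow> T \<phi> = 0) \<Longrightarrow> dist_deriv 0 T = T"
  by (auto simp: dist_deriv_def fun_eq_iff)

lemma dist_deriv_Suc: "dist_deriv (Suc n) T = dist_deriv 1 (dist_deriv n T)"
  by (auto simp: dist_deriv_def fun_eq_iff test_functions_vderiv funpow_swap1)

lemma dist_deriv_Suc': "dist_deriv (Suc n) T = dist_deriv n (dist_deriv 1 T)"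
  by (auto simp: dist_deriv_def fun_eq_iff test_functions_vderiv_pow)

lemma dist_deriv_add_index: "dist_deriv (n + m) T = dist_deriv m (dist_deriv n T)"
  by (auto simp: dist_deriv_def fun_eq_iff test_functions_vderiv_pow funpow_add power_add mult.commute)

lemma dist_deriv_distribution:
  assumes scl: "normed_space_over scl" and T: "T \<in> distributions scl"
  shows "dist_deriv n T \<in> distributions scl"
proof (induction n)
  case 0
  show ?case using T dist_deriv_0[of T] distributionsD(1)[OF T] by simp
next
  case (Suc n)
  show ?case unfolding dist_deriv_Suc by (rule dist_deriv_distribution_1[OF scl Suc])
qed

lemma dist_deriv_lincomb:
  "dist_deriv n (\<lambda>\<phi>. s *\<^sub>R F \<phi> + t *\<^sub>R G \<phi>) = (\<lambda>\<phi>. s *\<^sub>R dist_deriv n F \<phi> + t *\<^sub>R dist_deriv n G \<phi>)"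
  by (auto simp: dist_deriv_def fun_eq_iff scaleR_add_right mult.commute)

lemma dist_mean_lincomb:
  "dist_mean h (\<lambda>\<phi>. s *\<^sub>R F \<phi> + t *\<^sub>R G \<phi>) = (\<lambda>\<phi>. s *\<^sub>R dist_mean h F \<phi> + t *\<^sub>R dist_mean h G \<phi>)"
  by (auto simp: dist_mean_def fun_eq_iff)

lemma mean_linear:
  fixes \<phi> \<psi> :: "real \<Rightarrow> 'k::{real_normed_field, banach}"
  assumes h: "h \<noteq> 0" and \<phi>: "\<phi> \<in> test_functions" and \<psi>: "\<psi> \<in> test_functions"
  shows "mean h (\<lambda>t. \<phi> t + \<psi> t) = (\<lambda>t. mean h \<phi> t + mean h \<psi> t)"
    and "mean h (\<lambda>t. c * \<phi> t) = (\<lambda>t. c * mean h \<phi> t)"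
proof -
  note m = test_functions_mean(1)[OF _ h]
  show "mean h (\<lambda>t. \<phi> t + \<psi> t) = (\<lambda>t. mean h \<phi> t + mean h \<psi> t)"
  proof (rule test_functions_eqI[OF m[OF test_functions_add(1)[OF \<phi> \<psi>]] test_functions_add(1)[OF m[OF \<phi>] m[OF \<psi>]]])
    show "vderiv (mean h (\<lambda>t. \<phi> t + \<psi> t)) = vderiv (\<lambda>t. mean h \<phi> t + mean h \<psi> t)"
      using test_functions_add(2)[OF m[OF \<phi>] m[OF \<psi>], of 1]
      by (simp add: fun_eq_iff vderiv_mean[OF _ h] test_functions_add(1) \<phi> \<psi> algebra_simps)
  qed
  show "mean h (\<lambda>t. c * \<phi> t) = (\<lambda>t. c * mean h \<phi> t)"
  proof (rule test_functions_eqI[OF m[OF test_functions_cmult(1)[OF \<phi>]] test_functions_cmult(1)[OF m[OF \<phi>]]])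
    show "vderiv (mean h (\<lambda>t. c * \<phi> t)) = vderiv (\<lambda>t. c * mean h \<phi> t)"
      using test_functions_cmult(2)[OF m[OF \<phi>], of 1 c]
      by (simp add: fun_eq_iff vderiv_mean[OF _ h] test_functions_cmult(1) \<phi> algebra_simps)
  qed
qed

lemma dist_mean_distribution:
  fixes T :: "(real \<Rightarrow> 'k::{real_normed_field, banach}) \<Rightarrow> 'x::real_normed_vector"
  assumes scl: "normed_space_over scl" and T: "T \<in> distributions scl" and h: "h \<noteq> 0"
  shows "dist_mean h T \<in> distributions scl"
  unfolding dist_mean_def[abs_def]
proof (rule distributions_compose[OF scl T])
  have h': "- h \<noteq> 0" using h by simp
  show "\<exists>r'. \<forall>\<phi>\<in>test_functions_in {- r..r}. mean (- h) (\<phi> :: real \<Rightarrow> 'k) \<in> test_functions_in {- r'..r'}" for r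
    by (intro exI[of _ "r + \<bar>- h\<bar>"] ballI test_functions_in_mean(1)[OF _ h'])
  show "\<exists>M D. \<forall>\<phi>\<in>test_functions_in {- r..r}. \<forall>B. (\<forall>k\<le>M. \<forall>t. norm ((vderiv ^^ k) \<phi> t) \<le> B) \<longrightarrow>
      (\<forall>k\<le>N. \<forall>t. norm ((vderiv ^^ k) (mean (- h) (\<phi> :: real \<Rightarrow> 'k)) t) \<le> D * B)" for r N
  proof (intro exI[of _ N] exI[of _ 1] ballI allI impI)
    fix \<phi> :: "real \<Rightarrow> 'k" and B k t
    assume \<phi>: "\<phi> \<in> test_functions_in {- r..r}" "\<forall>k\<le>N. \<forall>t. norm ((vderiv ^^ k) \<phi> t) \<le> B" "k \<le> N"
    have "smooth \<phi>" using \<phi>(1) by (simp add: test_functions_in_iff)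
    then show "norm ((vderiv ^^ k) (mean (- h) \<phi>) t) \<le> 1 * B"
      unfolding test_functions_in_mean(2)[OF \<phi>(1) h'] mult_1
      by (intro norm_mean_le[OF smooth_continuous h']) (use \<phi>(2,3) in blast)+
  qed
  show "mean (- h) (\<lambda>t. \<phi> t + \<psi> t) = (\<lambda>t. mean (- h) \<phi> t + mean (- h) \<psi> t)"
    if "\<phi> \<in> test_functions" "\<psi> \<in> test_functions" for \<phi> \<psi> :: "real \<Rightarrow> 'k"
    using h' that by (rule mean_linear(1))
  show "mean (- h) (\<lambda>t. c * \<phi> t) = (\<lambda>t. c * mean (- h) \<phi> t)"
    if "\<phi> \<in> test_functions" for \<phi> :: "real \<Rightarrow> 'k" and c
    using h' that that by (rule mean_linear(2))
qed

lemma dist_mean_deriv: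
  fixes T :: "(real \<Rightarrow> 'k::{real_normed_field, banach}) \<Rightarrow> 'x::real_normed_vector"
  assumes "h \<noteq> 0"
  shows "dist_mean h (dist_deriv n T) = dist_deriv n (dist_mean h T)"
proof
  fix \<phi> :: "real \<Rightarrow> 'k"
  have "- h \<noteq> 0" using assms by simp
  from test_functions_mean[OF _ this, of \<phi>]
  show "dist_mean h (dist_deriv n T) \<phi> = dist_deriv n (dist_mean h T) \<phi>"
    by (simp add: dist_mean_def dist_deriv_def test_functions_vderiv_pow)
qed

text \<open>
  The mean is the convolution with \<open>1 / h\<close> times the indicator of \<open>{- h..0}\<close>, whose derivative
  is the difference of the point masses at \<open>- h\<close> and 0.
\<close>

lemma dist_mean_deriv_1:
  fixes T :: "(real \<Rightarrow> 'k::{real_normed_field, banach}) \<Rightarrow> 'x::real_normed_vector"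
  assumes scl: "normed_space_over scl" and T: "T \<in> distributions scl" and h: "h \<noteq> 0"
  shows "dist_mean h (dist_deriv 1 T) = (\<lambda>\<phi>. (1 / h) *\<^sub>R dist_diff h T \<phi>)"
proof
  fix \<phi> :: "real \<Rightarrow> 'k"
  show "dist_mean h (dist_deriv 1 T) \<phi> = (1 / h) *\<^sub>R dist_diff h T \<phi>"
  proof (cases "\<phi> \<in> test_functions")
    case True
    have h': "- h \<noteq> 0" using h by simp
    have s: "shift (- h) \<phi> \<in> test_functions" using True by (simp add: test_functions_shift_iff)
    have d: "(\<lambda>t. shift (- h) \<phi> t - \<phi> t) \<in> test_functions" by (rule test_functions_diff[OF s True])
    have "vderiv (mean (- h) \<phi>) = (\<lambda>t. (1 / (- h)) *\<^sub>R (shift (- h) \<phi> t - \<phi> t))"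
      by (auto simp: fun_eq_iff vderiv_mean[OF True h'] shift_def)
    then have "T (vderiv (mean (- h) \<phi>)) = (1 / (- h)) *\<^sub>R (T (shift (- h) \<phi>) - T \<phi>)"
      using distribution_scaleR[OF scl T d, of "1 / (- h)"] distribution_diff[OF scl T s True] by metis
    then show ?thesis
      using True test_functions_mean(1)[OF True h']
      by (simp add: dist_mean_def dist_deriv_def dist_diff_def dist_shift_def)
  next
    case False
    then show ?thesis
      using distributionsD(1)[OF T False] distributionsD(1)[OF T, of "shift (- h) \<phi>"]
      by (simp add: dist_mean_def dist_diff_def dist_shift_def test_functions_shift_iff)
  qed
qed

lemma dist_mean_commute:
  fixes T :: "(real \<Rightarrow> 'k::{real_normed_field, banach}) \<Rightarrow> 'x::real_normed_vector"
  assumes "h \<noteq> 0" "k \<noteq> 0"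
  shows "dist_mean h (dist_mean k T) = dist_mean k (dist_mean h T)"
proof
  fix \<phi> :: "real \<Rightarrow> 'k"
  have n: "- h \<noteq> 0" "- k \<noteq> 0" using assms by simp_all
  show "dist_mean h (dist_mean k T) \<phi> = dist_mean k (dist_mean h T) \<phi>"
  proof (cases "\<phi> \<in> test_functions")
    case True
    then show ?thesis
      using test_functions_mean(1)[OF True n(1)] test_functions_mean(1)[OF True n(2)]
        mean_mean_commute[OF True n] by (simp add: dist_mean_def)
  qed (simp add: dist_mean_def)
qed

lemma mean_shift: "mean h (shift a f) = shift a (mean h f)"
  by (simp add: mean_def shift_def add.assoc add.commute[of _ a])

lemma dist_mean_diff:
  fixes T :: "(real \<Rightarrow> 'k::{real_normed_field, banach}) \<Rightarrow> 'x::real_normed_vector"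
  assumes "h \<noteq> 0"
  shows "dist_mean h (dist_diff s T) = dist_diff s (dist_mean h T)"
proof
  fix \<phi> :: "real \<Rightarrow> 'k"
  show "dist_mean h (dist_diff s T) \<phi> = dist_diff s (dist_mean h T) \<phi>"
    by (simp add: dist_mean_def dist_diff_def dist_shift_def test_functions_shift_iff mean_shift)
qed

section \<open>Primitives of distributions\<close>

lemma test_function_integral:
  fixes \<phi> :: "real \<Rightarrow> 'k::{real_normed_field, banach}"
  assumes \<phi>: "\<phi> \<in> test_functions_in {- r..r}"
  shows "(\<phi> has_integral integral {- r..r} \<phi>) UNIV" and "integral UNIV \<phi> = integral {- r..r} \<phi>"
proof -
  have c: "continuous_on UNIV \<phi>" using smooth_continuous[of \<phi> 0] \<phi> by (simp add: test_functions_in_iff)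
  have "\<phi> integrable_on {- r..r}"
    by (intro integrable_continuous_interval continuous_on_subset[OF c]) simp
  then show "(\<phi> has_integral integral {- r..r} \<phi>) UNIV"
  proof (intro has_integral_on_superset[OF integrable_integral])
    fix t assume "t \<notin> {- r..r}"
    then have "r < \<bar>t\<bar>" by auto
    then show "\<phi> t = 0" using \<phi> by (simp add: test_functions_in_iff)
  qed simp_all
  then show "integral UNIV \<phi> = integral {- r..r} \<phi>" by (rule integral_unique)
qed

lemma test_function_integrable:
  fixes \<phi> :: "real \<Rightarrow> 'k::{real_normed_field, banach}"
  assumes "\<phi> \<in> test_functions"
  shows "\<phi> integrable_on UNIV"
proof -
  obtain r where "\<phi> \<in> test_functions_in {- r..r}" by (rule test_functions_obtain[OF assms])
  from test_function_integral(1)[OF this] show ?thesis by (rule has_integral_integrable)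
qed

lemma integral_vderiv_test_function:
  fixes \<phi> :: "real \<Rightarrow> 'k::{real_normed_field, banach}"
  assumes "\<phi> \<in> test_functions"
  shows "integral UNIV (vderiv \<phi>) = 0"
proof -
  obtain r where r: "r > 0" "\<phi> \<in> test_functions_in {- r..r}" by (rule test_functions_obtain[OF assms])
  define R where "R = r + 1"
  have R: "\<phi> \<in> test_functions_in {- R..R}" by (rule test_functions_in_mono[OF _ r(2)]) (simp add: R_def)
  have "(vderiv \<phi> has_integral \<phi> R - \<phi> (- R)) {- R..R}"
    by (rule fundamental_theorem_of_calculus)
       (use r smooth_has_derivative[OF test_functions_smooth[OF assms]]
         in \<open>auto simp: R_def intro: has_vector_derivative_at_within\<close>)
  moreover have "\<phi> R = 0" "\<phi> (- R) = 0" using r by (auto simp: test_functions_in_iff R_def)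
  ultimately show ?thesis
    using test_function_integral(2)[OF test_functions_in_vderiv[OF R]] by (simp add: integral_unique)
qed

text \<open>
  The primitive that vanishes to the left of the support is constant to its right, and the
  constant is the integral of \<open>\<phi>\<close>.
\<close>

lemma antiderivative_test_function:
  fixes \<phi> :: "real \<Rightarrow> 'k::{real_normed_field, banach}"
  assumes \<phi>: "\<phi> \<in> test_functions_in {- r..r}" and 0: "integral UNIV \<phi> = 0" and "r \<ge> 0"
  obtains \<psi> where "\<psi> \<in> test_functions_in {- r..r}" "vderiv \<psi> = \<phi>"
    "\<forall>B. (\<forall>t. norm (\<phi> t) \<le> B) \<longrightarrow> (\<forall>t. norm (\<psi> t) \<le> 2 * r * B)"
proof -
  have sm: "smooth \<phi>" and supp: "\<And>t. r < \<bar>t\<bar> \<Longrightarrow> \<phi> t = 0" using \<phi> by (auto simp: test_functions_in_iff)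
  have c: "continuous_on UNIV \<phi>" using smooth_continuous[OF sm, of 0] by simp
  have int: "\<phi> integrable_on {a..b}" for a b
    by (intro integrable_continuous_interval continuous_on_subset[OF c]) simp
  define \<psi> where "\<psi> t = primitive \<phi> t - primitive \<phi> (- r)" for t
  have d: "(\<psi> has_vector_derivative \<phi> t) (at t)" for t
    unfolding \<psi>_def using has_vector_derivative_diff[OF primitive_derivative[OF c] has_vector_derivative_const]
    by simp
  define F where "F k = (case k of 0 \<Rightarrow> \<psi> | Suc k \<Rightarrow> (vderiv ^^ k) \<phi>)" for k
  have "(F k has_vector_derivative F (Suc k) t) (at t)" for k t
    using d smoothD[OF sm] by (cases k) (auto simp: F_def)
  from smoothI[of F \<psi>, OF _ this] have sm\<psi>: "smooth \<psi>" by (simp add: F_def)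
  have eq: "\<psi> t = integral {- r..t} \<phi>" if "- r \<le> t" for t
    using primitive_diff[OF int that] by (simp add: \<psi>_def)
  have left: "\<psi> t = 0" if "t < - r" for t
  proof -
    have "primitive \<phi> (- r) - primitive \<phi> t = integral {t..- r} \<phi>"
      using primitive_diff[OF int, of t "- r"] that by simp
    also have "\<dots> = integral {t..- r} (\<lambda>t. 0)"
      by (rule integral_spike[of "{- r}"]) (use supp \<open>r \<ge> 0\<close> in auto)
    finally show ?thesis by (simp add: \<psi>_def)
  qed
  have right: "\<psi> t = 0" if "r < t" for t
  proof -
    have "\<phi> \<in> test_functions_in {- t..t}"
      by (rule test_functions_in_mono[OF _ \<phi>]) (use that in auto)
    then have "integral {- t..t} \<phi> = 0" using test_function_integral(2) 0 by metis
    moreover have "primitive \<phi> t - primitive \<phi> (- t) = integral {- t..t} \<phi>"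
      using primitive_diff[OF int, of "- t" t] that \<open>r \<ge> 0\<close> by simp
    moreover have "\<psi> (- t) = 0" using left[of "- t"] that by simp
    ultimately show ?thesis by (simp add: \<psi>_def)
  qed
  show thesis
  proof (rule that)
    show "\<psi> \<in> test_functions_in {- r..r}"
      unfolding test_functions_in_iff
    proof (intro conjI allI impI sm\<psi>)
      fix t assume "r < \<bar>t\<bar>"
      then show "\<psi> t = 0" using left[of t] right[of t] by (cases "t < 0") auto
    qed
    show "vderiv \<psi> = \<phi>" using d by (auto simp: vderiv_def fun_eq_iff intro: vector_derivative_at)
    have "norm (\<psi> t) \<le> 2 * r * B" if B: "\<And>t. norm (\<phi> t) \<le> B" for B t
    proof -
      have "B \<ge> 0" using B[of 0] norm_ge_zero order_trans by blast
      show ?thesis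
      proof (cases "\<bar>t\<bar> \<le> r")
        case True
        then have "- r \<le> t" by auto
        have "norm (\<psi> t) \<le> integral {- r..t} (\<lambda>_. B)"
          unfolding eq[OF \<open>- r \<le> t\<close>]
          by (rule Henstock_Kurzweil_Integration.integral_norm_bound_integral[OF int]) (use B in auto)
        also have "\<dots> = (t + r) * B" using \<open>- r \<le> t\<close> by simp
        also have "\<dots> \<le> 2 * r * B" using True \<open>B \<ge> 0\<close> by (intro mult_right_mono) auto
        finally show ?thesis .
      next
        case False
        then have "\<psi> t = 0" using left[of t] right[of t] by (cases "t < 0") auto
        then show ?thesis using \<open>r \<ge> 0\<close> \<open>B \<ge> 0\<close> by simp
      qed
    qed
    then show "\<forall>B. (\<forall>t. norm (\<phi> t) \<le> B) \<longrightarrow> (\<forall>t. norm (\<psi> t) \<le> 2 * r * B)" by blast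
  qed
qed

lemma derivative_bound_test_function:
  fixes \<phi> :: "real \<Rightarrow> 'k::{real_normed_field, banach}"
  assumes "\<phi> \<in> test_functions"
  shows "\<exists>P. \<forall>k\<le>N. \<forall>t. norm ((vderiv ^^ k) \<phi> t) \<le> P"
proof -
  obtain r where r: "\<phi> \<in> test_functions_in {- r..r}" by (rule test_functions_obtain[OF assms])
  have "\<exists>P. \<forall>t. norm ((vderiv ^^ k) \<phi> t) \<le> P" for k
  proof -
    have "compact ((vderiv ^^ k) \<phi> ` {- r..r})"
      by (intro compact_continuous_image continuous_on_subset[OF smooth_continuous[OF test_functions_smooth[OF assms]]]) auto
    then have "bounded ((vderiv ^^ k) \<phi> ` {- r..r})" by (rule compact_imp_bounded)
    then obtain P where P: "\<forall>x\<in>(vderiv ^^ k) \<phi> ` {- r..r}. norm x \<le> P"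
      unfolding bounded_iff by (elim exE)
    have "norm ((vderiv ^^ k) \<phi> t) \<le> max 0 P" for t
    proof (cases "t \<in> {- r..r}")
      case True
      then have "norm ((vderiv ^^ k) \<phi> t) \<le> P" using P by blast
      then show ?thesis by simp
    next
      case False
      then have "r < \<bar>t\<bar>" by auto
      then show ?thesis using test_functions_in_vderiv_pow[OF r, of k] by (simp add: test_functions_in_iff)
    qed
    then show ?thesis by blast
  qed
  then obtain P where P: "\<And>k t. norm ((vderiv ^^ k) \<phi> t) \<le> P k" by metis
  have P0: "0 \<le> P k" for k using P[of k 0] norm_ge_zero order_trans by blast
  show ?thesis
  proof (intro exI[of _ "\<Sum>k\<le>N. P k"] allI impI)
    fix k t assume "k \<le> N"
    then have "P k \<le> (\<Sum>k\<le>N. P k)" by (intro member_le_sum) (use P0 in auto)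
    with P[of k t] show "norm ((vderiv ^^ k) \<phi> t) \<le> (\<Sum>k\<le>N. P k)" by linarith
  qed
qed

text \<open>
  A test function with integral 1, or an arbitrary one in case all test functions have integral
  0. Stated in this form, existence follows by distinguishing the two cases.
\<close>

definition normaliser :: "(real \<Rightarrow> 'k::{real_normed_field, banach}) \<Rightarrow> bool" where
  "normaliser \<rho> \<longleftrightarrow> \<rho> \<in> test_functions \<and>
     (\<forall>\<phi>\<in>test_functions. integral UNIV \<phi> * integral UNIV \<rho> = integral UNIV \<phi>)"

text \<open>
  The projection along \<open>\<rho>\<close> onto the test functions with integral 0.
\<close>

definition balanced :: "(real \<Rightarrow> 'k::{real_normed_field, banach}) \<Rightarrow> (real \<Rightarrow> 'k) \<Rightarrow> real \<Rightarrow> 'k" where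
  "balanced \<rho> \<phi> = (\<lambda>t. \<phi> t - integral UNIV \<phi> * \<rho> t)"

definition test_primitive :: "(real \<Rightarrow> 'k::{real_normed_field, banach}) \<Rightarrow> (real \<Rightarrow> 'k) \<Rightarrow> real \<Rightarrow> 'k" where
  "test_primitive \<rho> \<phi> = (THE \<psi>. \<psi> \<in> test_functions \<and> vderiv \<psi> = balanced \<rho> \<phi>)"

lemma ex_normaliser: "\<exists>\<rho> :: real \<Rightarrow> 'k::{real_normed_field, banach}. normaliser \<rho>"
proof (cases "\<exists>\<psi> \<in> test_functions. integral UNIV (\<psi> :: real \<Rightarrow> 'k) \<noteq> 0")
  case True
  then obtain \<psi> :: "real \<Rightarrow> 'k" where \<psi>: "\<psi> \<in> test_functions" "integral UNIV \<psi> \<noteq> 0" by blast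
  have "((\<lambda>t. inverse (integral UNIV \<psi>) * \<psi> t) has_integral inverse (integral UNIV \<psi>) * integral UNIV \<psi>) UNIV"
    by (intro has_integral_mult_right integrable_integral test_function_integrable \<psi>)
  then have "integral UNIV (\<lambda>t. inverse (integral UNIV \<psi>) * \<psi> t) = 1"
    using \<psi>(2) by (simp add: integral_unique)
  then have "normaliser (\<lambda>t. inverse (integral UNIV \<psi>) * \<psi> t)"
    unfolding normaliser_def using test_functions_cmult(1)[OF \<psi>(1)] by simp
  then show ?thesis by blast
next
  case False
  then have "normaliser (\<lambda>t. 0 :: 'k)"
    unfolding normaliser_def using test_functions_inD[OF zero_test_function] by auto
  then show ?thesis by blast
qed

lemma balanced_test_function:
  assumes "normaliser \<rho>" "\<phi> \<in> test_functions"
  shows "balanced \<rho> \<phi> \<in> test_functions"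
    and "(vderiv ^^ k) (balanced \<rho> \<phi>) = (\<lambda>t. (vderiv ^^ k) \<phi> t - integral UNIV \<phi> * (vderiv ^^ k) \<rho> t)"
    and "integral UNIV (balanced \<rho> \<phi>) = 0"
proof -
  have \<rho>: "\<rho> \<in> test_functions" "integral UNIV \<phi> * integral UNIV \<rho> = integral UNIV \<phi>"
    using assms unfolding normaliser_def by blast+
  note d = test_functions_diff[OF assms(2) test_functions_cmult(1)[OF \<rho>(1)]]
  show "balanced \<rho> \<phi> \<in> test_functions" unfolding balanced_def by (rule d(1))
  show "(vderiv ^^ k) (balanced \<rho> \<phi>) = (\<lambda>t. (vderiv ^^ k) \<phi> t - integral UNIV \<phi> * (vderiv ^^ k) \<rho> t)"
    unfolding balanced_def d(2) test_functions_cmult(2)[OF \<rho>(1)] ..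
  have "(balanced \<rho> \<phi> has_integral integral UNIV \<phi> - integral UNIV \<phi> * integral UNIV \<rho>) UNIV"
    unfolding balanced_def
    by (intro has_integral_diff has_integral_mult_right integrable_integral test_function_integrable assms(2) \<rho>(1))
  then show "integral UNIV (balanced \<rho> \<phi>) = 0" using \<rho>(2) by (simp add: integral_unique)
qed

lemma test_primitive_eqI:
  assumes "\<psi> \<in> test_functions" "vderiv \<psi> = balanced \<rho> \<phi>"
  shows "test_primitive \<rho> \<phi> = \<psi>"
  unfolding test_primitive_def
proof (rule the_equality)
  fix \<theta> assume "\<theta> \<in> test_functions \<and> vderiv \<theta> = balanced \<rho> \<phi>"
  then have "\<theta> \<in> test_functions" "vderiv \<theta> = vderiv \<psi>" using assms(2) by simp_all
  then show "\<theta> = \<psi>" by (rule test_functions_eqI[OF _ assms(1)])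
qed (use assms in blast)

lemma test_primitive_in:
  assumes \<rho>: "normaliser \<rho>" "\<rho> \<in> test_functions_in {- r..r}" and \<phi>: "\<phi> \<in> test_functions_in {- r..r}" and "r \<ge> 0"
  shows "test_primitive \<rho> \<phi> \<in> test_functions_in {- r..r}"
    and "vderiv (test_primitive \<rho> \<phi>) = balanced \<rho> \<phi>"
    and "(\<And>t. norm (balanced \<rho> \<phi> t) \<le> B) \<Longrightarrow> norm (test_primitive \<rho> \<phi> t) \<le> 2 * r * B"
proof -
  have "balanced \<rho> \<phi> \<in> test_functions_in {- r..r}"
    using balanced_test_function(1)[OF \<rho>(1) test_functions_inD[OF \<phi>]] \<rho>(2) \<phi>
    unfolding test_functions_in_iff by (simp add: balanced_def test_functions_smooth)
  from antiderivative_test_function[OF this balanced_test_function(3)[OF \<rho>(1) test_functions_inD[OF \<phi>]] \<open>r \<ge> 0\<close>]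
  obtain \<psi> where \<psi>: "\<psi> \<in> test_functions_in {- r..r}" "vderiv \<psi> = balanced \<rho> \<phi>"
     "\<forall>B. (\<forall>t. norm (balanced \<rho> \<phi> t) \<le> B) \<longrightarrow> (\<forall>t. norm (\<psi> t) \<le> 2 * r * B)" .
  have "test_primitive \<rho> \<phi> = \<psi>" by (rule test_primitive_eqI[OF test_functions_inD[OF \<psi>(1)] \<psi>(2)])
  then show "test_primitive \<rho> \<phi> \<in> test_functions_in {- r..r}" "vderiv (test_primitive \<rho> \<phi>) = balanced \<rho> \<phi>"
    "(\<And>t. norm (balanced \<rho> \<phi> t) \<le> B) \<Longrightarrow> norm (test_primitive \<rho> \<phi> t) \<le> 2 * r * B"
    using \<psi> by simp_all
qed

lemma test_functions_common_support:
  assumes "\<rho> \<in> test_functions"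
  obtains R where "R > 0" "\<rho> \<in> test_functions_in {- R..R}" "{- r..r} \<subseteq> {- R..R}"
proof -
  obtain s where s: "s > 0" "\<rho> \<in> test_functions_in {- s..s}" by (rule test_functions_obtain[OF assms])
  have sub: "{- r..r} \<subseteq> {- max r s..max r s}" "{- s..s} \<subseteq> {- max r s..max r s}" by auto
  show thesis
    using s(1) by (intro that[OF _ test_functions_in_mono[OF sub(2) s(2)] sub(1)]) simp
qed

lemma test_primitive_test_function:
  assumes \<rho>: "normaliser \<rho>" and \<phi>: "\<phi> \<in> test_functions"
  shows "test_primitive \<rho> \<phi> \<in> test_functions"
    and "vderiv (test_primitive \<rho> \<phi>) = balanced \<rho> \<phi>"
proof -
  have \<rho>t: "\<rho> \<in> test_functions" using \<rho> by (simp add: normaliser_def)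
  obtain r where r: "\<phi> \<in> test_functions_in {- r..r}" by (rule test_functions_obtain[OF \<phi>])
  obtain R where R0: "R > 0" "\<rho> \<in> test_functions_in {- R..R}" "{- r..r} \<subseteq> {- R..R}"
    by (rule test_functions_common_support[OF \<rho>t])
  note R = R0(1,2) test_functions_in_mono[OF R0(3) r]
  note t = test_primitive_in[OF \<rho> R(2,3) less_imp_le[OF R(1)]]
  show "test_primitive \<rho> \<phi> \<in> test_functions" by (rule test_functions_inD[OF t(1)])
  show "vderiv (test_primitive \<rho> \<phi>) = balanced \<rho> \<phi>" by (rule t(2))
qed

lemma test_primitive_vderiv:
  assumes "\<phi> \<in> test_functions"
  shows "test_primitive \<rho> (vderiv \<phi>) = \<phi>"
  by (rule test_primitive_eqI[OF assms]) (simp add: balanced_def integral_vderiv_test_function[OF assms])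

lemma test_primitive_linear:
  assumes \<rho>: "normaliser \<rho>" and \<phi>: "\<phi> \<in> test_functions" and \<psi>: "\<psi> \<in> test_functions"
  shows "test_primitive \<rho> (\<lambda>t. \<phi> t + \<psi> t) = (\<lambda>t. test_primitive \<rho> \<phi> t + test_primitive \<rho> \<psi> t)"
    and "test_primitive \<rho> (\<lambda>t. c * \<phi> t) = (\<lambda>t. c * test_primitive \<rho> \<phi> t)"
proof -
  note L = test_primitive_test_function[OF \<rho>]
  show "test_primitive \<rho> (\<lambda>t. \<phi> t + \<psi> t) = (\<lambda>t. test_primitive \<rho> \<phi> t + test_primitive \<rho> \<psi> t)"
  proof (rule test_primitive_eqI[OF test_functions_add(1)[OF L(1)[OF \<phi>] L(1)[OF \<psi>]]])
    have "integral UNIV (\<lambda>t. \<phi> t + \<psi> t) = integral UNIV \<phi> + integral UNIV \<psi>"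
      by (rule Henstock_Kurzweil_Integration.integral_add) (intro test_function_integrable \<phi> \<psi>)+
    then show "vderiv (\<lambda>t. test_primitive \<rho> \<phi> t + test_primitive \<rho> \<psi> t) = balanced \<rho> (\<lambda>t. \<phi> t + \<psi> t)"
      using test_functions_add(2)[OF L(1)[OF \<phi>] L(1)[OF \<psi>], of 1]
      by (simp add: L(2)[OF \<phi>] L(2)[OF \<psi>] balanced_def algebra_simps)
  qed
  show "test_primitive \<rho> (\<lambda>t. c * \<phi> t) = (\<lambda>t. c * test_primitive \<rho> \<phi> t)"
  proof (rule test_primitive_eqI[OF test_functions_cmult(1)[OF L(1)[OF \<phi>]]])
    have "integral UNIV (\<lambda>t. c * \<phi> t) = c * integral UNIV \<phi>"
      by (intro integral_unique has_integral_mult_right integrable_integral test_function_integrable \<phi>)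
    then show "vderiv (\<lambda>t. c * test_primitive \<rho> \<phi> t) = balanced \<rho> (\<lambda>t. c * \<phi> t)"
      using test_functions_cmult(2)[OF L(1)[OF \<phi>], of 1 c]
      by (simp add: L(2)[OF \<phi>] balanced_def algebra_simps)
  qed
qed

text \<open>
  The primitive itself is bounded by the length of the support times the supremum of the
  balanced function, and its derivatives are those of the balanced function.
\<close>

lemma test_primitive_bound:
  fixes \<rho> :: "real \<Rightarrow> 'k::{real_normed_field, banach}"
  assumes \<rho>: "normaliser \<rho>"
  shows "\<exists>M D. \<forall>\<phi>\<in>test_functions_in {- r..r}. \<forall>B. (\<forall>k\<le>M. \<forall>t. norm ((vderiv ^^ k) \<phi> t) \<le> B) \<longrightarrow>
      (\<forall>k\<le>N. \<forall>t. norm ((vderiv ^^ k) (test_primitive \<rho> \<phi>) t) \<le> D * B)"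
proof -
  have \<rho>t: "\<rho> \<in> test_functions" using \<rho> by (simp add: normaliser_def)
  obtain P where P: "\<And>k t. k \<le> N \<Longrightarrow> norm ((vderiv ^^ k) \<rho> t) \<le> P"
    using derivative_bound_test_function[OF \<rho>t, of N] by blast
  have "P \<ge> 0" using P[of 0 0] norm_ge_zero order_trans by blast
  obtain R where R: "R > 0" "\<rho> \<in> test_functions_in {- R..R}"
    "{- r..r} \<subseteq> {- R..R}"
    by (rule test_functions_common_support[OF \<rho>t])
  define E where "E = 1 + 2 * R * P"
  have "E \<ge> 0" using \<open>R > 0\<close> \<open>P \<ge> 0\<close> by (simp add: E_def)
  show ?thesis
  proof (intro exI[of _ N] exI[of _ "(1 + 2 * R) * E"] ballI allI impI)
    fix \<phi> :: "real \<Rightarrow> 'k" and B k t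
    assume "\<phi> \<in> test_functions_in {- r..r}" and B: "\<forall>k\<le>N. \<forall>t. norm ((vderiv ^^ k) \<phi> t) \<le> B" and k: "k \<le> N"
    then have \<phi>R: "\<phi> \<in> test_functions_in {- R..R}" using test_functions_in_mono[OF R(3)] by blast
    have "B \<ge> 0" using B[rule_format, of 0 0] norm_ge_zero order_trans by blast
    note \<phi>t = test_functions_inD[OF \<phi>R]
    note L = test_primitive_in[OF \<rho> R(2) \<phi>R less_imp_le[OF R(1)]]
    have c: "continuous_on UNIV \<phi>" using smooth_continuous[OF test_functions_smooth[OF \<phi>t], of 0] by simp
    have "\<phi> integrable_on {- R..R}"
      by (intro integrable_continuous_interval continuous_on_subset[OF c]) simp
    then have "norm (integral {- R..R} \<phi>) \<le> integral {- R..R} (\<lambda>_. B)"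
      by (rule Henstock_Kurzweil_Integration.integral_norm_bound_integral)
         (use B[rule_format, of 0] in auto)
    then have I: "norm (integral UNIV \<phi>) \<le> 2 * R * B"
      unfolding test_function_integral(2)[OF \<phi>R] using \<open>R > 0\<close> by simp
    have XB: "norm ((vderiv ^^ j) (balanced \<rho> \<phi>) t) \<le> E * B" if "j \<le> N" for j t
    proof -
      have "norm ((vderiv ^^ j) (balanced \<rho> \<phi>) t)
          \<le> norm ((vderiv ^^ j) \<phi> t) + norm (integral UNIV \<phi>) * norm ((vderiv ^^ j) \<rho> t)"
        unfolding balanced_test_function(2)[OF \<rho> \<phi>t] norm_mult[symmetric] by (rule norm_triangle_ineq4)
      also have "\<dots> \<le> B + (2 * R * B) * P"
        using B that I P[OF that] \<open>R > 0\<close> \<open>B \<ge> 0\<close> by (intro add_mono mult_mono) auto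
      also have "\<dots> = E * B" by (simp add: E_def algebra_simps)
      finally show ?thesis .
    qed
    have EB: "0 \<le> E * B" using \<open>E \<ge> 0\<close> \<open>B \<ge> 0\<close> by simp
    have "norm ((vderiv ^^ k) (test_primitive \<rho> \<phi>) t) \<le> max 1 (2 * R) * (E * B)"
    proof (cases k)
      case 0
      have "norm (test_primitive \<rho> \<phi> t) \<le> 2 * R * (E * B)"
        by (rule L(3)) (use XB[of 0] in simp)
      also have "\<dots> \<le> max 1 (2 * R) * (E * B)"
        using EB by (intro mult_right_mono) auto
      finally show ?thesis using 0 by simp
    next
      case (Suc j)
      have "(vderiv ^^ k) (test_primitive \<rho> \<phi>) = (vderiv ^^ j) (balanced \<rho> \<phi>)"
        unfolding Suc L(2)[symmetric] by (simp add: funpow_swap1)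
      then have "norm ((vderiv ^^ k) (test_primitive \<rho> \<phi>) t) \<le> 1 * (E * B)" using XB[of j] Suc k by simp
      also have "\<dots> \<le> max 1 (2 * R) * (E * B)" using EB by (intro mult_right_mono) auto
      finally show ?thesis .
    qed
    also have "\<dots> \<le> (1 + 2 * R) * (E * B)" using EB \<open>R > 0\<close> by (intro mult_right_mono) auto
    finally show "norm ((vderiv ^^ k) (test_primitive \<rho> \<phi>) t) \<le> (1 + 2 * R) * E * B" by (simp add: mult.assoc)
  qed
qed

text \<open>
  Up to sign, a primitive of \<open>T\<close> is \<open>T\<close> composed with the primitive operator on test functions,
  which maps \<open>vderiv \<phi>\<close> back to \<open>\<phi>\<close>.
\<close>

theorem distribution_primitive:
  fixes T :: "(real \<Rightarrow> 'k::{real_normed_field, banach}) \<Rightarrow> 'x::real_normed_vector"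
  assumes scl: "normed_space_over scl" and T: "T \<in> distributions scl"
  shows "\<exists>P\<in>distributions scl. dist_deriv 1 P = T"
proof -
  obtain \<rho> :: "real \<Rightarrow> 'k" where \<rho>: "normaliser \<rho>" using ex_normaliser by blast
  have \<rho>t: "\<rho> \<in> test_functions" using \<rho> by (simp add: normaliser_def)
  define Q where "Q \<phi> = (if \<phi> \<in> test_functions then T (test_primitive \<rho> \<phi>) else 0)" for \<phi>
  have Q: "Q \<in> distributions scl"
    unfolding Q_def[abs_def]
  proof (rule distributions_compose[OF scl T _ test_primitive_linear(1)[OF \<rho>] _ test_primitive_bound[OF \<rho>]])
    fix r
    obtain R where R: "R > 0" "\<rho> \<in> test_functions_in {- R..R}"
      "{- r..r} \<subseteq> {- R..R}"
      by (rule test_functions_common_support[OF \<rho>t])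
    show "\<exists>r'. \<forall>\<phi>\<in>test_functions_in {- r..r}. test_primitive \<rho> \<phi> \<in> test_functions_in {- r'..r'}"
      using test_primitive_in(1)[OF \<rho> R(2) test_functions_in_mono[OF R(3)] less_imp_le[OF R(1)]] by blast
  next
    fix \<phi> :: "real \<Rightarrow> 'k" and c assume "\<phi> \<in> test_functions"
    then show "test_primitive \<rho> (\<lambda>t. c * \<phi> t) = (\<lambda>t. c * test_primitive \<rho> \<phi> t)"
      using test_primitive_linear(2)[OF \<rho>] by blast
  qed
  have "(\<lambda>\<phi>. - 1 *\<^sub>R Q \<phi> + 0 *\<^sub>R Q \<phi>) \<in> distributions scl"
    by (rule distributions_lincomb[OF scl Q Q])
  moreover have "dist_deriv 1 (\<lambda>\<phi>. - 1 *\<^sub>R Q \<phi> + 0 *\<^sub>R Q \<phi>) = T"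
  proof
    fix \<phi> show "dist_deriv 1 (\<lambda>\<phi>. - 1 *\<^sub>R Q \<phi> + 0 *\<^sub>R Q \<phi>) \<phi> = T \<phi>"
      using distributionsD(1)[OF T, of \<phi>]
      by (cases "\<phi> \<in> test_functions")
         (simp_all add: dist_deriv_def Q_def test_functions_vderiv test_primitive_vderiv)
  qed
  ultimately show ?thesis by blast
qed

text \<open>
  Modulo derivatives of test functions, on which \<open>S\<close> vanishes, \<open>\<phi>\<close> equals \<open>integral UNIV \<phi>\<close>
  times a normaliser \<open>\<rho>\<close>, and the value sought is \<open>x = S \<rho>\<close>.
\<close>

theorem dist_deriv_eq_zero:
  fixes S :: "(real \<Rightarrow> 'k::{real_normed_field, banach}) \<Rightarrow> 'x::real_normed_vector"
  assumes scl: "normed_space_over scl" and S: "S \<in> distributions scl"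
    and 0: "\<And>\<phi>. dist_deriv 1 S \<phi> = 0"
  shows "\<exists>x. \<forall>\<phi>\<in>test_functions. S \<phi> = scl (integral UNIV \<phi>) x"
proof -
  obtain \<rho> :: "real \<Rightarrow> 'k" where \<rho>: "normaliser \<rho>" using ex_normaliser by blast
  have \<rho>t: "\<rho> \<in> test_functions" using \<rho> by (simp add: normaliser_def)
  have "S \<phi> = scl (integral UNIV \<phi>) (S \<rho>)" if "\<phi> \<in> test_functions" for \<phi>
  proof -
    have "S (balanced \<rho> \<phi>) = 0"
      using 0[of "test_primitive \<rho> \<phi>"] test_primitive_test_function[OF \<rho> that] by (simp add: dist_deriv_def)
    then show ?thesis
      using distribution_diff[OF scl S that test_functions_cmult(1)[OF \<rho>t]] distributionsD(3)[OF S \<rho>t]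
      by (simp add: balanced_def)
  qed
  then show ?thesis by blast
qed

section \<open>Regular distributions\<close>

lemma test_functions_continuous: "\<phi> \<in> test_functions \<Longrightarrow> continuous_on UNIV \<phi>"
  using smooth_continuous[of \<phi> 0] test_functions_smooth[of \<phi>] by simp

text \<open>
  The interval need not be symmetric, as the support of a translated test function is not.
\<close>

lemma regular_eq_integral:
  fixes scl :: "'k::{real_normed_field, banach} \<Rightarrow> 'x::banach \<Rightarrow> 'x"
  assumes scl: "normed_space_over scl" and f: "f \<in> L1loc" and \<phi>: "\<phi> \<in> test_functions"
    and supp: "\<And>t. t \<notin> {u..v} \<Longrightarrow> \<phi> t = 0"
  shows "regular scl f \<phi> = integral {u..v} (\<lambda>t. scl (\<phi> t) (f t))"
proof -
  have "(\<lambda>t. scl (\<phi> t) (f t)) = (\<lambda>t. indicator {u..v} t *\<^sub>R scl (\<phi> t) (f t))"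
    using supp by (auto simp: fun_eq_iff indicator_def scl_simps(1)[OF scl])
  moreover have "(\<lambda>t. scl (\<phi> t) (f t)) \<in> L1loc"
    by (rule L1loc_bilinear[OF scl_bounded_bilinear[OF scl] test_functions_continuous[OF \<phi>] f])
  ultimately show ?thesis
    unfolding regular_def using \<phi> L1loc_bochner_integral by metis
qed

lemma test_functions_in_supp:
  assumes "\<phi> \<in> test_functions_in {- r..r}" "t \<notin> {- r..r}"
  shows "\<phi> t = 0"
proof -
  have "r < \<bar>t\<bar>" using assms(2) by auto
  then show ?thesis using assms(1) by (simp add: test_functions_in_iff)
qed

lemma regular_eq_integral_in:
  fixes scl :: "'k::{real_normed_field, banach} \<Rightarrow> 'x::banach \<Rightarrow> 'x"
  assumes "normed_space_over scl" "f \<in> L1loc" "\<phi> \<in> test_functions_in {- r..r}"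
  shows "regular scl f \<phi> = integral {- r..r} (\<lambda>t. scl (\<phi> t) (f t))"
  by (rule regular_eq_integral[OF assms(1,2) test_functions_inD[OF assms(3)]])
     (rule test_functions_in_supp[OF assms(3)])

lemma scl_integrable:
  fixes scl :: "'k::{real_normed_field, banach} \<Rightarrow> 'x::banach \<Rightarrow> 'x"
  assumes "normed_space_over scl" "f \<in> L1loc" "\<phi> \<in> test_functions"
  shows "(\<lambda>t. scl (\<phi> t) (f t)) integrable_on {a..b}"
  by (rule L1loc_integrable[OF L1loc_bilinear[OF scl_bounded_bilinear[OF assms(1)]
        test_functions_continuous[OF assms(3)] assms(2)]])

lemma regular_add:
  fixes scl :: "'k::{real_normed_field, banach} \<Rightarrow> 'x::banach \<Rightarrow> 'x"
  assumes scl: "normed_space_over scl" and f: "f \<in> L1loc" and \<phi>: "\<phi> \<in> test_functions" and \<psi>: "\<psi> \<in> test_functions"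
  shows "regular scl f (\<lambda>t. \<phi> t + \<psi> t) = regular scl f \<phi> + regular scl f \<psi>"
proof -
  interpret bounded_bilinear scl by (rule scl_bounded_bilinear[OF scl])
  obtain r where r: "\<phi> \<in> test_functions_in {- r..r}" by (rule test_functions_obtain[OF \<phi>])
  obtain R where R: "R > 0" "\<psi> \<in> test_functions_in {- R..R}" "{- r..r} \<subseteq> {- R..R}"
    by (rule test_functions_common_support[OF \<psi>])
  note \<phi>R = test_functions_in_mono[OF R(3) r]
  show ?thesis
    unfolding regular_eq_integral_in[OF scl f \<phi>R] regular_eq_integral_in[OF scl f R(2)]
      regular_eq_integral_in[OF scl f test_functions_in_add(1)[OF \<phi>R R(2)]] add_left
    by (rule Henstock_Kurzweil_Integration.integral_add[OF scl_integrable[OF scl f \<phi>] scl_integrable[OF scl f \<psi>]])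
qed

lemma regular_mult:
  fixes scl :: "'k::{real_normed_field, banach} \<Rightarrow> 'x::banach \<Rightarrow> 'x"
  assumes scl: "normed_space_over scl" and f: "f \<in> L1loc" and \<phi>: "\<phi> \<in> test_functions"
  shows "regular scl f (\<lambda>t. c * \<phi> t) = scl c (regular scl f \<phi>)"
proof -
  interpret normed_space_over scl by (rule scl)
  obtain r where r: "\<phi> \<in> test_functions_in {- r..r}" by (rule test_functions_obtain[OF \<phi>])
  have "((\<lambda>t. scl c (scl (\<phi> t) (f t))) has_integral scl c (integral {- r..r} (\<lambda>t. scl (\<phi> t) (f t)))) {- r..r}"
    using has_integral_linear[OF integrable_integral[OF scl_integrable[OF scl f \<phi>]]
        bounded_bilinear.bounded_linear_right[OF scl_bounded_bilinear[OF scl], of c]]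
    by (simp add: o_def)
  then show ?thesis
    unfolding regular_eq_integral_in[OF scl f r] regular_eq_integral_in[OF scl f test_functions_in_cmult(1)[OF r]]
    by (simp add: integral_unique)
qed

theorem regular_distribution:
  fixes scl :: "'k::{real_normed_field, banach} \<Rightarrow> 'x::banach \<Rightarrow> 'x"
  assumes scl: "normed_space_over scl" and f: "f \<in> L1loc"
  shows "regular scl f \<in> distributions scl"
proof -
  have zero: "regular scl f \<phi> = 0" if "\<phi> \<notin> test_functions" for \<phi>
    using that by (simp add: regular_def)
  have "seminorm_bounded (regular scl f)"
    unfolding seminorm_bounded_def
  proof
    fix r
    show "\<exists>N C. \<forall>\<phi>\<in>test_functions_in {- r..r}. \<forall>B. (\<forall>k\<le>N. \<forall>t. norm ((vderiv ^^ k) \<phi> t) \<le> B) \<longrightarrow>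
        norm (regular scl f \<phi>) \<le> C * B"
    proof (intro exI[of _ "0 :: nat"] exI[of _ "integral {- r..r} (\<lambda>t. norm (f t))"] ballI allI impI)
      fix \<phi> :: "real \<Rightarrow> 'k" and B
      assume \<phi>: "\<phi> \<in> test_functions_in {- r..r}" and "\<forall>k\<le>0. \<forall>t. norm ((vderiv ^^ k) \<phi> t) \<le> B"
      then have B: "norm (\<phi> t) \<le> B" for t by simp
      have "norm (integral {- r..r} (\<lambda>t. scl (\<phi> t) (f t))) \<le> integral {- r..r} (\<lambda>t. B * norm (f t))"
      proof (rule Henstock_Kurzweil_Integration.integral_norm_bound_integral)
        show "(\<lambda>t. scl (\<phi> t) (f t)) integrable_on {- r..r}"
          by (rule scl_integrable[OF scl f test_functions_inD[OF \<phi>]])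
        show "(\<lambda>t. B * norm (f t)) integrable_on {- r..r}"
          by (intro integrable_on_mult_right L1loc_norm_integrable f)
        show "norm (scl (\<phi> t) (f t)) \<le> B * norm (f t)" for t
          unfolding scl_simps(2)[OF scl] using B by (rule mult_right_mono) simp
      qed
      then show "norm (regular scl f \<phi>) \<le> integral {- r..r} (\<lambda>t. norm (f t)) * B"
        unfolding regular_eq_integral_in[OF scl f \<phi>] by (simp add: mult.commute)
    qed
  qed
  then show ?thesis
    unfolding distributions_iff[OF scl]
    using regular_add[OF scl f] regular_mult[OF scl f] zero by blast
qed

lemma regular_lincomb:
  fixes scl :: "'k::{real_normed_field, banach} \<Rightarrow> 'x::banach \<Rightarrow> 'x"
  assumes scl: "normed_space_over scl" and f: "f \<in> L1loc" and g: "g \<in> L1loc"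
  shows "regular scl (\<lambda>t. a *\<^sub>R f t + b *\<^sub>R g t) = (\<lambda>\<phi>. a *\<^sub>R regular scl f \<phi> + b *\<^sub>R regular scl g \<phi>)"
proof
  fix \<phi> :: "real \<Rightarrow> 'k"
  interpret bounded_bilinear scl by (rule scl_bounded_bilinear[OF scl])
  have fg: "(\<lambda>t. a *\<^sub>R f t + b *\<^sub>R g t) \<in> L1loc" by (intro L1loc_add L1loc_scaleR f g)
  show "regular scl (\<lambda>t. a *\<^sub>R f t + b *\<^sub>R g t) \<phi> = a *\<^sub>R regular scl f \<phi> + b *\<^sub>R regular scl g \<phi>"
  proof (cases "\<phi> \<in> test_functions")
    case True
    obtain r where r: "\<phi> \<in> test_functions_in {- r..r}" by (rule test_functions_obtain[OF True])
    have "((\<lambda>t. a *\<^sub>R scl (\<phi> t) (f t) + b *\<^sub>R scl (\<phi> t) (g t)) has_integral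
        a *\<^sub>R regular scl f \<phi> + b *\<^sub>R regular scl g \<phi>) {- r..r}"
      unfolding regular_eq_integral_in[OF scl f r] regular_eq_integral_in[OF scl g r]
      by (intro has_integral_add has_integral_cmul integrable_integral scl_integrable[OF scl _ True] f g)
    then show ?thesis
      unfolding regular_eq_integral_in[OF scl fg r] by (simp add: add_right scaleR_right integral_unique)
  qed (simp add: regular_def)
qed

lemma regular_shift:
  fixes scl :: "'k::{real_normed_field, banach} \<Rightarrow> 'x::banach \<Rightarrow> 'x"
  assumes scl: "normed_space_over scl" and f: "f \<in> L1loc"
  shows "dist_shift a (regular scl f) = regular scl (shift a f)"
proof
  fix \<phi> :: "real \<Rightarrow> 'k"
  show "dist_shift a (regular scl f) \<phi> = regular scl (shift a f) \<phi>"
  proof (cases "\<phi> \<in> test_functions")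
    case True
    obtain r where r: "\<phi> \<in> test_functions_in {- r..r}" by (rule test_functions_obtain[OF True])
    have s: "shift (- a) \<phi> \<in> test_functions" using True by (simp add: test_functions_shift_iff)
    have sf: "shift a f \<in> L1loc" unfolding shift_def by (rule L1loc_shift[OF f])
    have "regular scl f (shift (- a) \<phi>) = integral {- r + a..r + a} (\<lambda>t. scl (shift (- a) \<phi> t) (f t))"
    proof (rule regular_eq_integral[OF scl f s])
      fix t assume "t \<notin> {- r + a..r + a}"
      then have "t - a \<notin> {- r..r}" by auto
      then show "shift (- a) \<phi> t = 0" using test_functions_in_supp[OF r] by (simp add: shift_def)
    qed
    also have "\<dots> = integral {- r..r} (\<lambda>t. scl (\<phi> t) (shift a f t))"
      using integral_shift_interval[OF scl_integrable[OF scl f s], of "- r" r a] by (simp add: shift_def)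
    finally show ?thesis
      unfolding regular_eq_integral_in[OF scl sf r] dist_shift_def .
  qed (simp add: regular_def dist_shift_def test_functions_shift_iff)
qed

lemma regular_diff_op:
  fixes scl :: "'k::{real_normed_field, banach} \<Rightarrow> 'x::banach \<Rightarrow> 'x"
  assumes scl: "normed_space_over scl" and f: "f \<in> L1loc"
  shows "diff_op s f \<in> L1loc" and "dist_diff s (regular scl f) = regular scl (diff_op s f)"
proof -
  have sf: "shift s f \<in> L1loc" unfolding shift_def by (rule L1loc_shift[OF f])
  then show "diff_op s f \<in> L1loc" unfolding diff_op_def using f by (rule L1loc_diff)
  show "dist_diff s (regular scl f) = regular scl (diff_op s f)"
    using regular_lincomb[OF scl sf f, of 1 "-1"]
    by (simp add: dist_diff_def diff_op_def[abs_def] regular_shift[OF scl f])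
qed

text \<open>
  This is integration by parts on an interval that contains the support of the test function in
  its interior.
\<close>

theorem dist_deriv_regular:
  fixes scl :: "'k::{real_normed_field, banach} \<Rightarrow> 'x::banach \<Rightarrow> 'x"
  assumes scl: "normed_space_over scl" and F: "locally_abs_continuous F"
    and deriv: "AE t in lebesgue. (F has_vector_derivative f t) (at t)" and f: "f \<in> L1loc"
  shows "dist_deriv 1 (regular scl F) = regular scl f"
proof
  fix \<phi> :: "real \<Rightarrow> 'k"
  have FL: "F \<in> L1loc" by (rule continuous_imp_L1loc[OF locally_abs_continuous_imp_continuous[OF F]])
  show "dist_deriv 1 (regular scl F) \<phi> = regular scl f \<phi>"
  proof (cases "\<phi> \<in> test_functions")
    case True
    obtain r where r: "r > 0" "\<phi> \<in> test_functions_in {- r..r}" by (rule test_functions_obtain[OF True])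
    \<comment> \<open>on the larger interval \<open>\<phi>\<close> vanishes at the end points\<close>
    have sub: "{- r..r} \<subseteq> {- (r + 1)..r + 1}" by auto
    note R = test_functions_in_mono[OF sub r(2)]
    have sm: "smooth \<phi>" by (rule test_functions_smooth[OF True])
    have "integral {- (r + 1)..r + 1} (\<lambda>t. scl (\<phi> t) (f t))
        = - integral {- (r + 1)..r + 1} (\<lambda>t. scl (vderiv \<phi> t) (F t))"
    proof (rule integral_by_parts_vanishing[OF scl_bounded_bilinear[OF scl] smooth_has_derivative[OF sm]
          _ _ _ _ F deriv f])
      show "continuous_on UNIV (vderiv \<phi>)" by (rule test_functions_continuous[OF test_functions_vderiv[OF True]])
      show "\<phi> (- (r + 1)) = 0" "\<phi> (r + 1) = 0"
        using r(1) by (auto intro!: test_functions_in_supp[OF r(2)])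
    qed (use r(1) in simp)
    then show ?thesis
      using True unfolding regular_eq_integral_in[OF scl f R]
      by (simp add: dist_deriv_def regular_eq_integral_in[OF scl FL test_functions_in_vderiv[OF R]])
  qed (simp add: dist_deriv_def regular_def)
qed

lemma primitive_continuous:
  fixes f :: "real \<Rightarrow> 'b::banach"
  shows "f \<in> L1loc \<Longrightarrow> continuous_on UNIV (primitive f)"
  by (rule locally_abs_continuous_imp_continuous[OF locally_abs_continuous_primitive])

lemma dist_deriv_regular_primitive:
  fixes scl :: "'k::{real_normed_field, banach} \<Rightarrow> 'x::banach \<Rightarrow> 'x"
  assumes scl: "normed_space_over scl" and f: "f \<in> L1loc"
  shows "primitive f \<in> L1loc" and "dist_deriv 1 (regular scl (primitive f)) = regular scl f"
  using continuous_imp_L1loc[OF primitive_continuous[OF f]]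
    dist_deriv_regular[OF scl locally_abs_continuous_primitive[OF f] primitive_has_derivative_AE[OF f] f]
  by simp_all

text \<open>
  Let \<open>F\<close> be the primitive of \<open>f\<close>. Since \<open>regular scl f\<close> is the derivative of \<open>regular scl F\<close>,
  its mean is the difference quotient of \<open>regular scl F\<close>, and \<open>mean h f\<close> is the same difference
  quotient of \<open>F\<close>.
\<close>

theorem regular_mean:
  fixes scl :: "'k::{real_normed_field, banach} \<Rightarrow> 'x::banach \<Rightarrow> 'x"
  assumes scl: "normed_space_over scl" and f: "f \<in> L1loc" and h: "h \<noteq> 0"
  shows "mean h f \<in> L1loc" and "dist_mean h (regular scl f) = regular scl (mean h f)"
proof -
  let ?F = "primitive f"
  note F = dist_deriv_regular_primitive[OF scl f]
  have eq: "mean h f = (\<lambda>t. (1 / h) *\<^sub>R diff_op h ?F t + 0 *\<^sub>R diff_op h ?F t)"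
    by (simp add: fun_eq_iff mean_eq_primitive[OF f h] diff_op_def shift_def)
  note D = regular_diff_op[OF scl F(1), of h]
  show "mean h f \<in> L1loc" unfolding eq by (intro L1loc_add L1loc_scaleR D(1))
  have "dist_mean h (regular scl f) = (\<lambda>\<phi>. (1 / h) *\<^sub>R dist_diff h (regular scl ?F) \<phi>)"
    using dist_mean_deriv_1[OF scl regular_distribution[OF scl F(1)] h] F(2) by simp
  then show "dist_mean h (regular scl f) = regular scl (mean h f)"
    unfolding eq regular_lincomb[OF scl D(1) D(1)] D(2) by simp
qed

lemma regular_diff_mean:
  fixes scl :: "'k::{real_normed_field, banach} \<Rightarrow> 'x::banach \<Rightarrow> 'x"
  assumes scl: "normed_space_over scl" and f: "f \<in> L1loc" and h: "h \<noteq> 0"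
  shows "regular scl (\<lambda>t. f t - mean h f t) = (\<lambda>\<phi>. regular scl f \<phi> - dist_mean h (regular scl f) \<phi>)"
  using regular_lincomb[OF scl f regular_mean(1)[OF scl f h], of 1 "-1"] regular_mean(2)[OF scl f h] by simp

text \<open>
  The difference of \<open>T\<close> and the distribution given by \<open>primitive g\<close> has derivative zero, hence
  is given by a constant.
\<close>

lemma dist_deriv_eq_regular:
  fixes scl :: "'k::{real_normed_field, banach} \<Rightarrow> 'x::banach \<Rightarrow> 'x"
  assumes scl: "normed_space_over scl" and T: "T \<in> distributions scl"
    and g: "g \<in> L1loc" and D: "dist_deriv 1 T = regular scl g"
  shows "\<exists>x. T = regular scl (\<lambda>t. primitive g t + x)"
proof -
  interpret bounded_bilinear scl by (rule scl_bounded_bilinear[OF scl])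
  note G = dist_deriv_regular_primitive[OF scl g]
  define S where "S = (\<lambda>\<phi>. 1 *\<^sub>R T \<phi> + (-1) *\<^sub>R regular scl (primitive g) \<phi>)"
  have "S \<in> distributions scl"
    unfolding S_def by (rule distributions_lincomb[OF scl T regular_distribution[OF scl G(1)]])
  moreover have "dist_deriv 1 S \<phi> = 0" for \<phi>
    unfolding S_def dist_deriv_lincomb D G(2) by simp
  ultimately obtain x where x: "\<And>\<phi>. \<phi> \<in> test_functions \<Longrightarrow> S \<phi> = scl (integral UNIV \<phi>) x"
    using dist_deriv_eq_zero[OF scl] by blast
  have xL: "(\<lambda>t. x) \<in> L1loc" by (rule continuous_imp_L1loc) simp
  have const: "regular scl (\<lambda>t. x) \<phi> = scl (integral UNIV \<phi>) x" if \<phi>: "\<phi> \<in> test_functions" for \<phi>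
  proof -
    obtain r where r: "\<phi> \<in> test_functions_in {- r..r}" by (rule test_functions_obtain[OF \<phi>])
    have "(\<phi> has_integral integral {- r..r} \<phi>) {- r..r}"
      by (intro integrable_integral integrable_continuous_interval continuous_on_subset[OF test_functions_continuous[OF \<phi>]]) simp
    from has_integral_linear[OF this bounded_linear_left[of x]]
    show ?thesis
      unfolding regular_eq_integral_in[OF scl xL r] test_function_integral(2)[OF r]
      by (simp add: o_def integral_unique)
  qed
  have "T \<phi> = regular scl (\<lambda>t. primitive g t + x) \<phi>" for \<phi>
  proof (cases "\<phi> \<in> test_functions")
    case True
    then have "T \<phi> = regular scl (primitive g) \<phi> + regular scl (\<lambda>t. x) \<phi>"
      using x[OF True] const[OF True] by (simp add: S_def algebra_simps)
    then show ?thesis using regular_lincomb[OF scl G(1) xL, of 1 1] by simp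
  next
    case False
    then show ?thesis using distributionsD(1)[OF T] by (simp add: regular_def)
  qed
  then show ?thesis by blast
qed

section \<open>The spaces \<open>W\<^sup>1\<^sup>,\<^sup>n\<^sub>l\<^sub>o\<^sub>c\<close>\<close>

lemma differentiable_has_vderiv: "f differentiable (at t) \<Longrightarrow> (f has_vector_derivative vderiv f t) (at t)"
  unfolding vderiv_def by (rule vector_derivative_works[THEN iffD1])

lemma W1loc_continuous:
  assumes "\<psi> \<in> W1loc n" "k \<le> n - 1"
  shows "continuous_on UNIV ((vderiv ^^ k) \<psi>)"
proof (cases "k = n - 1")
  case True
  then show ?thesis using assms(1) by (simp add: W1loc_def)
next
  case False
  then have "\<forall>t. (vderiv ^^ k) \<psi> differentiable (at t)" using assms by (simp add: W1loc_def)
  then show ?thesis by (meson continuous_at_imp_continuous_on differentiable_imp_continuous_within)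
qed

text \<open>
  Up to order \<open>n - 1\<close> the derivatives are continuous and the derivative of a \<open>C^1\<close> function is
  the distributional one; the last differentiation uses local absolute continuity.
\<close>

theorem dist_deriv_regular_W1loc:
  fixes scl :: "'k::{real_normed_field, banach} \<Rightarrow> 'x::banach \<Rightarrow> 'x"
  assumes scl: "normed_space_over scl" and \<psi>: "\<psi> \<in> W1loc n" and "n \<ge> 1"
    and f: "f \<in> L1loc" "AE t in lebesgue. f t = (vderiv ^^ n) \<psi> t"
  shows "dist_deriv n (regular scl \<psi>) = regular scl f"
proof -
  have zero: "regular scl \<psi> \<phi> = 0" if "\<phi> \<notin> test_functions" for \<phi>
    using that by (simp add: regular_def)
  have "dist_deriv k (regular scl \<psi>) = regular scl ((vderiv ^^ k) \<psi>)" if "k \<le> n - 1" for k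
    using that
  proof (induction k)
    case 0
    show ?case using dist_deriv_0[OF zero] by simp
  next
    case (Suc k)
    then have "\<forall>t. (vderiv ^^ k) \<psi> differentiable (at t)" using \<psi> by (simp add: W1loc_def)
    then have d: "((vderiv ^^ k) \<psi> has_vector_derivative (vderiv ^^ Suc k) \<psi> t) (at t)" for t
      using differentiable_has_vderiv by auto
    have c: "continuous_on UNIV ((vderiv ^^ Suc k) \<psi>)" by (rule W1loc_continuous[OF \<psi> Suc.prems])
    have "dist_deriv 1 (regular scl ((vderiv ^^ k) \<psi>)) = regular scl ((vderiv ^^ Suc k) \<psi>)"
      by (rule dist_deriv_regular[OF scl locally_abs_continuous_C1[OF d c] _ continuous_imp_L1loc[OF c]])
         (use d in auto)
    moreover have "dist_deriv k (regular scl \<psi>) = regular scl ((vderiv ^^ k) \<psi>)"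
      using Suc by simp
    ultimately show ?case unfolding dist_deriv_Suc[of k] by simp
  qed
  then have 1: "dist_deriv (n - 1) (regular scl \<psi>) = regular scl ((vderiv ^^ (n - 1)) \<psi>)" by simp
  have "AE t in lebesgue. (vderiv ^^ (n - 1)) \<psi> differentiable (at t)" using \<psi> by (simp add: W1loc_def)
  with f(2) have "AE t in lebesgue. ((vderiv ^^ (n - 1)) \<psi> has_vector_derivative f t) (at t)"
  proof eventually_elim
    fix t assume "f t = (vderiv ^^ n) \<psi> t" "(vderiv ^^ (n - 1)) \<psi> differentiable (at t)"
    moreover have "(vderiv ^^ n) \<psi> = vderiv ((vderiv ^^ (n - 1)) \<psi>)"
      using \<open>n \<ge> 1\<close> by (cases n) auto
    ultimately show "((vderiv ^^ (n - 1)) \<psi> has_vector_derivative f t) (at t)"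
      using differentiable_has_vderiv by metis
  qed
  moreover have "locally_abs_continuous ((vderiv ^^ (n - 1)) \<psi>)" using \<psi> by (simp add: W1loc_def)
  ultimately have "dist_deriv 1 (regular scl ((vderiv ^^ (n - 1)) \<psi>)) = regular scl f"
    using dist_deriv_regular[OF scl _ _ f(1)] by blast
  then show ?thesis using 1 dist_deriv_Suc[of "n - 1" "regular scl \<psi>"] \<open>n \<ge> 1\<close> by simp
qed

text \<open>
  The function \<open>f\<close> is integrated \<open>Suc m\<close> times, with a constant of integration at each step. The
  first integral is locally absolutely continuous with derivative \<open>f\<close> almost everywhere, the
  further ones are primitives of continuous functions.
\<close>

theorem dist_deriv_regular_imp_W1loc:
  fixes scl :: "'k::{real_normed_field, banach} \<Rightarrow> 'x::banach \<Rightarrow> 'x"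
  assumes scl: "normed_space_over scl" and T: "T \<in> distributions scl"
    and f: "f \<in> L1loc" and D: "dist_deriv (Suc m) T = regular scl f"
  shows "\<exists>\<psi>\<in>W1loc (Suc m). T = regular scl \<psi> \<and> (AE t in lebesgue. f t = (vderiv ^^ Suc m) \<psi> t)"
  using T D
proof (induction m arbitrary: T)
  case 0
  obtain x where x: "T = regular scl (\<lambda>t. primitive f t + x)"
    using dist_deriv_eq_regular[OF scl 0(1) f] 0(2) by auto
  let ?\<psi> = "\<lambda>t. primitive f t + x"
  have AC: "locally_abs_continuous ?\<psi>"
    by (rule locally_abs_continuous_add_const[OF locally_abs_continuous_primitive[OF f]]) simp
  have d: "AE t in lebesgue. (?\<psi> has_vector_derivative f t) (at t)"
    using primitive_has_derivative_AE[OF f]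
  proof eventually_elim
    fix t assume "(primitive f has_vector_derivative f t) (at t)"
    from has_vector_derivative_add[OF this has_vector_derivative_const[of x]]
    show "(?\<psi> has_vector_derivative f t) (at t)" by simp
  qed
  have "AE t in lebesgue. ?\<psi> differentiable (at t)"
    using d by eventually_elim (rule differentiableI_vector)
  then have "?\<psi> \<in> W1loc (Suc 0)"
    using AC locally_abs_continuous_imp_continuous[OF AC] by (simp add: W1loc_def)
  moreover have "AE t in lebesgue. f t = (vderiv ^^ Suc 0) ?\<psi> t"
    using d by eventually_elim (simp add: vderiv_def vector_derivative_at)
  ultimately show ?case using x by blast
next
  case (Suc m)
  have "dist_deriv (Suc m) (dist_deriv 1 T) = regular scl f"
    using Suc.prems(2) dist_deriv_Suc'[of "Suc m" T] by simp
  from Suc.IH[OF dist_deriv_distribution[OF scl Suc.prems(1)] this]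
  obtain \<psi> where \<psi>: "\<psi> \<in> W1loc (Suc m)" "dist_deriv 1 T = regular scl \<psi>"
    "AE t in lebesgue. f t = (vderiv ^^ Suc m) \<psi> t" by blast
  have c: "continuous_on UNIV \<psi>" using W1loc_continuous[OF \<psi>(1), of 0] by simp
  obtain x where x: "T = regular scl (\<lambda>t. primitive \<psi> t + x)"
    using dist_deriv_eq_regular[OF scl Suc.prems(1) continuous_imp_L1loc[OF c] \<psi>(2)] by blast
  let ?\<theta> = "\<lambda>t. primitive \<psi> t + x"
  have d: "(?\<theta> has_vector_derivative \<psi> t) (at t)" for t
    using has_vector_derivative_add[OF primitive_derivative[OF c] has_vector_derivative_const[of x]] by simp
  then have "vderiv ?\<theta> = \<psi>" by (auto simp: vderiv_def fun_eq_iff intro: vector_derivative_at)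
  then have pow: "(vderiv ^^ Suc k) ?\<theta> = (vderiv ^^ k) \<psi>" for k by (simp add: funpow_swap1)
  have "(vderiv ^^ k) ?\<theta> differentiable (at t)" if "k < Suc m" for k t
  proof (cases k)
    case 0
    then show ?thesis using differentiableI_vector[OF d] by simp
  next
    case (Suc j)
    then have "j < m" using that by simp
    then show ?thesis unfolding Suc pow using \<psi>(1) by (simp add: W1loc_def)
  qed
  then have "?\<theta> \<in> W1loc (Suc (Suc m))"
    using \<psi>(1) unfolding W1loc_def mem_Collect_eq diff_Suc_1 pow by blast
  moreover have "AE t in lebesgue. f t = (vderiv ^^ Suc (Suc m)) ?\<theta> t"
    using \<psi>(3) unfolding pow .
  ultimately show ?case using x by blast
qed

section \<open>Mean classes inside an ambient space of distributions\<close>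

lemma real_linear_lincomb:
  assumes "real_linear A" "F \<in> A" "G \<in> A"
  shows "(\<lambda>\<phi>. s *\<^sub>R F \<phi> + t *\<^sub>R G \<phi>) \<in> A"
  using assms unfolding real_linear_def by blast

lemma real_linear_ops:
  assumes "real_linear A" "F \<in> A"
  shows "(\<lambda>\<phi>. c *\<^sub>R F \<phi>) \<in> A" and "G \<in> A \<Longrightarrow> (\<lambda>\<phi>. F \<phi> + G \<phi>) \<in> A" and "G \<in> A \<Longrightarrow> (\<lambda>\<phi>. F \<phi> - G \<phi>) \<in> A"
    and "(\<lambda>\<phi>. 0) \<in> A"
  using real_linear_lincomb[OF assms(1,2,2), of c 0] real_linear_lincomb[OF assms, of G 1 1]
    real_linear_lincomb[OF assms, of G 1 "-1"] real_linear_lincomb[OF assms(1,2,2), of 0 0] by simp_all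

lemma dist_deriv_add: "dist_deriv n (\<lambda>\<phi>. F \<phi> + G \<phi>) = (\<lambda>\<phi>. dist_deriv n F \<phi> + dist_deriv n G \<phi>)"
  using dist_deriv_lincomb[of n 1 F 1 G] by simp

lemma dist_deriv_diff: "dist_deriv n (\<lambda>\<phi>. F \<phi> - G \<phi>) = (\<lambda>\<phi>. dist_deriv n F \<phi> - dist_deriv n G \<phi>)"
  using dist_deriv_lincomb[of n 1 F "-1" G] by simp

lemma dist_deriv_zero: "dist_deriv n (\<lambda>\<phi>. 0) = (\<lambda>\<phi>. 0)"
  by (rule ext) (simp add: dist_deriv_def)

lemma dist_mean_add: "dist_mean h (\<lambda>\<phi>. F \<phi> + G \<phi>) = (\<lambda>\<phi>. dist_mean h F \<phi> + dist_mean h G \<phi>)"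
  using dist_mean_lincomb[of h 1 F 1 G] by simp

lemma dist_mean_sub: "dist_mean h (\<lambda>\<phi>. F \<phi> - G \<phi>) = (\<lambda>\<phi>. dist_mean h F \<phi> - dist_mean h G \<phi>)"
  using dist_mean_lincomb[of h 1 F "-1" G] by simp

lemma positive_invariant_diff:
  assumes "real_linear A" "positive_invariant A" "F \<in> A" "s > 0"
  shows "dist_diff s F \<in> A"
proof -
  have "dist_shift s F \<in> A" using assms(2-4) by (simp add: positive_invariant_def)
  then show ?thesis unfolding dist_diff_def using real_linear_ops(3)[OF assms(1) _ assms(3)] by blast
qed

lemma class_sum_iff: "T \<in> class_sum A B \<longleftrightarrow> (\<exists>F\<in>A. \<exists>G\<in>B. T = (\<lambda>\<phi>. F \<phi> + G \<phi>))"
  unfolding class_sum_def by blast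

text \<open>
  The properties that all distributions and the regular distributions have in common.
\<close>

locale ambient_class =
  fixes scl :: "'k::{real_normed_field, banach} \<Rightarrow> 'x::real_normed_vector \<Rightarrow> 'x"
    and R :: "((real \<Rightarrow> 'k) \<Rightarrow> 'x) set"
  assumes scl: "normed_space_over scl"
    and distributions: "R \<subseteq> distributions scl"
    and linear: "real_linear R"
    and mean: "T \<in> R \<Longrightarrow> h > 0 \<Longrightarrow> dist_mean h T \<in> R"
    and has_primitive: "T \<in> R \<Longrightarrow> \<exists>P\<in>R. dist_deriv 1 P = T"
begin

definition means_in :: "((real \<Rightarrow> 'k) \<Rightarrow> 'x) set \<Rightarrow> ((real \<Rightarrow> 'k) \<Rightarrow> 'x) set" where
  "means_in B = {T \<in> R. \<forall>h>0. dist_mean h T \<in> B}"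

definition difference_property :: "((real \<Rightarrow> 'k) \<Rightarrow> 'x) set \<Rightarrow> bool" where
  "difference_property B \<longleftrightarrow>
     (\<forall>T\<in>R. (\<forall>s>0. dist_diff s T \<in> B) \<longrightarrow> (\<forall>h>0. (\<lambda>\<phi>. T \<phi> - dist_mean h T \<phi>) \<in> B))"

lemma real_linear_means_in:
  assumes B: "real_linear B"
  shows "real_linear (means_in B)"
  unfolding real_linear_def
proof (intro ballI allI)
  fix F G and s t :: real assume F: "F \<in> means_in B" and G: "G \<in> means_in B"
  have "(\<lambda>\<phi>. s *\<^sub>R F \<phi> + t *\<^sub>R G \<phi>) \<in> R"
    using F G real_linear_lincomb[OF linear] by (simp add: means_in_def)
  moreover have "dist_mean h (\<lambda>\<phi>. s *\<^sub>R F \<phi> + t *\<^sub>R G \<phi>) \<in> B" if "h > 0" for h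
    unfolding dist_mean_lincomb using F G that real_linear_lincomb[OF B] by (simp add: means_in_def)
  ultimately show "(\<lambda>\<phi>. s *\<^sub>R F \<phi> + t *\<^sub>R G \<phi>) \<in> means_in B" by (simp add: means_in_def)
qed

text \<open>
  Means commute with differences and with each other, so the property of \<open>B\<close> applies to each
  mean of \<open>T\<close>.
\<close>

lemma difference_property_means_in:
  assumes B: "difference_property B"
  shows "difference_property (means_in B)"
  unfolding difference_property_def
proof (intro ballI allI impI)
  fix T h assume T: "T \<in> R" and diff: "\<forall>s>0. dist_diff s T \<in> means_in B" and h: "(h :: real) > 0"
  have "(\<lambda>\<phi>. T \<phi> - dist_mean h T \<phi>) \<in> R"
    by (rule real_linear_ops(3)[OF linear T mean[OF T h]])
  moreover have "dist_mean k (\<lambda>\<phi>. T \<phi> - dist_mean h T \<phi>) \<in> B" if k: "k > 0" for k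
  proof -
    have "dist_diff s (dist_mean k T) \<in> B" if "s > 0" for s
    proof -
      have "dist_mean k (dist_diff s T) \<in> B" using diff that k by (simp add: means_in_def)
      then show ?thesis using dist_mean_diff[of k s T] k by simp
    qed
    then have "(\<lambda>\<phi>. dist_mean k T \<phi> - dist_mean h (dist_mean k T) \<phi>) \<in> B"
      using B mean[OF T k] h by (simp add: difference_property_def)
    then show ?thesis
      using dist_mean_commute[of h k T] h k by (simp add: dist_mean_sub)
  qed
  ultimately show "(\<lambda>\<phi>. T \<phi> - dist_mean h T \<phi>) \<in> means_in B" by (simp add: means_in_def)
qed

text \<open>
  Take a primitive \<open>P\<close> of \<open>T\<close> in \<open>R\<close>. Its differences \<open>dist_diff s P\<close>, being \<open>s\<close> times the means
  of \<open>T\<close>, lie in \<open>B\<close>, so \<open>Q = P - dist_mean 1 P\<close> lies in \<open>B\<close>. Its derivative is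
  \<open>T - dist_mean 1 T\<close>.
\<close>

theorem means_in_decomposition:
  assumes B: "real_linear B" "difference_property B" and T: "T \<in> means_in B"
  shows "\<exists>Q\<in>B. T = (\<lambda>\<phi>. dist_mean 1 T \<phi> + dist_deriv 1 Q \<phi>)"
proof -
  have TR: "T \<in> R" and TB: "\<And>h. h > 0 \<Longrightarrow> dist_mean h T \<in> B" using T by (auto simp: means_in_def)
  obtain P where P: "P \<in> R" "dist_deriv 1 P = T" using has_primitive[OF TR] by blast
  have "dist_diff s P \<in> B" if s: "s > 0" for s
  proof -
    have "dist_mean s T = (\<lambda>\<phi>. (1 / s) *\<^sub>R dist_diff s P \<phi>)"
      using dist_mean_deriv_1[OF scl, of P s] P distributions s by auto
    then have "(\<lambda>\<phi>. s *\<^sub>R dist_mean s T \<phi>) = dist_diff s P" using s by simp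
    then show ?thesis using real_linear_ops(1)[OF B(1) TB[OF s], of s] by simp
  qed
  then have "(\<lambda>\<phi>. P \<phi> - dist_mean 1 P \<phi>) \<in> B"
    using B(2) P(1) by (simp add: difference_property_def)
  moreover have "dist_deriv 1 (\<lambda>\<phi>. P \<phi> - dist_mean 1 P \<phi>) = (\<lambda>\<phi>. T \<phi> - dist_mean 1 T \<phi>)"
    using dist_mean_deriv[of 1 1 P] by (simp add: dist_deriv_diff P(2)[simplified])
  ultimately show ?thesis by (intro bexI[of _ "\<lambda>\<phi>. P \<phi> - dist_mean 1 P \<phi>"]) auto
qed

end

text \<open>
  The assumption \<open>ramp\<close> is what invariance under convolution gives besides invariance under
  means: the class \<open>A\<close> contains a primitive of \<open>F - dist_mean 1 F\<close>.
\<close>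

locale averaging_class = ambient_class scl R
  for scl :: "'k::{real_normed_field, banach} \<Rightarrow> 'x::real_normed_vector \<Rightarrow> 'x" and R +
  fixes A :: "((real \<Rightarrow> 'k) \<Rightarrow> 'x) set"
  assumes sub: "A \<subseteq> R"
    and real_linear_A: "real_linear A"
    and invariant: "positive_invariant A"
    and mean_A: "F \<in> A \<Longrightarrow> h > 0 \<Longrightarrow> dist_mean h F \<in> A"
    and ramp: "F \<in> A \<Longrightarrow> \<exists>G\<in>A. (\<lambda>\<phi>. F \<phi> - dist_mean 1 F \<phi>) = dist_deriv 1 G"
    and difference_A: "difference_property A"
begin

lemma distribution_A: "F \<in> A \<Longrightarrow> F \<in> distributions scl"
  using sub distributions by blast

definition sum_with_deriv :: "nat \<Rightarrow> ((real \<Rightarrow> 'k) \<Rightarrow> 'x) set" where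
  "sum_with_deriv m = class_sum A (dist_deriv m ` A)"

lemma sum_with_deriv_iff:
  "T \<in> sum_with_deriv m \<longleftrightarrow> (\<exists>a\<in>A. \<exists>b\<in>A. T = (\<lambda>\<phi>. a \<phi> + dist_deriv m b \<phi>))"
  unfolding sum_with_deriv_def class_sum_iff by blast

lemma sum_with_derivI:
  assumes "F \<in> A"
  shows "F \<in> sum_with_deriv m" and "dist_deriv m F \<in> sum_with_deriv m"
proof -
  have 0: "(\<lambda>\<phi>. 0) \<in> A" by (rule real_linear_ops(4)[OF real_linear_A assms])
  show "F \<in> sum_with_deriv m"
    unfolding sum_with_deriv_iff
    by (rule bexI[OF bexI[OF _ 0] assms]) (simp add: dist_deriv_zero)
  show "dist_deriv m F \<in> sum_with_deriv m"
    unfolding sum_with_deriv_iff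
    by (rule bexI[OF bexI[OF _ assms] 0]) simp
qed

lemma sum_with_deriv_add:
  assumes "S \<in> sum_with_deriv m" "T \<in> sum_with_deriv m"
  shows "(\<lambda>\<phi>. S \<phi> + T \<phi>) \<in> sum_with_deriv m"
proof -
  obtain a b where S: "a \<in> A" "b \<in> A" "S = (\<lambda>\<phi>. a \<phi> + dist_deriv m b \<phi>)"
    using assms(1) unfolding sum_with_deriv_iff by blast
  obtain c d where T: "c \<in> A" "d \<in> A" "T = (\<lambda>\<phi>. c \<phi> + dist_deriv m d \<phi>)"
    using assms(2) unfolding sum_with_deriv_iff by blast
  show ?thesis
    unfolding sum_with_deriv_iff S(3) T(3)
    by (rule bexI[OF bexI[OF _ real_linear_ops(2)[OF real_linear_A S(2) T(2)]]
          real_linear_ops(2)[OF real_linear_A S(1) T(1)]]) (simp add: dist_deriv_add algebra_simps)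
qed

text \<open>
  The element \<open>H = dist_deriv k b\<close> of \<open>A\<close> is split into \<open>dist_mean 1 H\<close> and \<open>H - dist_mean 1 H\<close>.
  The derivative of the first part is \<open>dist_diff 1 H \<in> A\<close>. The second part lies in \<open>A\<close> and
  equals \<open>dist_deriv k (b - dist_mean 1 b)\<close>, which is a derivative of order \<open>Suc k\<close> of an
  element of \<open>A\<close>.
\<close>

lemma deriv_eq_sum_with_high_deriv:
  assumes F: "F \<in> A"
  shows "\<exists>a\<in>A. \<exists>b\<in>A. dist_deriv k b \<in> A \<and> dist_deriv 1 F = (\<lambda>\<phi>. a \<phi> + dist_deriv 1 (dist_deriv k b) \<phi>)"
proof (induction k)
  case 0
  have "dist_deriv 0 F = F" by (rule dist_deriv_0) (rule distributionsD(1)[OF distribution_A[OF F]])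
  then show ?case
    using F real_linear_ops(4)[OF real_linear_A F] by (intro bexI[of _ "\<lambda>\<phi>. 0"] bexI[of _ F]) auto
next
  case (Suc k)
  then obtain a b where a: "a \<in> A" and b: "b \<in> A" and H: "dist_deriv k b \<in> A"
    and eq: "dist_deriv 1 F = (\<lambda>\<phi>. a \<phi> + dist_deriv 1 (dist_deriv k b) \<phi>)" by blast
  define H where "H = dist_deriv k b"
  have HA: "H \<in> A" using H by (simp add: H_def)
  obtain b' where b': "b' \<in> A" "(\<lambda>\<phi>. b \<phi> - dist_mean 1 b \<phi>) = dist_deriv 1 b'" using ramp[OF b] by blast
  have step: "(\<lambda>\<phi>. H \<phi> - dist_mean 1 H \<phi>) = dist_deriv (Suc k) b'"
    unfolding dist_deriv_Suc' b'(2)[symmetric] dist_deriv_diff H_def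
    using dist_mean_deriv[of 1 k b] by simp
  have high: "dist_deriv (Suc k) b' \<in> A"
    unfolding step[symmetric] by (rule real_linear_ops(3)[OF real_linear_A HA mean_A[OF HA]]) simp
  have "dist_diff 1 H \<in> A" by (rule positive_invariant_diff[OF real_linear_A invariant HA]) simp
  moreover have "dist_deriv 1 (dist_mean 1 H) = dist_diff 1 H"
    using dist_mean_deriv_1[OF scl distribution_A[OF HA], of 1] dist_mean_deriv[of 1 1 H] by simp
  ultimately have low: "dist_deriv 1 (dist_mean 1 H) \<in> A" by simp
  have "dist_deriv 1 H = (\<lambda>\<phi>. dist_deriv 1 (dist_mean 1 H) \<phi> + dist_deriv 1 (dist_deriv (Suc k) b') \<phi>)"
    unfolding step[symmetric] dist_deriv_diff by simp
  then have "dist_deriv 1 F = (\<lambda>\<phi>. (a \<phi> + dist_deriv 1 (dist_mean 1 H) \<phi>) + dist_deriv 1 (dist_deriv (Suc k) b') \<phi>)"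
    unfolding eq H_def[symmetric] by (simp add: add.assoc)
  then show ?case
    by (intro bexI[OF _ real_linear_ops(2)[OF real_linear_A a low]] bexI[OF _ b'(1)] conjI[OF high])
qed

text \<open>
  By the preceding lemma \<open>dist_deriv (Suc j) F\<close> is the sum of \<open>dist_deriv j a\<close> and a derivative
  of order \<open>m\<close>, where \<open>a \<in> A\<close> and the order \<open>k\<close> of the lemma is chosen such that
  \<open>j + 1 + k = m\<close>.
\<close>

theorem deriv_in_sum_with_higher_deriv:
  assumes "F \<in> A" "1 \<le> j" "j \<le> m"
  shows "dist_deriv j F \<in> sum_with_deriv m"
  using assms(2,1,3)
proof (induction j arbitrary: F rule: dec_induct)
  case base
  obtain a b where ab: "a \<in> A" "b \<in> A"
    "dist_deriv 1 F = (\<lambda>\<phi>. a \<phi> + dist_deriv 1 (dist_deriv (m - 1) b) \<phi>)"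
    using deriv_eq_sum_with_high_deriv[OF base(1), of "m - 1"] by blast
  have "Suc (m - 1) = m" using base(2) by simp
  then have "dist_deriv 1 (dist_deriv (m - 1) b) = dist_deriv m b" using dist_deriv_Suc[of "m - 1" b] by metis
  then show ?case
    unfolding sum_with_deriv_iff ab(3) by (intro bexI[OF _ ab(1)] bexI[OF _ ab(2)]) simp
next
  case (step j)
  define k where "k = m - Suc j"
  have m: "(1 + k) + j = m" using step.prems(2) by (simp add: k_def)
  obtain a b where ab: "a \<in> A" "b \<in> A"
    "dist_deriv 1 F = (\<lambda>\<phi>. a \<phi> + dist_deriv 1 (dist_deriv k b) \<phi>)"
    using deriv_eq_sum_with_high_deriv[OF step.prems(1), of k] by blast
  have "dist_deriv (Suc j) F = dist_deriv j (dist_deriv 1 F)" by (rule dist_deriv_Suc')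
  also have "\<dots> = (\<lambda>\<phi>. dist_deriv j a \<phi> + dist_deriv j (dist_deriv 1 (dist_deriv k b)) \<phi>)"
    unfolding ab(3) dist_deriv_add ..
  also have "dist_deriv j (dist_deriv 1 (dist_deriv k b)) = dist_deriv m b"
    using dist_deriv_add_index[of "1 + k" j b] m dist_deriv_Suc[of k b] by simp
  finally show ?case
    using sum_with_deriv_add[OF step.IH[OF ab(1)] sum_with_derivI(2)[OF ab(2), of m]] step.prems(2) by simp
qed

text \<open>
  The decomposition of an element of the mean class of \<open>B\<close> into a mean and the derivative of an
  element of \<open>B\<close> involves derivatives of the orders 0, \<open>n\<close>, 1 and \<open>Suc n\<close> of elements of \<open>A\<close>;
  all are absorbed by \<open>sum_with_deriv (Suc n)\<close>. The part of order \<open>Suc n\<close> lies in \<open>R\<close>, as the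
  difference of two elements of \<open>R\<close>.
\<close>

theorem means_in_pow_eq:
  "(means_in ^^ n) A = class_sum A (dist_deriv n ` A \<inter> R) \<and>
   real_linear ((means_in ^^ n) A) \<and> difference_property ((means_in ^^ n) A)"
proof (induction n)
  case 0
  have d0: "dist_deriv 0 F = F" if "F \<in> A" for F
    by (rule dist_deriv_0) (rule distributionsD(1)[OF distribution_A[OF that]])
  then have im: "dist_deriv 0 ` A \<inter> R = A" using sub by force
  have "class_sum A A = A"
  proof (intro equalityI subsetI)
    fix T assume "T \<in> class_sum A A"
    then show "T \<in> A" unfolding class_sum_iff using real_linear_ops(2)[OF real_linear_A] by blast
  next
    fix T assume "T \<in> A"
    then show "T \<in> class_sum A A"
      unfolding class_sum_iff using real_linear_ops(4)[OF real_linear_A] by (intro bexI[of _ T] bexI[of _ "\<lambda>\<phi>. 0"]) auto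
  qed
  then show ?case using im real_linear_A difference_A by simp
next
  case (Suc n)
  define B where "B = (means_in ^^ n) A"
  have B: "B = class_sum A (dist_deriv n ` A \<inter> R)" "real_linear B" "difference_property B"
    using Suc.IH unfolding B_def by blast+
  have "means_in B = class_sum A (dist_deriv (Suc n) ` A \<inter> R)"
  proof (intro equalityI subsetI)
    fix T assume T: "T \<in> means_in B"
    have BS: "F \<in> sum_with_deriv n" if "F \<in> B" for F
      using that unfolding B(1) class_sum_iff sum_with_deriv_def by blast
    have TB: "dist_mean 1 T \<in> B" and TR: "T \<in> R" using T by (auto simp: means_in_def)
    obtain Q where Q: "Q \<in> B" "T = (\<lambda>\<phi>. dist_mean 1 T \<phi> + dist_deriv 1 Q \<phi>)"
      using means_in_decomposition[OF B(2,3) T] by blast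
    obtain a b where ab: "a \<in> A" "b \<in> A" "dist_mean 1 T = (\<lambda>\<phi>. a \<phi> + dist_deriv n b \<phi>)"
      using BS[OF TB] unfolding sum_with_deriv_iff by blast
    obtain c d where cd: "c \<in> A" "d \<in> A" "Q = (\<lambda>\<phi>. c \<phi> + dist_deriv n d \<phi>)"
      using BS[OF Q(1)] unfolding sum_with_deriv_iff by blast
    have nb: "dist_deriv n b \<in> sum_with_deriv (Suc n)"
    proof (cases "n = 0")
      case True
      have "dist_deriv 0 b = b" by (rule dist_deriv_0) (rule distributionsD(1)[OF distribution_A[OF ab(2)]])
      then show ?thesis using True sum_with_derivI(1)[OF ab(2)] by simp
    next
      case False
      then show ?thesis by (intro deriv_in_sum_with_higher_deriv ab(2)) auto
    qed
    have "dist_mean 1 T \<in> sum_with_deriv (Suc n)"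
      unfolding ab(3) by (rule sum_with_deriv_add[OF sum_with_derivI(1)[OF ab(1)] nb])
    moreover have "dist_deriv 1 Q \<in> sum_with_deriv (Suc n)"
      unfolding cd(3) dist_deriv_add dist_deriv_Suc[symmetric]
      by (intro sum_with_deriv_add deriv_in_sum_with_higher_deriv cd(1) sum_with_derivI(2)[OF cd(2)]) auto
    ultimately have "T \<in> sum_with_deriv (Suc n)"
      using sum_with_deriv_add Q(2) by metis
    then obtain x y where xy: "x \<in> A" "y \<in> A" "T = (\<lambda>\<phi>. x \<phi> + dist_deriv (Suc n) y \<phi>)"
      unfolding sum_with_deriv_iff by blast
    have "(\<lambda>\<phi>. T \<phi> - x \<phi>) \<in> R" using real_linear_ops(3)[OF linear TR] xy(1) sub by blast
    moreover have "(\<lambda>\<phi>. T \<phi> - x \<phi>) = dist_deriv (Suc n) y" unfolding xy(3) by simp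
    ultimately have "dist_deriv (Suc n) y \<in> dist_deriv (Suc n) ` A \<inter> R" using xy(2) by simp
    then show "T \<in> class_sum A (dist_deriv (Suc n) ` A \<inter> R)"
      unfolding class_sum_iff using xy(1,3) by blast
  next
    fix T assume "T \<in> class_sum A (dist_deriv (Suc n) ` A \<inter> R)"
    then obtain F G where F: "F \<in> A" and G: "G \<in> A" "dist_deriv (Suc n) G \<in> R"
      and T: "T = (\<lambda>\<phi>. F \<phi> + dist_deriv (Suc n) G \<phi>)"
      unfolding class_sum_iff by blast
    have "T \<in> R" unfolding T using F sub G(2) by (intro real_linear_ops(2)[OF linear]) auto
    moreover have "dist_mean h T \<in> B" if h: "h > 0" for h
    proof -
      have ne: "h \<noteq> 0" using h by simp
      have "(\<lambda>\<phi>. (1 / h) *\<^sub>R dist_diff h G \<phi>) \<in> A"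
        by (intro real_linear_ops(1) real_linear_A positive_invariant_diff[OF real_linear_A invariant G(1) h])
      moreover have "dist_mean h (dist_deriv (Suc n) G) = dist_deriv n (\<lambda>\<phi>. (1 / h) *\<^sub>R dist_diff h G \<phi>)"
        unfolding dist_deriv_Suc'[of n G] dist_mean_deriv[OF ne, of n "dist_deriv 1 G"]
          dist_mean_deriv_1[OF scl distribution_A[OF G(1)] ne] ..
      moreover have "dist_mean h (dist_deriv (Suc n) G) \<in> R" by (rule mean[OF G(2) h])
      ultimately have "dist_mean h (dist_deriv (Suc n) G) \<in> dist_deriv n ` A \<inter> R" by auto
      then show ?thesis
        unfolding B(1) T dist_mean_add class_sum_iff using mean_A[OF F h] by blast
    qed
    ultimately show "T \<in> means_in B" by (simp add: means_in_def)
  qed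
  then show ?case
    using real_linear_means_in[OF B(2)] difference_property_means_in[OF B(3)] by (simp add: B_def)
qed

end

section \<open>Convolution\<close>

lemma Linf_c_interval:
  fixes g :: "real \<Rightarrow> real"
  assumes "continuous_on UNIV g" "\<And>t. t \<in> {a..b} \<Longrightarrow> \<bar>g t\<bar> \<le> C"
  shows "(\<lambda>t. indicator {a..b} t * g t) \<in> Linf_c"
  unfolding Linf_c_def
proof (intro CollectI conjI)
  have "g \<in> borel_measurable borel" by (rule borel_measurable_continuous_onI[OF assms(1)])
  then have "(\<lambda>t. indicator {a..b} t * g t) \<in> borel_measurable lborel" by simp
  then show "(\<lambda>t. indicator {a..b} t * g t) \<in> borel_measurable lebesgue" by (rule measurable_completion)
  have "\<bar>indicator {a..b} t * g t\<bar> \<le> \<bar>C\<bar>" for t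
    using assms(2)[of t] by (auto simp: indicator_def)
  then show "\<exists>C. AE t in lebesgue. \<bar>indicator {a..b} t * g t\<bar> \<le> C" by blast
  have "\<bar>a\<bar> + \<bar>b\<bar> < \<bar>t\<bar> \<longrightarrow> indicator {a..b} t * g t = 0" for t by (auto simp: indicator_def)
  then show "\<exists>R. AE t in lebesgue. R < \<bar>t\<bar> \<longrightarrow> indicator {a..b} t * g t = 0"
    by (intro exI[of _ "\<bar>a\<bar> + \<bar>b\<bar>"]) simp
qed

lemma mean_eq_bochner:
  fixes f :: "real \<Rightarrow> 'b::real_normed_vector"
  assumes "h > 0"
  shows "mean (- h) f t = (1 / h) *\<^sub>R bochner_integral lebesgue (\<lambda>s. indicator {- h..0} s *\<^sub>R f (t + s))"
  using assms by (simp add: mean_def oriented_integral_def)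

lemma dist_conv_indicator:
  fixes T :: "(real \<Rightarrow> 'k::{real_normed_field, banach}) \<Rightarrow> 'x::real_normed_vector"
  assumes scl: "normed_space_over scl" and T: "T \<in> distributions scl" and h: "h > 0"
  shows "dist_conv T (\<lambda>t. indicator {- h..0} t * 1) = (\<lambda>\<phi>. h *\<^sub>R dist_mean h T \<phi>)"
proof
  fix \<phi> :: "real \<Rightarrow> 'k"
  show "dist_conv T (\<lambda>t. indicator {- h..0} t * 1) \<phi> = h *\<^sub>R dist_mean h T \<phi>"
  proof (cases "\<phi> \<in> test_functions")
    case True
    have "- h \<noteq> 0" using h by simp
    note m = test_functions_mean(1)[OF True this]
    have "(\<lambda>t. bochner_integral lebesgue (\<lambda>s. (indicator {- h..0} s * 1) *\<^sub>R \<phi> (t + s))) = (\<lambda>t. h *\<^sub>R mean (- h) \<phi> t)"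
      using h by (simp add: fun_eq_iff mean_eq_bochner)
    then show ?thesis
      using True distribution_scaleR[OF scl T m, of h] by (simp add: dist_conv_def dist_mean_def)
  qed (simp add: dist_conv_def dist_mean_def)
qed

text \<open>
  The ramp \<open>- (t + 1)\<close> on \<open>{- 1..0}\<close> has as derivative the point mass at 0 minus the indicator
  of \<open>{- 1..0}\<close>. On test functions this is an integration by parts.
\<close>

lemma dist_deriv_conv_ramp:
  fixes T :: "(real \<Rightarrow> 'k::{real_normed_field, banach}) \<Rightarrow> 'x::real_normed_vector"
  assumes scl: "normed_space_over scl" and T: "T \<in> distributions scl"
  shows "dist_deriv 1 (dist_conv T (\<lambda>t. indicator {- 1..0} t * - (t + 1))) = (\<lambda>\<phi>. T \<phi> - dist_mean 1 T \<phi>)"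
proof
  fix \<phi> :: "real \<Rightarrow> 'k"
  show "dist_deriv 1 (dist_conv T (\<lambda>t. indicator {- 1..0} t * - (t + 1))) \<phi> = T \<phi> - dist_mean 1 T \<phi>"
  proof (cases "\<phi> \<in> test_functions")
    case True
    have sm: "smooth \<phi>" by (rule test_functions_smooth[OF True])
    have c: "continuous_on UNIV \<phi>" "continuous_on UNIV (vderiv \<phi>)"
      using test_functions_continuous True test_functions_vderiv by blast+
    have m: "mean (- 1) \<phi> \<in> test_functions" using test_functions_mean(1)[OF True, of "- 1"] by simp
    have conv: "bochner_integral lebesgue (\<lambda>s. (indicator {- 1..0} s * - (s + 1)) *\<^sub>R vderiv \<phi> (t + s))
        = mean (- 1) \<phi> t - \<phi> t" for t
    proof -
      have ct: "continuous_on UNIV (\<lambda>s. \<phi> (t + s))" "continuous_on UNIV (\<lambda>s. vderiv \<phi> (t + s))"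
        by (intro continuous_on_compose2[OF c(1)] continuous_on_compose2[OF c(2)] continuous_intros; simp)+
      let ?g = "\<lambda>s. - (s + 1) *\<^sub>R vderiv \<phi> (t + s)"
      have gL: "?g \<in> L1loc" by (intro continuous_imp_L1loc continuous_intros ct)
      have d: "((\<lambda>s. - (s + 1) *\<^sub>R \<phi> (t + s)) has_vector_derivative
          (- (s + 1) *\<^sub>R vderiv \<phi> (t + s) + - 1 *\<^sub>R \<phi> (t + s))) (at s within {- 1..0})" for s
      proof -
        have "((\<lambda>s. t + s) has_vector_derivative 1) (at s)" by (auto intro!: derivative_eq_intros)
        from vector_diff_chain_at[OF this smooth_has_derivative[OF sm, of "t + s"]]
        have "((\<lambda>s. \<phi> (t + s)) has_vector_derivative vderiv \<phi> (t + s)) (at s within {- 1..0})"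
          by (simp add: o_def has_vector_derivative_at_within)
        moreover have "((\<lambda>s. - (s + 1)) has_vector_derivative (- 1 :: real)) (at s within {- 1..0})"
          by (auto intro!: derivative_eq_intros)
        ultimately show ?thesis
          using bounded_bilinear.has_vector_derivative[OF bounded_bilinear_scaleR] by blast
      qed
      have "((\<lambda>s. - (s + 1) *\<^sub>R vderiv \<phi> (t + s) + - 1 *\<^sub>R \<phi> (t + s)) has_integral
          - (0 + 1) *\<^sub>R \<phi> (t + 0) - - (- 1 + 1) *\<^sub>R \<phi> (t + - 1)) {- 1..0}"
        by (rule fundamental_theorem_of_calculus[OF _ d]) simp
      moreover have "((\<lambda>s. \<phi> (t + s)) has_integral mean (- 1) \<phi> t) {- 1..0}"
      proof -
        have "mean (- 1) \<phi> t = integral {- 1..0} (\<lambda>s. \<phi> (t + s))"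
          using mean_eq_bochner[of 1 \<phi> t] L1loc_bochner_integral[OF continuous_imp_L1loc[OF ct(1)], of "- 1" 0] by simp
        then show ?thesis
          using integrable_integral[OF L1loc_integrable[OF continuous_imp_L1loc[OF ct(1)], of "- 1" 0]] by simp
      qed
      ultimately have "(?g has_integral (- (0 + 1) *\<^sub>R \<phi> (t + 0) - - (- 1 + 1) *\<^sub>R \<phi> (t + - 1)) + mean (- 1) \<phi> t) {- 1..0}"
        using has_integral_add[of "\<lambda>s. - (s + 1) *\<^sub>R vderiv \<phi> (t + s) + - 1 *\<^sub>R \<phi> (t + s)" _ "{- 1..0}" "\<lambda>s. \<phi> (t + s)"]
        by fastforce
      then have "integral {- 1..0} ?g = mean (- 1) \<phi> t - \<phi> t"
        by (simp add: integral_unique)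
      moreover have "(indicator {- 1..0} s * - (s + 1)) *\<^sub>R vderiv \<phi> (t + s) = indicator {- 1..0} s *\<^sub>R ?g s" for s
        by simp
      ultimately show ?thesis using L1loc_bochner_integral[OF gL, of "- 1" 0] by simp
    qed
    have "dist_conv T (\<lambda>t. indicator {- 1..0} t * - (t + 1)) (vderiv \<phi>) = T (\<lambda>t. mean (- 1) \<phi> t - \<phi> t)"
      unfolding dist_conv_def conv by (rule if_P[OF test_functions_vderiv[OF True]])
    then have "dist_deriv 1 (dist_conv T (\<lambda>t. indicator {- 1..0} t * - (t + 1))) \<phi> = - T (\<lambda>t. mean (- 1) \<phi> t - \<phi> t)"
      using True by (simp add: dist_deriv_def)
    then show ?thesis
      using distribution_diff[OF scl T m True] True by (simp add: dist_mean_def)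
  qed (use distributionsD(1)[OF T] in \<open>simp add: dist_deriv_def dist_mean_def\<close>)
qed

lemma conv_invariant_class:
  fixes A :: "((real \<Rightarrow> 'k::{real_normed_field, banach}) \<Rightarrow> 'x::real_normed_vector) set"
  assumes scl: "normed_space_over scl" and A: "A \<subseteq> distributions scl" "real_linear A"
    and conv: "\<forall>T\<in>A. \<forall>g\<in>Linf_c. dist_conv T g \<in> A" and F: "F \<in> A"
  shows "h > 0 \<Longrightarrow> dist_mean h F \<in> A" and "\<exists>G\<in>A. (\<lambda>\<phi>. F \<phi> - dist_mean 1 F \<phi>) = dist_deriv 1 G"
proof -
  have Fd: "F \<in> distributions scl" using F A(1) by blast
  show "dist_mean h F \<in> A" if h: "h > 0"
  proof -
    have "(\<lambda>t. indicator {- h..0} t * 1) \<in> Linf_c" by (rule Linf_c_interval[of "\<lambda>t. 1" _ _ 1]) auto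
    then have "(\<lambda>\<phi>. h *\<^sub>R dist_mean h F \<phi>) \<in> A"
      using conv F dist_conv_indicator[OF scl Fd h] by metis
    from real_linear_ops(1)[OF A(2) this, of "1 / h"] show ?thesis using h by simp
  qed
  have "(\<lambda>t. indicator {- 1..0} t * - (t + 1)) \<in> Linf_c"
    by (rule Linf_c_interval[of "\<lambda>t. - (t + 1)" _ _ 1]) (auto intro!: continuous_intros)
  then have "dist_conv F (\<lambda>t. indicator {- 1..0} t * - (t + 1)) \<in> A" using conv F by blast
  then show "\<exists>G\<in>A. (\<lambda>\<phi>. F \<phi> - dist_mean 1 F \<phi>) = dist_deriv 1 G"
    using dist_deriv_conv_ramp[OF scl Fd] by metis
qed

section \<open>All distributions and regular distributions as ambient spaces\<close>

lemma ambient_class_distributions: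
  fixes scl :: "'k::{real_normed_field, banach} \<Rightarrow> 'x::real_normed_vector \<Rightarrow> 'x"
  assumes scl: "normed_space_over scl"
  shows "ambient_class scl (distributions scl)"
proof (rule ambient_class.intro[OF scl subset_refl])
  show "real_linear (distributions scl)"
    unfolding real_linear_def using distributions_lincomb[OF scl] by blast
  fix T assume T: "T \<in> distributions scl"
  show "dist_mean h T \<in> distributions scl" if "h > 0" for h
    using dist_mean_distribution[OF scl T] that by simp
  show "\<exists>P\<in>distributions scl. dist_deriv 1 P = T" by (rule distribution_primitive[OF scl T])
qed

lemma ambient_class_regular:
  fixes scl :: "'k::{real_normed_field, banach} \<Rightarrow> 'x::banach \<Rightarrow> 'x"
  assumes scl: "normed_space_over scl"
  shows "ambient_class scl (regular scl ` L1loc)"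
proof (rule ambient_class.intro[OF scl])
  show "regular scl ` L1loc \<subseteq> distributions scl" using regular_distribution[OF scl] by blast
  show "real_linear (regular scl ` L1loc)"
    unfolding real_linear_def
  proof (intro ballI allI)
    fix F G and s t :: real assume "F \<in> regular scl ` L1loc" "G \<in> regular scl ` L1loc"
    then obtain f g where fg: "f \<in> L1loc" "g \<in> L1loc" "F = regular scl f" "G = regular scl g" by blast
    show "(\<lambda>\<phi>. s *\<^sub>R F \<phi> + t *\<^sub>R G \<phi>) \<in> regular scl ` L1loc"
      unfolding fg(3,4) regular_lincomb[OF scl fg(1,2), symmetric]
      by (intro imageI L1loc_add L1loc_scaleR fg)
  qed
  fix T assume "T \<in> regular scl ` L1loc"
  then obtain f where f: "f \<in> L1loc" "T = regular scl f" by blast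
  show "dist_mean h T \<in> regular scl ` L1loc" if "h > 0" for h
    using regular_mean[OF scl f(1), of h] that f(2) by simp
  show "\<exists>P\<in>regular scl ` L1loc. dist_deriv 1 P = T"
    using dist_deriv_regular_primitive[OF scl f(1)] f(2) by blast
qed

lemma mean_class_eq:
  fixes scl :: "'k::{real_normed_field, banach} \<Rightarrow> 'x::banach \<Rightarrow> 'x"
  assumes scl: "normed_space_over scl"
  shows "mean_class scl B = {T \<in> regular scl ` L1loc. \<forall>h>0. dist_mean h T \<in> B}"
proof -
  have "(\<forall>h>0. regular scl (mean h f) \<in> B) \<longleftrightarrow> (\<forall>h>0. dist_mean h (regular scl f) \<in> B)" if "f \<in> L1loc" for f
    using regular_mean(2)[OF scl that] by auto
  then show ?thesis unfolding mean_class_def by blast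
qed

lemma Delta_iff:
  fixes scl :: "'k::{real_normed_field, banach} \<Rightarrow> 'x::banach \<Rightarrow> 'x"
  assumes scl: "normed_space_over scl"
  shows "Delta scl B \<longleftrightarrow> (\<forall>T\<in>regular scl ` L1loc. (\<forall>s>0. dist_diff s T \<in> B) \<longrightarrow>
      (\<forall>h>0. (\<lambda>\<phi>. T \<phi> - dist_mean h T \<phi>) \<in> B))"
proof -
  have "((\<forall>s>0. regular scl (diff_op s f) \<in> B) \<longrightarrow> (\<forall>h>0. regular scl (\<lambda>t. f t - mean h f t) \<in> B)) \<longleftrightarrow>
      ((\<forall>s>0. dist_diff s (regular scl f) \<in> B) \<longrightarrow>
       (\<forall>h>0. (\<lambda>\<phi>. regular scl f \<phi> - dist_mean h (regular scl f) \<phi>) \<in> B))" if "f \<in> L1loc" for f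
    using regular_diff_op(2)[OF scl that] regular_diff_mean[OF scl that] by auto
  then show ?thesis unfolding Delta_def by auto
qed

text \<open>
  For the inclusion from right to left, integrating \<open>f\<close> supplies a representative in \<open>W1loc n\<close>
  of the given element of \<open>A\<close>.
\<close>

lemma deriv_Loc_eq:
  fixes scl :: "'k::{real_normed_field, banach} \<Rightarrow> 'x::banach \<Rightarrow> 'x"
  assumes scl: "normed_space_over scl" and A: "A \<subseteq> distributions scl" and n: "n \<ge> 1"
  shows "deriv_Loc scl n A = dist_deriv n ` A \<inter> regular scl ` L1loc"
proof (intro equalityI subsetI)
  fix T assume "T \<in> deriv_Loc scl n A"
  then obtain f \<psi> where f: "f \<in> L1loc" "T = regular scl f" and \<psi>: "\<psi> \<in> W1loc n" "regular scl \<psi> \<in> A"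
    "AE t in lebesgue. f t = (vderiv ^^ n) \<psi> t"
    unfolding deriv_Loc_def by blast
  have "dist_deriv n (regular scl \<psi>) = T"
    using dist_deriv_regular_W1loc[OF scl \<psi>(1) n f(1) \<psi>(3)] f(2) by simp
  then show "T \<in> dist_deriv n ` A \<inter> regular scl ` L1loc" using \<psi>(2) f by blast
next
  fix T assume "T \<in> dist_deriv n ` A \<inter> regular scl ` L1loc"
  then obtain S f where S: "S \<in> A" "T = dist_deriv n S" and f: "f \<in> L1loc" "T = regular scl f" by blast
  obtain m where m: "n = Suc m" using n by (cases n) auto
  have "S \<in> distributions scl" using S(1) A by blast
  from dist_deriv_regular_imp_W1loc[OF scl this f(1), of m]
  obtain \<psi> where "\<psi> \<in> W1loc n" "S = regular scl \<psi>" "AE t in lebesgue. f t = (vderiv ^^ n) \<psi> t"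
    using S(2) f(2) m by auto
  then show "T \<in> deriv_Loc scl n A" unfolding deriv_Loc_def using f S(1) by blast
qed

theorem corollary5p3:
  fixes scl :: "'k::{real_normed_field, euclidean_space} \<Rightarrow> 'x::banach \<Rightarrow> 'x"
    and A :: "((real \<Rightarrow> 'k) \<Rightarrow> 'x) set"
    and n :: nat
  assumes "normed_space_over scl"
    and "A \<subseteq> distributions scl"
    and "real_linear A"
    and "positive_invariant A"
    and "\<forall>T\<in>A. \<forall>g\<in>Linf_c. dist_conv T g \<in> A"
    and "n \<ge> 1"
  shows "(Delta' scl A \<longrightarrow>
           (dist_mean_class scl ^^ n) A = class_sum A (dist_deriv n ` A)) \<and>
         (A \<subseteq> regular scl ` L1loc \<and> Delta scl A \<longrightarrow>
           (mean_class scl ^^ n) A = class_sum A (deriv_Loc scl n A))"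
proof (intro conjI impI)
  note conv = conv_invariant_class[OF assms(1,2,3,5)]
  assume D: "Delta' scl A"
  interpret ambient_class scl "distributions scl" by (rule ambient_class_distributions[OF assms(1)])
  interpret averaging_class scl "distributions scl" A
  proof unfold_locales
    show "difference_property A" using D by (simp add: difference_property_def Delta'_def)
  qed (use assms conv in auto)
  have "means_in = dist_mean_class scl" by (simp add: fun_eq_iff means_in_def dist_mean_class_def)
  moreover have "dist_deriv n ` A \<inter> distributions scl = dist_deriv n ` A"
    using dist_deriv_distribution[OF assms(1)] assms(2) by blast
  ultimately show "(dist_mean_class scl ^^ n) A = class_sum A (dist_deriv n ` A)"
    using means_in_pow_eq[of n] by simp
next
  note conv = conv_invariant_class[OF assms(1,2,3,5)]
  assume D: "A \<subseteq> regular scl ` L1loc \<and> Delta scl A"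
  interpret ambient_class scl "regular scl ` L1loc" by (rule ambient_class_regular[OF assms(1)])
  interpret averaging_class scl "regular scl ` L1loc" A
  proof unfold_locales
    show "difference_property A"
      using D Delta_iff[OF assms(1)] by (simp add: difference_property_def)
  qed (use assms conv D in auto)
  have "means_in = mean_class scl" by (simp add: fun_eq_iff means_in_def mean_class_eq[OF assms(1)])
  then show "(mean_class scl ^^ n) A = class_sum A (deriv_Loc scl n A)"
    using means_in_pow_eq[of n] deriv_Loc_eq[OF assms(1,2,6)] by simp
qed

end
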